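(* Let $\mu=p_0\delta_0+\sum_{n=1}^\infty p_n\delta_{a_n}$ with $p_0\ge0$, let $\Phi$ be any dimension function, and put $L=\limsup_{x\to0}\Phi(x)^{-1}$ and $\Psi(x)=\frac{\log|\log x|}{|\log x|}$. (1) (Polynomial-polynomial) Suppose that for all $n\in\mathbb{N}$, $p_n=n^{-\beta}$ and $a_n=n^{-\lambda}$ for some $\beta>1$ and $\lambda>0$, and let $s=\frac{\beta-1}{\lambda}$, $t=\frac{\beta}{\lambda+1}$. If $p_0=0$, then $$\overline{\dim}_\Phi\mu=\begin{cases}\max(1,s)&\text{if }L\ge\lambda,\\ \max(t+L(t-s),s)&\text{if }L\le\lambda,\end{cases}$$ while if $p_0\ne0$, then $$\overline{\dim}_\Phi\mu=\begin{cases}sL+\max(1,s)&\text{if }L\ge\lambda,\\ (1+L)\max(s,t)&\text{if }L\le\lambda.\end{cases}$$ (2) (Exponential-exponential) Suppose that for all $n\in\mathbb{N}$, $p_n=\beta^{-n}$ and $a_n=\lambda^{-n}$ for some $\beta,\lambda>1$. Then $$\overline{\dim}_\Phi\mu=\begin{cases}(1+L)\frac{\log\beta}{\log\lambda}&\text{if }p_0\ne0,\\ \frac{\log\beta}{\log\lambda}&\text{if }p_0=0.\end{cases}$$ (3) (Mixed rates, exponential-polynomial) Suppose that for all $n\in\mathbb{N}$, $p_n=\beta^{-n}$ and $a_n=n^{-\lambda}$ for some $\beta>1$ and $\lambda>0$. Then $\overline{\dim}_\Phi\mu=\infty$. (4) (Mixed rates, polynomial-exponential) Suppose that for all $n\in\mathbb{N}$,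 $p_n=n^{-\beta}$ and $a_n=\lambda^{-n}$ for some $\beta,\lambda>1$. Then $$\overline{\dim}_\Phi\mu=\begin{cases}\limsup_{x\to0}\beta\frac{\Psi(x)}{\Phi(x)}&\text{if }p_0\ne0,\\ \limsup_{x\to0}\frac{\Psi(x)}{\Phi(x)}&\text{if }p_0=0.\end{cases}$$
   Context: $\delta_a$ is the unit point mass at $a$; $\mu$ is a finite Borel measure on $\mathbb{R}$ with support $\{a_n\}_{n\ge1}\cup\{0\}$ (normalizing it to a probability measure does not change its $\Phi$-dimensions). A dimension function is a map $\Phi:(0,1)\to[0,\infty)$ such that $x^{1+\Phi(x)}$ decreases to $0$ as $x$ decreases to $0$. $\overline{\dim}_\Phi\mu$ is the infimum of all $\alpha$ for which there exist $C_1,C_2>0$ such that for all $0<r<R^{1+\Phi(R)}\le R\le C_1$ and all $x\in\mathrm{supp}\,\mu$, $\mu(B(x,R))/\mu(B(x,r))\le C_2(R/r)^\alpha$, where $B(x,R)$ is the open ball. Values in $[0,\infty]$ are allowed, and a quotient of a positive number by $0$ is $\infty$. *)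

theory Defs
  imports "HOL-Probability.Giry_Monad"
begin

(* The measure p0 * delta_0 + (SUM n >= 1. p n * delta_(a n)); the values p 0 and a 0 are not used. *)
definition atomic_measure :: "real \<Rightarrow> (nat \<Rightarrow> real) \<Rightarrow> (nat \<Rightarrow> real) \<Rightarrow> real measure" where
  "atomic_measure p0 p a = measure_of UNIV (sets borel)
     (\<lambda>A. ennreal p0 * emeasure (return borel 0) A
        + (\<Sum>n. ennreal (p (Suc n)) * emeasure (return borel (a (Suc n))) A))"

lemma sets_atomic_measure [simp]: "sets (atomic_measure p0 p a) = sets borel"
  unfolding atomic_measure_def
  using sets.sets_measure_of_eq[of "borel :: real measure"] by (simp only: space_borel)

(* The defining set function is countably additive, so measure_of does not collapse to zero. *)
lemma emeasure_atomic_measure: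
  assumes A: "A \<in> sets borel"
  shows "emeasure (atomic_measure p0 p a) A =
     ennreal p0 * emeasure (return borel 0) A
        + (\<Sum>n. ennreal (p (Suc n)) * emeasure (return borel (a (Suc n))) A)"
  unfolding atomic_measure_def
proof (rule emeasure_measure_of_sigma)
  let ?f = "\<lambda>A. ennreal p0 * emeasure (return borel (0::real)) A
        + (\<Sum>n. ennreal (p (Suc n)) * emeasure (return borel (a (Suc n))) A)"
  show "countably_additive (sets borel) ?f"
  proof (rule countably_additiveI)
    fix F :: "nat \<Rightarrow> real set"
    assume F: "range F \<subseteq> sets borel" and dj: "disjoint_family F"
    have ret: "emeasure (return borel x) (\<Union>i. F i) = (\<Sum>i. emeasure (return borel x) (F i))"
      for x :: real
      using F dj by (intro suminf_emeasure[symmetric]) (simp_all only: sets_return)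
    have swap: "(\<Sum>n. \<Sum>i. g n i) = (\<Sum>i. \<Sum>n. g n i)" for g :: "nat \<Rightarrow> nat \<Rightarrow> ennreal"
      using nn_integral_suminf[of "\<lambda>i n. g n i" "count_space UNIV"]
      by (simp add: nn_integral_count_space_nat)
    have "(\<Sum>i. ?f (F i)) = (\<Sum>i. ennreal p0 * emeasure (return borel 0) (F i))
        + (\<Sum>i. \<Sum>n. ennreal (p (Suc n)) * emeasure (return borel (a (Suc n))) (F i))"
      by (intro suminf_add[symmetric] summableI)
    also have "\<dots> = ?f (\<Union>i. F i)"
      by (subst swap[symmetric]) (simp only: ret ennreal_suminf_cmult)
    finally show "(\<Sum>i. ?f (F i)) = ?f (\<Union>i. F i)" .
  qed
  show "positive (sets borel) ?f"
    unfolding positive_def by (simp only: emeasure_empty mult_zero_right suminf_zero add_0)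
  show "sigma_algebra (UNIV :: real set) (sets borel)"
    using sets.sigma_algebra_axioms[of "borel :: real measure"] by (simp only: space_borel)
qed (rule A)

definition measure_support :: "real measure \<Rightarrow> real set" where
  "measure_support M = {x. \<forall>U. open U \<longrightarrow> x \<in> U \<longrightarrow> emeasure M U > 0}"

(* Weakly decreasing as x decreases; Phi is meaningful on (0,1) only. *)
definition dimension_function :: "(real \<Rightarrow> real) \<Rightarrow> bool" where
  "dimension_function \<Phi> \<longleftrightarrow>
     (\<forall>x\<in>{0<..<1}. \<Phi> x \<ge> 0) \<and>
     mono_on {0<..<1} (\<lambda>x. x powr (1 + \<Phi> x)) \<and>
     ((\<lambda>x. x powr (1 + \<Phi> x)) \<longlongrightarrow> 0) (at_right 0)"

(* C1 < 1 keeps R in the domain (0,1) of Phi. For x in the support and a finite Borel measure M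
   the denominator is positive. The infimum of the empty set is infinity. *)
definition upper_Phi_dim :: "(real \<Rightarrow> real) \<Rightarrow> real measure \<Rightarrow> ereal" where
  "upper_Phi_dim \<Phi> M = Inf (ereal ` {\<alpha>. \<exists>C1 C2. 0 < C1 \<and> C1 < 1 \<and> 0 < C2 \<and>
     (\<forall>r R. \<forall>x\<in>measure_support M.
        0 < r \<longrightarrow> r < R powr (1 + \<Phi> R) \<longrightarrow> R powr (1 + \<Phi> R) \<le> R \<longrightarrow> 0 < R \<longrightarrow> R \<le> C1 \<longrightarrow>
        measure M (ball x R) / measure M (ball x r) \<le> C2 * (R / r) powr \<alpha>)})"

definition Psi :: "real \<Rightarrow> real" where
  "Psi x = ln \<bar>ln x\<bar> / \<bar>ln x\<bar>"

end

theory Submission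
  imports Defs "HOL-Real_Asymp.Real_Asymp"
begin

text \<open>
  Write \<open>mass x r\<close> for the mass of the ball of radius \<open>r\<close> about a point \<open>x\<close> of the support.
  A number \<open>\<alpha>\<close> bounds the dimension if, up to a constant, \<open>mass x R \<le> (R/r)^\<alpha> * mass x r\<close> for all
  small \<open>R\<close> and all \<open>r < R^(1 + \<Phi>(R))\<close>. The function \<open>\<Phi>\<close> enters only through this cutoff, which
  is compared with powers of \<open>R\<close>: for \<open>l > L\<close> it eventually lies below \<open>R^(1 + 1/l)\<close>, so that
  \<open>1/R \<le> (R/r)^l\<close>, while for \<open>l < L\<close> the radius \<open>r = R^(1 + 1/l)\<close> is allowed for arbitrarily small \<open>R\<close>.
  Consequently a bound \<open>mass x R \<le> C (R/r)^u R^(-v) * mass x r\<close>, valid for all \<open>r < R\<close>, shows that the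
  dimension is at most \<open>u + v L\<close> (\<open>dim_le_of_ratio_bound\<close>), and balls that attain the reverse bound at
  \<open>r = R^(1 + 1/l)\<close> show that it is at least \<open>u + v l\<close> (\<open>exponent_ge_of_scaled_ratio_bound\<close>).
  Letting \<open>R\<close> stay fixed while \<open>r\<close> tends to \<open>0\<close> gives lower bounds that do not involve \<open>L\<close>
  (\<open>exponent_ge_of_fixed_ball\<close>). What remains is to estimate these masses.

  Polynomial masses at polynomial positions. The atom \<open>x = a n\<close> has mass \<open>n^(-\<beta>)\<close> and lies at distance about
  \<open>n^(-lam-1)\<close> from its neighbours. A ball about \<open>x\<close> with \<open>r \<le> x\<close> therefore has mass comparable to
  \<open>n^(-\<beta>) max 1 (r n^(lam+1))\<close>, and a ball with \<open>r \<ge> x\<close> has mass comparable to \<open>r^s\<close>, plus \<open>p0\<close> as soon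
  as it contains \<open>0\<close>. The lightest balls of radius \<open>r\<close> are the ones near \<open>0\<close>, of mass \<open>r^s\<close>, or those about
  the atoms whose distance to the neighbours is about \<open>r\<close>, of mass \<open>r^t\<close>; the latter are of smaller order
  exactly if \<open>s < 1\<close>. The pairs \<open>(u, v)\<close> that result, with the ranges in which test balls attain them, are

  \<^item> \<open>(max 1 s, 0)\<close> if \<open>p0 = 0\<close>, where \<open>s\<close> comes from balls near \<open>0\<close> and \<open>1\<close> is the limit of the next pair as \<open>l\<close> tends to \<open>lam\<close>;
  \<^item> \<open>(t, t - s)\<close> if \<open>p0 = 0\<close> and \<open>s \<le> 1\<close>, attained for \<open>l < lam\<close>;
  \<^item> \<open>(q, q)\<close> with \<open>q = max s t\<close>, attained for \<open>p0 > 0\<close> if \<open>q = s\<close> or \<open>l < lam\<close>;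
  \<^item> \<open>(1, s)\<close> if \<open>s \<le> 1\<close>, attained for \<open>p0 > 0\<close> and \<open>l > lam\<close>.

  The value \<open>lam\<close> separates the two regimes because an isolated test ball of radius \<open>R^(1 + 1/l)\<close> has its centre near
  \<open>R^((1 + 1/l) lam / (lam + 1))\<close>, which is less than \<open>R\<close> exactly if \<open>l < lam\<close>. At \<open>L = lam\<close> the formulas agree,
  since \<open>t (1 + lam) = \<beta> = 1 + s lam\<close>.

  Exponential masses at exponential positions. Here \<open>p n\<close> is the power \<open>s = ln \<beta> / ln lam\<close> of \<open>a n\<close>, and \<open>mass x r\<close> is
  comparable to \<open>(max x r)^s\<close>, apart from the atom at \<open>0\<close>. The pairs are \<open>(s, 0)\<close> without that atom and
  \<open>(s, s)\<close> with it.

  Exponential masses at polynomial positions. Balls about \<open>a n\<close> whose radius is a small multiple of \<open>n^(-lam-1)\<close> have mass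
  \<open>\<beta>^(-n)\<close>, which is smaller than any power of the radius, so no finite exponent is possible.

  Polynomial masses at exponential positions. Masses are powers of logarithms: \<open>mass x r\<close> is at least of order
  \<open>|ln r|^(-\<beta>)\<close>, and a ball of radius \<open>R\<close> that contains more than one atom has mass at most of order
  \<open>p0 + |ln R|^(1-\<beta>)\<close>. The ratio is thus at most of order \<open>|ln R|^K\<close> times a power of \<open>1 + ln (R/r)\<close>, where \<open>K = 1\<close>
  without and \<open>K = \<beta>\<close> with the atom at \<open>0\<close>. The second factor is below every power of \<open>R/r\<close>, and \<open>|ln R|^K\<close>
  becomes a power of \<open>R/r\<close> by the same comparison of scales, with \<open>1/\<Phi>\<close> replaced by \<open>Psi/\<Phi>\<close>.
\<close>

section \<open>Exponents that bound the dimension\<close>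


text \<open>
  The requirement in the definition of the dimension with the quotient multiplied out and the constant \<open>C1\<close>
  absorbed into the filter. In this form upper bounds on the cutoff and estimates of masses, which hold for all
  sufficiently small \<open>R\<close>, combine by filter reasoning.
\<close>
definition controls :: "(real \<Rightarrow> real) \<Rightarrow> real measure \<Rightarrow> real \<Rightarrow> bool" where
  "controls \<Phi> M \<alpha> \<longleftrightarrow>
     (\<exists>C>0. \<forall>\<^sub>F R in at_right 0. \<forall>r. \<forall>x\<in>measure_support M.
        0 < r \<longrightarrow> r < R powr (1 + \<Phi> R) \<longrightarrow>
        measure M (ball x R) \<le> C * (R / r) powr \<alpha> * measure M (ball x r))"

lemma measure_ball_pos:
  assumes "finite_measure M" "x \<in> measure_support M" "0 < r"
  shows "0 < measure M (ball x r)"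
proof -
  have "0 < emeasure M (ball x r)"
    using assms(2,3) by (auto simp: measure_support_def)
  then show ?thesis
    using finite_measure.emeasure_eq_measure[OF assms(1)] by simp
qed

lemma eventually_at_right_0_less:
  fixes b :: real assumes "0 < b" shows "\<forall>\<^sub>F R in at_right 0. 0 < R \<and> R < b"
  using assms by (auto simp: eventually_at_right intro!: exI[of _ b])

lemma powr_one_plus_le:
  assumes "dimension_function \<Phi>" "0 < R" "R < 1"
  shows "R powr (1 + \<Phi> R) \<le> R"
proof -
  have "\<Phi> R \<ge> 0" using assms by (auto simp: dimension_function_def)
  then have "R powr (1 + \<Phi> R) \<le> R powr 1" using assms by (intro powr_mono') auto
  then show ?thesis using assms by simp
qed

lemma upper_Phi_dim_eq_Inf_controls:
  assumes M: "finite_measure M" and \<Phi>: "dimension_function \<Phi>"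
  shows "upper_Phi_dim \<Phi> M = Inf (ereal ` {\<alpha>. controls \<Phi> M \<alpha>})"
proof -
  have "(\<exists>C1 C2. 0 < C1 \<and> C1 < 1 \<and> 0 < C2 \<and>
     (\<forall>r R. \<forall>x\<in>measure_support M.
        0 < r \<longrightarrow> r < R powr (1 + \<Phi> R) \<longrightarrow> R powr (1 + \<Phi> R) \<le> R \<longrightarrow> 0 < R \<longrightarrow> R \<le> C1 \<longrightarrow>
        measure M (ball x R) / measure M (ball x r) \<le> C2 * (R / r) powr \<alpha>)) \<longleftrightarrow> controls \<Phi> M \<alpha>"
    (is "?l \<longleftrightarrow> ?r") for \<alpha>
  proof
    assume ?l
    then obtain C1 C2 where C: "0 < C1" "C1 < 1" "0 < C2"
      and *: "\<And>r R x. x \<in> measure_support M \<Longrightarrow> 0 < r \<Longrightarrow> r < R powr (1 + \<Phi> R) \<Longrightarrow>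
         R powr (1 + \<Phi> R) \<le> R \<Longrightarrow> 0 < R \<Longrightarrow> R \<le> C1 \<Longrightarrow>
         measure M (ball x R) / measure M (ball x r) \<le> C2 * (R / r) powr \<alpha>" by blast
    show ?r unfolding controls_def
    proof (intro exI[of _ C2] conjI C(3) eventually_mono[OF eventually_at_right_0_less[OF C(1)]] allI ballI impI)
      fix R r x assume A: "0 < R \<and> R < C1" "x \<in> measure_support M" "0 < r" "r < R powr (1 + \<Phi> R)"
      then have "measure M (ball x R) / measure M (ball x r) \<le> C2 * (R / r) powr \<alpha>"
        using * powr_one_plus_le[OF \<Phi>, of R] C by auto
      then show "measure M (ball x R) \<le> C2 * (R / r) powr \<alpha> * measure M (ball x r)"
        using measure_ball_pos[OF M A(2,3)] by (simp add: divide_le_eq)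
    qed
  next
    assume ?r
    then obtain C where "0 < C" and ev: "\<forall>\<^sub>F R in at_right 0. \<forall>r. \<forall>x\<in>measure_support M.
        0 < r \<longrightarrow> r < R powr (1 + \<Phi> R) \<longrightarrow>
        measure M (ball x R) \<le> C * (R / r) powr \<alpha> * measure M (ball x r)"
      unfolding controls_def by blast
    from ev obtain b where b: "0 < b" "\<And>R r x. 0 < R \<Longrightarrow> R < b \<Longrightarrow> x \<in> measure_support M \<Longrightarrow>
        0 < r \<Longrightarrow> r < R powr (1 + \<Phi> R) \<Longrightarrow>
        measure M (ball x R) \<le> C * (R / r) powr \<alpha> * measure M (ball x r)"
      unfolding eventually_at_right[OF zero_less_one] by auto
    show ?l
    proof (rule exI[of _ "min (b/2) (1/2)"], rule exI[of _ C], intro conjI allI ballI impI)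
      fix r R x assume A: "x \<in> measure_support M" "0 < r" "r < R powr (1 + \<Phi> R)" "0 < R"
        "R \<le> min (b / 2) (1 / 2)"
      have "measure M (ball x R) \<le> C * (R / r) powr \<alpha> * measure M (ball x r)"
        using A b(1) by (intro b(2)) auto
      then show "measure M (ball x R) / measure M (ball x r) \<le> C * (R / r) powr \<alpha>"
        using measure_ball_pos[OF M A(1,2)] by (simp add: divide_le_eq)
    qed (use b \<open>0 < C\<close> in auto)
  qed
  then show ?thesis unfolding upper_Phi_dim_def by simp
qed

lemma upper_Phi_dim_le:
  assumes "finite_measure M" "dimension_function \<Phi>" "controls \<Phi> M \<alpha>"
  shows "upper_Phi_dim \<Phi> M \<le> ereal \<alpha>"
  using assms by (auto simp: upper_Phi_dim_eq_Inf_controls intro: Inf_lower)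

lemma upper_Phi_dim_ge:
  assumes "finite_measure M" "dimension_function \<Phi>" "\<And>\<alpha>. controls \<Phi> M \<alpha> \<Longrightarrow> D \<le> ereal \<alpha>"
  shows "D \<le> upper_Phi_dim \<Phi> M"
  using assms by (auto simp: upper_Phi_dim_eq_Inf_controls intro: Inf_greatest)

text \<open>
  The weight \<open>g\<close> is the constant \<open>1\<close> where masses are powers of the radius, which gives the number \<open>L\<close>,
  and \<open>Psi\<close> where they are powers of its logarithm.
\<close>
definition Phi_rate :: "(real \<Rightarrow> real) \<Rightarrow> (real \<Rightarrow> real) \<Rightarrow> ereal" where
  "Phi_rate g \<Phi> = Limsup (at_right 0) (\<lambda>x. ereal (g x) / ereal (\<Phi> x))"

lemma eventually_Phi_nonneg:
  assumes "dimension_function \<Phi>"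
  shows "\<forall>\<^sub>F R in at_right 0. 0 \<le> \<Phi> R"
  using assms by (intro eventually_mono[OF eventually_at_right_0_less[of 1]]) (auto simp: dimension_function_def)

text \<open>
  This lemma and the next one translate inequalities for the upper limit into inequalities between the
  cutoff \<open>R^(1 + \<Phi>(R))\<close> and an explicit radius: eventually from above, and for arbitrarily small \<open>R\<close> from below.
  Where \<open>\<Phi>\<close> vanishes the quotient is infinite, so the first case excludes such points and the second one contains them.
\<close>
lemma Phi_rate_lessD:
  assumes \<Phi>: "dimension_function \<Phi>" and l: "Phi_rate g \<Phi> < ereal l" "0 < l"
    and g: "\<forall>\<^sub>F x in at_right 0. 0 < g x"
  shows "\<forall>\<^sub>F R in at_right 0. R powr (1 + \<Phi> R) \<le> R powr (1 + g R / l)"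
proof -
  have "\<forall>\<^sub>F R in at_right 0. ereal (g R) / ereal (\<Phi> R) < ereal l"
    using l(1) unfolding Phi_rate_def by (rule Limsup_lessD)
  then show ?thesis
    using g eventually_Phi_nonneg[OF \<Phi>] eventually_at_right_0_less[of 1, OF zero_less_one]
  proof eventually_elim
    case (elim R)
    have "\<Phi> R \<noteq> 0" using elim by (auto simp: divide_ereal_def)
    then have "g R / l \<le> \<Phi> R" using elim l by (auto simp: field_simps)
    then show ?case using elim by (intro powr_mono') auto
  qed
qed

lemma less_Phi_rateD:
  assumes \<Phi>: "dimension_function \<Phi>" and l: "ereal l < Phi_rate g \<Phi>" "0 < l"
    and g: "\<forall>\<^sub>F x in at_right 0. 0 < g x"
  shows "\<exists>\<^sub>F R in at_right 0. R powr (1 + g R / l) < R powr (1 + \<Phi> R)"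
proof -
  have "\<not> (\<forall>\<^sub>F R in at_right 0. ereal (g R) / ereal (\<Phi> R) \<le> ereal l)"
    using l(1) Limsup_bounded[of "\<lambda>R. ereal (g R) / ereal (\<Phi> R)" "ereal l" "at_right 0"]
    unfolding Phi_rate_def not_le[symmetric] by blast
  then have "\<exists>\<^sub>F R in at_right 0. ereal l < ereal (g R) / ereal (\<Phi> R)"
    by (simp add: frequently_def not_less)
  moreover have "\<forall>\<^sub>F R in at_right 0. ereal l < ereal (g R) / ereal (\<Phi> R) \<longrightarrow>
      R powr (1 + g R / l) < R powr (1 + \<Phi> R)"
    using g eventually_Phi_nonneg[OF \<Phi>] eventually_at_right_0_less[of 1, OF zero_less_one]
  proof (eventually_elim, intro impI)
    fix R assume R: "ereal l < ereal (g R) / ereal (\<Phi> R)" "0 < g R" "0 \<le> \<Phi> R" "0 < R \<and> R < 1"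
    have "\<Phi> R < g R / l"
    proof (cases "\<Phi> R = 0")
      case False
      then have "l < g R / \<Phi> R" "0 < \<Phi> R" using R by auto
      then show ?thesis using l(2) by (simp add: field_simps)
    qed (use R l(2) in auto)
    then show "R powr (1 + g R / l) < R powr (1 + \<Phi> R)" using R by (intro powr_less_mono') auto
  qed
  ultimately show ?thesis by (rule frequently_rev_mp)
qed

lemma Phi_rate_nonneg:
  assumes "dimension_function \<Phi>" "\<forall>\<^sub>F x in at_right 0. 0 < g x"
  shows "0 \<le> Phi_rate g \<Phi>"
  unfolding Phi_rate_def
proof (rule le_Limsup)
  show "\<forall>\<^sub>F x in at_right 0. 0 \<le> ereal (g x) / ereal (\<Phi> x)"
    using assms(2) eventually_Phi_nonneg[OF assms(1)]
    by eventually_elim (auto simp: divide_ereal_def)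
qed auto

lemma frequently_const_le_powr:
  fixes c C e :: real
  assumes "\<exists>\<^sub>F x in at_right 0. c \<le> C * x powr e" "0 < c" "0 < C"
  shows "e \<le> 0"
proof (rule ccontr)
  assume "\<not> e \<le> 0"
  then have "((\<lambda>x::real. C * x powr e) \<longlongrightarrow> 0) (at_right 0)" using \<open>0 < C\<close> by real_asymp
  then have "\<forall>\<^sub>F x in at_right 0. C * x powr e < c" using \<open>0 < c\<close> by (simp add: order_tendstoD)
  then show False using assms(1) by (simp add: frequently_def not_le)
qed

lemma powr_ratio_eq:
  assumes "0 < (R::real)" "0 < l"
  shows "R / R powr (1 + 1 / l) = R powr (- (1/l))"
  using assms by (simp add: powr_add powr_minus divide_inverse)

text \<open>
  For \<open>l\<close> larger than the upper limit, every allowed \<open>r\<close> satisfies \<open>1/R \<le> (R/r)^l\<close>, so that the factor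
  \<open>R^(-v)\<close> costs at most \<open>(R/r)^(v l)\<close>. Splitting the bound into the two powers keeps the mass estimates free of \<open>\<Phi>\<close>.
\<close>
lemma dim_le_of_ratio_bound:
  assumes M: "finite_measure M" and \<Phi>: "dimension_function \<Phi>" and C: "0 < C" and v: "0 \<le> v"
    and ev: "\<forall>\<^sub>F R in at_right 0. \<forall>r x. 0 < r \<longrightarrow> r < R \<longrightarrow> x \<in> measure_support M \<longrightarrow>
       measure M (ball x R) \<le> C * (R / r) powr u * R powr (- v) * measure M (ball x r)"
  shows "upper_Phi_dim \<Phi> M \<le> ereal u + ereal v * Phi_rate (\<lambda>_. 1) \<Phi>"
proof (cases "v = 0")
  case True
  have "controls \<Phi> M u" unfolding controls_def
    using ev eventually_at_right_0_less[of 1, OF zero_less_one]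
  proof (intro exI[of _ C] conjI C, eventually_elim, intro allI ballI impI)
    fix R r x assume "0 < R \<and> R < 1" "x \<in> measure_support M" "0 < r" "r < R powr (1 + \<Phi> R)"
     and *: "\<forall>r x. 0 < r \<longrightarrow> r < R \<longrightarrow> x \<in> measure_support M \<longrightarrow>
       measure M (ball x R) \<le> C * (R / r) powr u * R powr (- v) * measure M (ball x r)"
    then show "measure M (ball x R) \<le> C * (R / r) powr u * measure M (ball x r)"
      using powr_one_plus_le[OF \<Phi>, of R] *[rule_format, of r x] True by simp
  qed
  then show ?thesis using upper_Phi_dim_le[OF M \<Phi>] True by (simp flip: zero_ereal_def)
next
  case False
  with v have v: "v > 0" by simp
  show ?thesis
  proof (cases "Phi_rate (\<lambda>_. 1) \<Phi>")
    case PInf then show ?thesis using v by simp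
  next
    case MInf then show ?thesis using Phi_rate_nonneg[OF \<Phi>, of "\<lambda>_. 1"] by simp
  next
    case (real L)
    have "0 \<le> L" using Phi_rate_nonneg[OF \<Phi>, of "\<lambda>_. 1"] real by simp
    have "upper_Phi_dim \<Phi> M \<le> ereal (u + v * L) + ereal e" if e: "0 < e" for e
    proof -
      \<comment> \<open>Chosen so that \<open>u + v l\<close> exceeds the claimed bound by exactly \<open>e\<close>.\<close>
      define l where "l = L + e / v"
      have l: "0 < l" "L < l" using e v \<open>0 \<le> L\<close> by (auto simp: l_def add_nonneg_pos)
      have "controls \<Phi> M (u + v * l)" unfolding controls_def
        using ev eventually_at_right_0_less[of 1, OF zero_less_one]
          Phi_rate_lessD[OF \<Phi>, of "\<lambda>_. 1" l, unfolded real, simplified, OF l(2,1)]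
      proof (intro exI[of _ C] conjI C, eventually_elim, intro allI ballI impI)
        fix R r x assume R: "0 < R \<and> R < 1" and A: "x \<in> measure_support M" "0 < r" "r < R powr (1 + \<Phi> R)"
         and *: "\<forall>r x. 0 < r \<longrightarrow> r < R \<longrightarrow> x \<in> measure_support M \<longrightarrow>
           measure M (ball x R) \<le> C * (R / r) powr u * R powr (- v) * measure M (ball x r)"
         and B: "R powr (1 + \<Phi> R) \<le> R powr (1 + 1 / l)"
        have "R powr (-(1/l)) \<le> R / r"
          unfolding powr_ratio_eq[of R l, OF R[THEN conjunct1] l(1), symmetric]
          using A B R by (intro divide_left_mono) auto
        then have "(R powr (-(1/l))) powr (v * l) \<le> (R / r) powr (v * l)"
          using v l by (intro powr_mono2) auto
        then have "R powr (-v) \<le> (R / r) powr (v * l)"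
          using l by (simp add: powr_powr)
        then have "C * (R / r) powr u * R powr (- v) * measure M (ball x r) \<le>
           C * (R / r) powr u * (R / r) powr (v * l) * measure M (ball x r)"
          using C by (intro mult_mono) auto
        moreover have "r < R" using A powr_one_plus_le[OF \<Phi>, of R] R by auto
        ultimately show "measure M (ball x R) \<le> C * (R / r) powr (u + v * l) * measure M (ball x r)"
          using *[rule_format, of r x] A by (simp add: powr_add mult.assoc)
      qed
      then have "upper_Phi_dim \<Phi> M \<le> ereal (u + v * l)" by (rule upper_Phi_dim_le[OF M \<Phi>])
      also have "u + v * l = (u + v * L) + e" using v by (simp add: l_def field_simps)
      finally show ?thesis by simp
    qed
    then have "upper_Phi_dim \<Phi> M \<le> ereal (u + v * L)" by (rule ereal_le_epsilon2)
    then show ?thesis using real by simp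
  qed
qed

text \<open>
  The converse: at the radius \<open>r = R^(1 + 1/l)\<close>, which is below the cutoff for arbitrarily small \<open>R\<close>, both \<open>R/r\<close> and
  \<open>R^(-v)\<close> are powers of \<open>R\<close>, and comparing exponents as \<open>R\<close> tends to \<open>0\<close> gives the inequality.
\<close>
lemma exponent_ge_of_scaled_ratio_bound:
  assumes M: "finite_measure M" and \<Phi>: "dimension_function \<Phi>" and "controls \<Phi> M \<alpha>"
    and l: "0 < l" "ereal l < Phi_rate (\<lambda>_. 1) \<Phi>" and c: "0 < c"
    and ev: "\<forall>\<^sub>F R in at_right 0. \<exists>x\<in>measure_support M.
       c * (R / R powr (1 + 1/l)) powr u * R powr (- v) * measure M (ball x (R powr (1 + 1/l)))
         \<le> measure M (ball x R)"
  shows "u + v * l \<le> \<alpha>"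
proof -
  obtain C where C: "0 < C" and evC: "\<forall>\<^sub>F R in at_right 0. \<forall>r. \<forall>x\<in>measure_support M.
        0 < r \<longrightarrow> r < R powr (1 + \<Phi> R) \<longrightarrow>
        measure M (ball x R) \<le> C * (R / r) powr \<alpha> * measure M (ball x r)"
    using \<open>controls \<Phi> M \<alpha>\<close> unfolding controls_def by blast
  have "\<forall>\<^sub>F R in at_right 0. R powr (1 + 1 / l) < R powr (1 + \<Phi> R) \<longrightarrow> c \<le> C * R powr ((u + v * l - \<alpha>) / l)"
    using ev evC eventually_at_right_0_less[of 1, OF zero_less_one]
  proof (eventually_elim, intro impI)
    fix R assume "\<exists>x\<in>measure_support M.
       c * (R / R powr (1 + 1/l)) powr u * R powr (- v) * measure M (ball x (R powr (1 + 1/l)))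
         \<le> measure M (ball x R)" and *: "\<forall>r. \<forall>x\<in>measure_support M.
        0 < r \<longrightarrow> r < R powr (1 + \<Phi> R) \<longrightarrow>
        measure M (ball x R) \<le> C * (R / r) powr \<alpha> * measure M (ball x r)"
     and R: "0 < R \<and> R < 1" and r: "R powr (1 + 1/l) < R powr (1 + \<Phi> R)"
    then obtain x where x: "x \<in> measure_support M"
       "c * (R / R powr (1 + 1/l)) powr u * R powr (- v) * measure M (ball x (R powr (1 + 1/l)))
         \<le> measure M (ball x R)" by blast
    let ?m = "measure M (ball x (R powr (1 + 1/l)))"
    have m: "0 < ?m" using R by (intro measure_ball_pos[OF M x(1)]) auto
    have "c * (R / R powr (1 + 1/l)) powr u * R powr (- v) * ?m \<le> C * (R / R powr (1 + 1/l)) powr \<alpha> * ?m"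
      using *[rule_format, OF x(1) _ r] x(2) R by simp
    then have "c * (R / R powr (1 + 1/l)) powr u * R powr (- v) \<le> C * (R / R powr (1 + 1/l)) powr \<alpha>"
      using m by simp
    then have "c * (R powr (- (1/l) * u) * R powr (- v)) \<le> C * R powr (- (1/l) * \<alpha>)"
      using R l by (simp only: powr_ratio_eq powr_powr mult.assoc)
    then have "c * (R powr (- (1/l) * u) * R powr (- v)) * R powr ((1/l)*u + v) \<le> C * R powr (- (1/l) * \<alpha>) * R powr ((1/l)*u + v)"
      by (intro mult_right_mono) auto
    moreover have "R powr (- (1/l) * u) * R powr (- v) * R powr ((1/l)*u + v) = 1"
      using R by (simp flip: powr_add)
    moreover have "R powr (- (1/l) * \<alpha>) * R powr ((1/l)*u + v) = R powr ((u + v * l - \<alpha>) / l)"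
      using l by (simp flip: powr_add add: add_divide_distrib diff_divide_distrib)
    ultimately show "c \<le> C * R powr ((u + v * l - \<alpha>) / l)" by (simp add: mult.assoc)
  qed
  with less_Phi_rateD[OF \<Phi> l(2,1)] have "\<exists>\<^sub>F R in at_right 0. c \<le> C * R powr ((u + v * l - \<alpha>) / l)"
    by (rule frequently_rev_mp) simp
  then have "(u + v * l - \<alpha>) / l \<le> 0" by (rule frequently_const_le_powr[OF _ c C])
  then show ?thesis using l by (simp add: divide_le_0_iff)
qed

text \<open>
  For a fixed \<open>R\<close> all sufficiently small \<open>r\<close> are allowed, whatever \<open>\<Phi>\<close> is. This is the only source of lower
  bounds when the upper limit \<open>L\<close> is \<open>0\<close>.
\<close>
lemma exponent_ge_of_fixed_ball:
  assumes M: "finite_measure M" and \<Phi>: "dimension_function \<Phi>" and "controls \<Phi> M \<alpha>"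
    and ev: "\<forall>\<^sub>F R in at_right 0. \<exists>c>0. \<exists>\<^sub>F r in at_right 0. \<exists>x\<in>measure_support M.
       c * r powr (- u) * measure M (ball x r) \<le> measure M (ball x R)"
  shows "u \<le> \<alpha>"
proof -
  obtain C where C: "0 < C" and evC: "\<forall>\<^sub>F R in at_right 0. \<forall>r. \<forall>x\<in>measure_support M.
        0 < r \<longrightarrow> r < R powr (1 + \<Phi> R) \<longrightarrow>
        measure M (ball x R) \<le> C * (R / r) powr \<alpha> * measure M (ball x r)"
    using \<open>controls \<Phi> M \<alpha>\<close> unfolding controls_def by blast
  from eventually_happens'[OF trivial_limit_at_right_real[of "0::real"]
      eventually_conj[OF evC eventually_conj[OF ev eventually_at_right_0_less[of 1, OF zero_less_one]]]]
  obtain R where R: "0 < R" and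
    ev_c: "\<exists>c>0. \<exists>\<^sub>F r in at_right 0. \<exists>x\<in>measure_support M.
       c * r powr (- u) * measure M (ball x r) \<le> measure M (ball x R)"
    and *: "\<And>r x. x \<in> measure_support M \<Longrightarrow> 0 < r \<Longrightarrow> r < R powr (1 + \<Phi> R) \<Longrightarrow>
        measure M (ball x R) \<le> C * (R / r) powr \<alpha> * measure M (ball x r)" by blast
  from ev_c obtain c where c: "0 < c" and ev_r: "\<exists>\<^sub>F r in at_right 0. \<exists>x\<in>measure_support M.
       c * r powr (- u) * measure M (ball x r) \<le> measure M (ball x R)" by blast
  have "\<exists>\<^sub>F r in at_right 0. c \<le> (C * R powr \<alpha>) * r powr (u - \<alpha>)"
  proof (rule frequently_rev_mp[OF ev_r],
      rule eventually_mono[OF eventually_at_right_0_less[of "R powr (1 + \<Phi> R)"]], goal_cases)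
    case 1 show ?case using R by simp
  next
    case (2 r) show ?case
    proof
    from 2 have r: "0 < r \<and> r < R powr (1 + \<Phi> R)" .
    assume "\<exists>x\<in>measure_support M. c * r powr (- u) * measure M (ball x r) \<le> measure M (ball x R)"
    then obtain x where x: "x \<in> measure_support M" "c * r powr (- u) * measure M (ball x r) \<le> measure M (ball x R)"
      by blast
    have "c * r powr (- u) * measure M (ball x r) \<le> C * (R / r) powr \<alpha> * measure M (ball x r)"
      using *[OF x(1)] r x(2) by fastforce
    then have "c * r powr (- u) \<le> C * (R / r) powr \<alpha>"
      using measure_ball_pos[OF M x(1), of r] r by simp
    then have "c * r powr (- u) * r powr u \<le> C * (R / r) powr \<alpha> * r powr u"
      by (intro mult_right_mono) auto
    then show "c \<le> (C * R powr \<alpha>) * r powr (u - \<alpha>)"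
      using r R by (simp add: powr_divide powr_diff powr_minus field_simps)
    qed
  qed
  then have "u - \<alpha> \<le> 0" by (rule frequently_const_le_powr[OF _ c]) (use C R in auto)
  then show ?thesis by simp
qed

text \<open>
  Passing to the limit \<open>l \<rightarrow> L\<close>, where \<open>L\<close> may be infinite. The hypothesis may be known only for \<open>l > l0\<close>;
  for \<open>L = 0\<close> there is no such \<open>l\<close>, and \<open>u \<le> \<alpha>\<close> takes its place.
\<close>
lemma ereal_add_mult_le:
  fixes L :: ereal and u v \<alpha> :: real
  assumes "0 \<le> L" "0 \<le> v" "u \<le> \<alpha>" "0 \<le> l0" "l0 < L \<or> L = 0"
    and le: "\<And>l. 0 < l \<Longrightarrow> l0 < ereal l \<Longrightarrow> ereal l < L \<Longrightarrow> u + v * l \<le> \<alpha>"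
  shows "ereal u + ereal v * L \<le> ereal \<alpha>"
proof (cases "v = 0 \<or> L = 0")
  case True
  then show ?thesis using assms(3) by (auto simp flip: zero_ereal_def)
next
  case False
  then have L0: "l0 < L" "0 < v" using assms by auto
  have *: "ereal u + ereal v * l \<le> ereal \<alpha>" if l: "l0 < l" "l < L" for l
  proof -
    obtain l' where l': "l = ereal l'" using l assms(4) by (cases l) auto
    moreover have "0 < l'" using l assms(4) l' order.strict_trans1[of 0 l0 l] by simp
    ultimately show ?thesis using le[of l'] l by simp
  qed
  have le': "l \<le> ereal ((\<alpha> - u) / v)" if l: "l0 < l" "l < L" for l
  proof -
    obtain l' where l': "l = ereal l'" using l assms(4) by (cases l) auto
    then show ?thesis using *[OF l] L0 by (auto simp: field_simps)
  qed
  have "L \<le> ereal ((\<alpha> - u) / v)"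
    using L0(1) le' by (rule dense_le_bounded)
  then show ?thesis using assms(1) L0(2) by (cases L) (auto simp: field_simps)
qed


section \<open>Measures with atoms accumulating at the origin\<close>
locale atomic_masses =
  fixes p0 :: real and p a :: "nat \<Rightarrow> real"
  assumes p0_nonneg: "0 \<le> p0"
    and p_pos: "\<And>n. 1 \<le> n \<Longrightarrow> 0 < p n"
    and p_summable: "summable (\<lambda>n. p (Suc n))"
    and a_pos: "\<And>n. 1 \<le> n \<Longrightarrow> 0 < a n"
    and a_tendsto_0: "a \<longlonglongrightarrow> 0"
begin

abbreviation "M \<equiv> atomic_measure p0 p a"
abbreviation "mass x r \<equiv> measure M (ball x r)"

lemma summable_restricted_mass: "summable (\<lambda>n. p (Suc n) * indicator A (a (Suc n)))"
proof (rule summable_comparison_test[OF _ p_summable], intro exI[of _ 0] allI impI)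
  show "norm (p (Suc n) * indicator A (a (Suc n))) \<le> p (Suc n)" for n
    using p_pos[of "Suc n"] by (simp add: indicator_def)
qed

lemma restricted_mass_nonneg: "0 \<le> p (Suc n) * indicator A (a (Suc n))"
  using p_pos[of "Suc n"] by (simp add: indicator_def)

lemma emeasure_M:
  assumes "A \<in> sets borel"
  shows "emeasure M A = ennreal (p0 * indicator A 0 + (\<Sum>n. p (Suc n) * indicator A (a (Suc n))))"
proof -
  have "(\<Sum>n. ennreal (p (Suc n)) * emeasure (return borel (a (Suc n))) A) =
      (\<Sum>n. ennreal (p (Suc n) * indicator A (a (Suc n))))"
    using assms by (intro arg_cong[of _ _ suminf] ext) (auto simp: indicator_def)
  also have "\<dots> = ennreal (\<Sum>n. p (Suc n) * indicator A (a (Suc n)))"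
    by (rule suminf_ennreal2[OF restricted_mass_nonneg summable_restricted_mass])
  finally have *: "(\<Sum>n. ennreal (p (Suc n)) * emeasure (return borel (a (Suc n))) A) =
    ennreal (\<Sum>n. p (Suc n) * indicator A (a (Suc n)))" .
  show ?thesis unfolding emeasure_atomic_measure[OF assms] *
    using assms p0_nonneg suminf_nonneg[OF summable_restricted_mass restricted_mass_nonneg, of A]
    by (subst ennreal_plus) (auto simp: indicator_def)
qed

lemma measure_M:
  assumes "A \<in> sets borel"
  shows "measure M A = p0 * indicator A 0 + (\<Sum>n. p (Suc n) * indicator A (a (Suc n)))"
  using p0_nonneg suminf_nonneg[OF summable_restricted_mass restricted_mass_nonneg, of A]
  by (simp add: measure_def emeasure_M[OF assms] del: ennreal_plus)

lemma finite_M: "finite_measure M"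
proof
  have "space M = UNIV" using sets_eq_imp_space_eq[of M borel] by simp
  then show "emeasure M (space M) \<noteq> \<infinity>" by (simp add: emeasure_M)
qed

text \<open>
  Apart from the atom at \<open>0\<close>, the mass of a set is the supremum of the sums of \<open>p\<close> over finite sets of indices of
  atoms in it. This lemma and the next one state the two halves of this, and all estimates of masses go through them.
\<close>
lemma measure_M_ge:
  assumes "A \<in> sets borel" "finite F" "F \<subseteq> {1..}" "a ` F \<subseteq> A"
  shows "p0 * indicator A 0 + sum p F \<le> measure M A"
proof -
  define G where "G = {n. Suc n \<in> F}"
  have F: "F = Suc ` G"
  proof -
    have "n \<in> Suc ` G" if "n \<in> F" for n
    proof -
      have "n = Suc (n - 1)" using that assms(3) by auto
      then show ?thesis using that unfolding G_def by (metis image_eqI mem_Collect_eq)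
    qed
    then show ?thesis by (auto simp: G_def)
  qed
  have "finite G" unfolding G_def using finite_vimageI[OF assms(2), of Suc] by (simp add: vimage_def)
  have "sum p F = (\<Sum>n\<in>G. p (Suc n))" unfolding F by (subst sum.reindex) auto
  also have "\<dots> = (\<Sum>n\<in>G. p (Suc n) * indicator A (a (Suc n)))"
    using assms(4) by (intro sum.cong) (auto simp: indicator_def G_def)
  also have "\<dots> \<le> (\<Sum>n. p (Suc n) * indicator A (a (Suc n)))"
    using \<open>finite G\<close> restricted_mass_nonneg by (intro sum_le_suminf summable_restricted_mass) auto
  finally show ?thesis unfolding measure_M[OF assms(1)] by simp
qed

lemma measure_M_le:
  assumes "A \<in> sets borel"
    and le: "\<And>F. finite F \<Longrightarrow> F \<subseteq> {1..} \<Longrightarrow> a ` F \<subseteq> A \<Longrightarrow> sum p F \<le> B"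
  shows "measure M A \<le> p0 * indicator A 0 + B"
proof -
  have "(\<Sum>n. p (Suc n) * indicator A (a (Suc n))) \<le> B"
  proof (rule suminf_le_const[OF summable_restricted_mass])
    fix n
    have "(\<Sum>k<n. p (Suc k) * indicator A (a (Suc k))) = (\<Sum>k\<in>{1..n}. p k * indicator A (a k))"
      by (rule sum.reindex_bij_witness[of _ "\<lambda>k. k - 1" Suc]) auto
    also have "\<dots> = sum p {k\<in>{1..n}. a k \<in> A}"
      by (rule sum.mono_neutral_cong_right) (auto simp: indicator_def)
    also have "\<dots> \<le> B" by (rule le) auto
    finally show "(\<Sum>k<n. p (Suc k) * indicator A (a (Suc k))) \<le> B" .
  qed
  then show ?thesis unfolding measure_M[OF assms(1)] by simp
qed

lemma sum_le_measure_M: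
  assumes "A \<in> sets borel" "finite F" "F \<subseteq> {1..}" "a ` F \<subseteq> A"
  shows "sum p F \<le> measure M A"
  using measure_M_ge[OF assms] p0_nonneg by (cases "0 \<in> A") auto

lemma measure_M_atom:
  assumes "A \<in> sets borel" "1 \<le> n" "a n \<in> A"
  shows "p n \<le> measure M A"
  using sum_le_measure_M[OF assms(1), of "{n}"] assms by simp

lemma measure_M_le_total: "measure M A \<le> measure M UNIV"
  using finite_measure.bounded_measure[OF finite_M, of A] sets_eq_imp_space_eq[of M borel] by simp

lemma total_pos: "0 < measure M UNIV"
  using measure_M_atom[of UNIV 1] p_pos[of 1] by simp

lemma atom_in_support:
  assumes "1 \<le> n" shows "a n \<in> measure_support M"
  unfolding measure_support_def
proof (intro CollectI allI impI)
  fix U assume "open U" "a n \<in> U"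
  then have "0 < measure M U" using measure_M_atom[of U n] p_pos[of n] assms by force
  then show "0 < emeasure M U"
    using finite_measure.emeasure_eq_measure[OF finite_M] by simp
qed

text \<open>
  The set formed by a sequence and its limit is compact, so its complement is an open null set.
\<close>
lemma support_cases:
  assumes "x \<in> measure_support M"
  obtains "x = 0" | n where "1 \<le> n" "x = a n"
proof -
  have "x \<in> insert 0 (a ` {1..})"
  proof (rule ccontr)
    assume x: "x \<notin> insert 0 (a ` {1..})"
    define U where "U = - insert 0 (range (\<lambda>n. a (Suc n)))"
    have "(\<lambda>n. a (Suc n)) \<longlonglongrightarrow> 0" using a_tendsto_0 by (rule LIMSEQ_Suc)
    then have "open U" unfolding U_def
      by (intro open_Compl compact_imp_closed compact_sequence_with_limit)
    moreover have "x \<in> U" using x unfolding U_def by auto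
    moreover have "emeasure M U = 0"
      using \<open>open U\<close> by (subst emeasure_M) (auto simp: U_def indicator_def)
    ultimately show False using assms by (auto simp: measure_support_def)
  qed
  then show thesis using that by auto
qed

end


section \<open>Polynomial masses at polynomial positions: estimates of masses\<close>

text \<open>
  By the mean value theorem. For \<open>x = n\<close> and \<open>y = m\<close> this measures the distance of the atoms at \<open>n^(-q)\<close> and \<open>m^(-q)\<close>.
\<close>
lemma powr_minus_diff_bounds:
  fixes x y q :: real
  assumes "0 < x" "x \<le> y" "0 < q"
  shows "q * (y - x) * y powr (- q - 1) \<le> x powr (- q) - y powr (- q)"
    and "x powr (- q) - y powr (- q) \<le> q * (y - x) * x powr (- q - 1)"
proof -
  have "q * (y - x) * y powr (- q - 1) \<le> x powr (- q) - y powr (- q) \<and>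
        x powr (- q) - y powr (- q) \<le> q * (y - x) * x powr (- q - 1)"
  proof (cases "x = y")
    case False
    then have xy: "x < y" using assms by simp
    obtain z where z: "x < z" "z < y" "y powr (- q) - x powr (- q) = (y - x) * (- q * z powr (- q - 1))"
      using MVT2[OF xy, of "\<lambda>z. z powr (- q)" "\<lambda>z. - q * z powr (- q - 1)"] assms(1)
        has_real_derivative_powr[of _ "- q"] by (smt (verit, best))
    have "y powr (- q - 1) \<le> z powr (- q - 1)" "z powr (- q - 1) \<le> x powr (- q - 1)"
      using z assms by (auto intro!: powr_mono2')
    then have "q * (y - x) * y powr (- q - 1) \<le> q * (y - x) * z powr (- q - 1)"
      "q * (y - x) * z powr (- q - 1) \<le> q * (y - x) * x powr (- q - 1)"
      using xy assms by (auto intro!: mult_left_mono)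
    then show ?thesis using z(3) by (simp add: algebra_simps)
  qed simp
  then show "q * (y - x) * y powr (- q - 1) \<le> x powr (- q) - y powr (- q)"
    "x powr (- q) - y powr (- q) \<le> q * (y - x) * x powr (- q - 1)" by auto
qed

text \<open>
  A term \<open>n^(-\<beta>)\<close> is at most a constant times \<open>n^(1-\<beta>) - (n+1)^(1-\<beta>)\<close>, and these differences telescope.
  A real threshold \<open>X\<close> saves rounding when it comes from inverting \<open>n^(-lam) < \<rho>\<close>.
\<close>
lemma sum_powr_tail_le:
  fixes \<beta> X :: real
  assumes "1 < \<beta>" "0 < X" "finite F" and F: "\<And>n. n \<in> F \<Longrightarrow> X \<le> real n"
  shows "(\<Sum>n\<in>F. real n powr (- \<beta>)) \<le> 2 powr \<beta> / (\<beta> - 1) * X powr (1 - \<beta>)"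
proof -
  let ?C = "2 powr \<beta> / (\<beta> - 1)"
  define N where "N = nat \<lceil>X\<rceil>"
  have N: "1 \<le> N" "X \<le> real N" unfolding N_def using assms(2) by linarith+
  have step: "real n powr (- \<beta>) \<le> ?C * (real n powr (1 - \<beta>) - real (Suc n) powr (1 - \<beta>))" if "1 \<le> n" for n
  proof -
    have "real n powr (- \<beta>) = 2 powr \<beta> * (2 * real n) powr (- \<beta>)"
      using that by (simp add: powr_mult powr_minus)
    also have "\<dots> \<le> 2 powr \<beta> * real (Suc n) powr (- \<beta>)"
      using that assms(1) by (intro mult_left_mono powr_mono2') auto
    also have "\<dots> \<le> 2 powr \<beta> * ((real n powr (1 - \<beta>) - real (Suc n) powr (1 - \<beta>)) / (\<beta> - 1))"
      using powr_minus_diff_bounds(1)[of "real n" "real (Suc n)" "\<beta> - 1"] that assms(1)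
      by (intro mult_left_mono) (auto simp: field_simps)
    finally show ?thesis by simp
  qed
  have tele: "(\<Sum>n\<in>{N..<N+k}. real n powr (- \<beta>)) \<le> ?C * (real N powr (1 - \<beta>) - real (N + k) powr (1 - \<beta>))" for k
  proof (induction k)
    case (Suc k)
    then show ?case using step[of "N + k"] N(1) by (simp add: algebra_simps)
  qed simp
  obtain k where k: "F \<subseteq> {..<k}" using finite_nat_iff_bounded assms(3) by blast
  have "F \<subseteq> {N..<N+k}"
  proof
    fix n assume n: "n \<in> F"
    then have "X \<le> real n" by (rule F)
    then have "N \<le> n" unfolding N_def by linarith
    then show "n \<in> {N..<N+k}" using n k by auto
  qed
  then have "(\<Sum>n\<in>F. real n powr (- \<beta>)) \<le> (\<Sum>n\<in>{N..<N+k}. real n powr (- \<beta>))"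
    by (intro sum_mono2) auto
  also have "\<dots> \<le> ?C * real N powr (1 - \<beta>)"
    using tele[of k] assms(1) by (smt (verit) divide_nonneg_nonneg mult_left_mono powr_ge_zero)
  also have "\<dots> \<le> ?C * X powr (1 - \<beta>)"
    using N assms by (intro mult_left_mono powr_mono2') auto
  finally show ?thesis .
qed

lemma sum_powr_ge:
  fixes \<beta> Y :: real
  assumes "0 < \<beta>" "finite F" "\<And>n. n \<in> F \<Longrightarrow> 1 \<le> n \<and> real n \<le> Y"
  shows "real (card F) * Y powr (- \<beta>) \<le> (\<Sum>n\<in>F. real n powr (- \<beta>))"
proof -
  have "(\<Sum>n\<in>F. Y powr (- \<beta>)) \<le> (\<Sum>n\<in>F. real n powr (- \<beta>))"
    using assms by (intro sum_mono powr_mono2') (auto dest!: assms(3))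
  then show ?thesis by simp
qed

locale poly_poly =
  fixes p0 :: real and p a :: "nat \<Rightarrow> real" and \<beta> lam :: real
  assumes p0: "0 \<le> p0" and \<beta>: "1 < \<beta>" and lam: "0 < lam"
    and p: "\<And>n. 1 \<le> n \<Longrightarrow> p n = real n powr (- \<beta>)"
    and a: "\<And>n. 1 \<le> n \<Longrightarrow> a n = real n powr (- lam)"

sublocale poly_poly \<subseteq> atomic_masses p0 p a
proof
  have "summable (\<lambda>n. real (Suc n) powr (- \<beta>))"
    using \<beta> summable_real_powr_iff[of "- \<beta>"] by (subst summable_Suc_iff) simp
  then show "summable (\<lambda>n. p (Suc n))" by (simp add: p)
  have "(\<lambda>n. real n powr (- lam)) \<longlonglongrightarrow> 0" using lam by real_asymp
  then show "a \<longlonglongrightarrow> 0"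
    by (rule Lim_transform_eventually) (auto simp: a intro: eventually_mono[OF eventually_ge_at_top[of 1]])
qed (use p0 in \<open>auto simp: p a\<close>)

context poly_poly
begin

text \<open>
  Near \<open>0\<close> a ball of radius \<open>r\<close> has mass of order \<open>r^s\<close>; an atom whose distance to its neighbours is of order
  \<open>r\<close> has mass of order \<open>r^t\<close>.
\<close>
definition "s = (\<beta> - 1) / lam"
definition "t = \<beta> / (lam + 1)"

lemma sum_p: "F \<subseteq> {1..} \<Longrightarrow> sum p F = (\<Sum>n\<in>F. real n powr (- \<beta>))"
  by (intro sum.cong) (auto simp: p)

text \<open>
  The atoms below \<open>\<rho>\<close> have indices above \<open>\<rho>^(-1/lam)\<close>.
\<close>
lemma measure_below_le:
  "\<exists>C>0. \<forall>\<rho> A. 0 < \<rho> \<longrightarrow> A \<in> sets borel \<longrightarrow> A \<subseteq> {..<\<rho>} \<longrightarrow> measure M A \<le> p0 * indicator A 0 + C * \<rho> powr s"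
proof (intro exI conjI allI impI)
  show "0 < 2 powr \<beta> / (\<beta> - 1)" using \<beta> by simp
  fix \<rho> :: real and A assume \<rho>: "0 < \<rho>" and A: "A \<in> sets borel" "A \<subseteq> {..<\<rho>}"
  show "measure M A \<le> p0 * indicator A 0 + 2 powr \<beta> / (\<beta> - 1) * \<rho> powr s"
  proof (rule measure_M_le[OF A(1)])
    fix F assume F: "finite F" "F \<subseteq> {1..}" "a ` F \<subseteq> A"
    have "\<rho> powr (- 1 / lam) \<le> real n" if "n \<in> F" for n
    proof -
      have "1 \<le> n" "a n < \<rho>" using that F A(2) by auto
      then have n: "1 \<le> n" "real n powr (- lam) < \<rho>" by (simp_all add: a)
      then have "\<rho> powr (- 1 / lam) \<le> (real n powr (- lam)) powr (- 1 / lam)"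
        using lam \<rho> by (intro powr_mono2') auto
      then show ?thesis using lam n by (simp add: powr_powr)
    qed
    then have "sum p F \<le> 2 powr \<beta> / (\<beta> - 1) * (\<rho> powr (- 1 / lam)) powr (1 - \<beta>)"
      unfolding sum_p[OF F(2)] using \<beta> \<rho> F(1) by (intro sum_powr_tail_le) auto
    also have "(\<rho> powr (- 1 / lam)) powr (1 - \<beta>) = \<rho> powr s"
      by (simp add: powr_powr s_def diff_divide_distrib)
    finally show "sum p F \<le> 2 powr \<beta> / (\<beta> - 1) * \<rho> powr s" .
  qed
qed

text \<open>
  The ball contains all atoms in \<open>(0, r)\<close>, in particular those with indices from \<open>N\<close> to \<open>2 N\<close>, where \<open>N\<close> is
  of order \<open>r^(-1/lam)\<close>.
\<close>
lemma measure_ball_large_ge: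
  "\<exists>c>0. \<forall>x r. 0 \<le> x \<longrightarrow> x \<le> r \<longrightarrow> 0 < r \<longrightarrow> r \<le> 1 \<longrightarrow> c * r powr s \<le> mass x r"
proof (intro exI conjI allI impI)
  show "0 < (2::real) powr (1 - 2 * \<beta>)" by simp
  fix x r :: real assume x: "0 \<le> x" "x \<le> r" "0 < r" "r \<le> 1"
  define Y where "Y = r powr (- 1 / lam)"
  define N where "N = nat \<lfloor>Y\<rfloor> + 1"
  have "1 powr (- 1 / lam) \<le> Y" unfolding Y_def using x lam by (intro powr_mono2') auto
  then have Y: "1 \<le> Y" by simp
  have N: "Y < real N" "real N \<le> 2 * Y" "1 \<le> N" unfolding N_def using Y by linarith+
  have "a n \<in> ball x r" if "N \<le> n" for n
  proof -
    have n: "1 \<le> n" "Y < real n" using that N by auto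
    have "a n = real n powr (- lam)" using a n by simp
    also have "\<dots> < Y powr (- lam)" using n Y lam by (intro powr_less_mono2_neg) auto
    also have "\<dots> = r" unfolding Y_def using lam x by (simp add: powr_powr)
    finally show ?thesis using a_pos[OF n(1)] x by (auto simp: dist_real_def)
  qed
  then have "sum p {N..2*N} \<le> mass x r"
    using N by (intro sum_le_measure_M) auto
  moreover have "real (card {N..2*N}) * (real (2*N)) powr (- \<beta>) \<le> sum p {N..2*N}"
  proof -
    have "real (card {N..2*N}) * (real (2*N)) powr (- \<beta>) \<le> (\<Sum>n\<in>{N..2*N}. real n powr (- \<beta>))"
      using N \<beta> by (intro sum_powr_ge) auto
    then show ?thesis using N by (subst sum_p) auto
  qed
  moreover have "(2::real) powr (1 - 2 * \<beta>) * r powr s \<le> real (card {N..2*N}) * (real (2*N)) powr (- \<beta>)"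
  proof -
    have "2 powr (1 - 2 * \<beta>) * r powr s = 2 powr (- \<beta>) * (2 powr (1 - \<beta>) * r powr s)"
      by (simp flip: powr_add)
    also have "2 powr (1 - \<beta>) * r powr s = (2 * Y) powr (1 - \<beta>)"
      using Y by (simp add: powr_mult Y_def powr_powr s_def diff_divide_distrib)
    also have "2 powr (- \<beta>) * (2 * Y) powr (1 - \<beta>) \<le> 2 powr (- \<beta>) * real N powr (1 - \<beta>)"
      using N \<beta> Y by (intro mult_left_mono powr_mono2') auto
    also have "\<dots> = real N * (real (2*N)) powr (- \<beta>)"
      using N by (simp add: powr_mult powr_diff powr_minus divide_inverse)
    also have "\<dots> \<le> real (card {N..2*N}) * (real (2*N)) powr (- \<beta>)"
      by (intro mult_right_mono) auto
    finally show ?thesis .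
  qed
  ultimately show "2 powr (1 - 2 * \<beta>) * r powr s \<le> mass x r" by linarith
qed

text \<open>
  The number of indices \<open>m \<ge> n\<close> for which \<open>a m\<close> lies within distance \<open>r\<close> of \<open>a n\<close> is at least of order \<open>r n^(lam+1)\<close>; for \<open>r \<le> a n\<close>
  this many can be found among the indices up to \<open>2 n\<close>, whose masses are of order \<open>n^(-\<beta>)\<close>.
\<close>
lemma measure_ball_small_ge:
  "\<exists>c>0. \<forall>n r. 1 \<le> n \<longrightarrow> 0 < r \<longrightarrow> r \<le> a n \<longrightarrow>
     c * (r * real n powr (lam + 1 - \<beta>)) \<le> mass (a n) r"
proof -
  \<comment> \<open>The bound \<open>1 / (2 lam)\<close> keeps the chosen atoms inside the ball, the bound \<open>1\<close> keeps their indices below \<open>2 n\<close>.\<close>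
  define c1 where "c1 = min 1 (1 / (2 * lam))"
  have c1: "0 < c1" "c1 \<le> 1" "lam * c1 \<le> 1/2" unfolding c1_def using lam by (auto simp: min_def field_simps)
  have "c1 * 2 powr (- \<beta>) * (r * real n powr (lam + 1 - \<beta>)) \<le> mass (a n) r"
    if n: "1 \<le> n" and r: "0 < r" "r \<le> a n" for n r
  proof -
    define Z where "Z = c1 * (r * real n powr (lam + 1))"
    define K where "K = nat \<lfloor>Z\<rfloor>"
    have "r * real n powr (lam + 1) \<le> real n powr (- lam) * real n powr (lam + 1)"
      using r a[OF n] by (intro mult_right_mono) auto
    also have "\<dots> = real n" using n by (simp flip: powr_add)
    finally have "r * real n powr (lam + 1) \<le> real n" .
    then have Z: "0 \<le> Z" "Z \<le> real n" unfolding Z_def using c1 r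
       mult_mono[of c1 1 "r * real n powr (lam + 1)" "real n"] by auto
    then have K: "real K \<le> Z" "Z \<le> real K + 1" "K \<le> n" unfolding K_def by linarith+
    have "a m \<in> ball (a n) r" if m: "m \<in> {n..n+K}" for m
    proof -
      have "a n - a m \<le> lam * (real m - real n) * real n powr (- lam - 1)"
        using powr_minus_diff_bounds(2)[of "real n" "real m" lam] n m lam by (simp add: a)
      also have "\<dots> \<le> lam * Z * real n powr (- lam - 1)"
        using m K lam by (intro mult_right_mono mult_left_mono) auto
      also have "\<dots> = lam * c1 * r * (real n powr (lam + 1) * real n powr (- lam - 1))"
        by (simp add: Z_def)
      also have "real n powr (lam + 1) * real n powr (- lam - 1) = 1" using n by (simp flip: powr_add)
      also have "lam * c1 * r * 1 < r" using c1 r mult_right_mono[OF c1(3), of r] by auto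
      finally have "a n - a m < r" .
      moreover have "a m \<le> a n" using m n lam by (auto simp: a intro!: powr_mono2')
      ultimately show ?thesis by (auto simp: dist_real_def)
    qed
    then have "sum p {n..n+K} \<le> mass (a n) r"
      using n by (intro sum_le_measure_M) auto
    moreover have "real (card {n..n+K}) * (2 * real n) powr (- \<beta>) \<le> sum p {n..n+K}"
    proof -
      have "real (card {n..n+K}) * (2 * real n) powr (- \<beta>) \<le> (\<Sum>m\<in>{n..n+K}. real m powr (- \<beta>))"
        using n \<beta> K by (intro sum_powr_ge) auto
      then show ?thesis using n by (subst sum_p) auto
    qed
    moreover have "c1 * 2 powr (- \<beta>) * (r * real n powr (lam + 1 - \<beta>)) = Z * (2 * real n) powr (- \<beta>)"
      unfolding Z_def using n by (simp add: powr_mult powr_diff powr_minus divide_inverse)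
    moreover have "\<dots> \<le> real (card {n..n+K}) * (2 * real n) powr (- \<beta>)"
      using K by (intro mult_right_mono) auto
    ultimately show ?thesis by linarith
  qed
  then show ?thesis using c1 by (intro exI[of _ "c1 * 2 powr (- \<beta>)"]) auto
qed

text \<open>
  Positions within a factor \<open>2\<close> of each other have indices within a constant factor of each other.
\<close>
lemma a_bounds_imp_index_bounds:
  assumes "1 \<le> n" "1 \<le> m" "a n / 2 \<le> a m" "a m \<le> 2 * a n"
  shows "real m \<le> 2 powr (1 / lam) * real n" "real n \<le> 2 powr (1 / lam) * real m"
proof -
  have *: "real m \<le> 2 powr (1 / lam) * real n" if "1 \<le> n" "1 \<le> m" "a n \<le> 2 * a m" for m n
  proof -
    have "(2 * a m) powr (- 1 / lam) \<le> a n powr (- 1 / lam)"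
      using that lam a_pos by (intro powr_mono2') auto
    then have "2 powr (- 1 / lam) * real m \<le> real n"
      using that lam by (simp add: a powr_mult powr_powr)
    then have "2 powr (1 / lam) * (2 powr (- 1 / lam) * real m) \<le> 2 powr (1 / lam) * real n"
      by (intro mult_left_mono) auto
    moreover have "(2::real) powr (1 / lam) * 2 powr (- 1 / lam) = 1" by (simp flip: powr_add)
    ultimately show ?thesis by (metis mult.assoc mult.left_neutral)
  qed
  show "real m \<le> 2 powr (1 / lam) * real n" "real n \<le> 2 powr (1 / lam) * real m"
    using *[of n m] *[of m n] assms by auto
qed

text \<open>
  If \<open>R\<close> exceeds half of \<open>a n\<close>, the ball is treated as a part of the half-line below \<open>2 a n\<close>. Otherwise all
  atoms in it have indices comparable to \<open>n\<close>, so they are separated by a multiple of \<open>n^(-lam-1)\<close>, which bounds their number.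
\<close>
lemma measure_ball_small_le:
  "\<exists>C>0. \<forall>n R. 1 \<le> n \<longrightarrow> 0 < R \<longrightarrow> R \<le> a n \<longrightarrow>
     mass (a n) R \<le> C * (real n powr (- \<beta>) * (1 + R * real n powr (lam + 1)))"
proof -
  obtain C where C: "0 < C" and below: "\<And>\<rho> A. 0 < \<rho> \<Longrightarrow> A \<in> sets borel \<Longrightarrow> A \<subseteq> {..<\<rho>} \<Longrightarrow>
     measure M A \<le> p0 * indicator A 0 + C * \<rho> powr s"
    using measure_below_le by blast
  define A where "A = 2 powr (1 / lam)"
  have A: "1 \<le> A" unfolding A_def using lam by (simp add: ge_one_powr_ge_zero)
  define B where "B = 1 + 2 * A powr (lam + 1) / lam"
  have B: "0 < B" unfolding B_def using lam A by (auto intro!: add_pos_nonneg)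
  define D where "D = max (C * 2 powr s * 2) (B * A powr \<beta>)"
  have "mass (a n) R \<le> D * (real n powr (- \<beta>) * (1 + R * real n powr (lam + 1)))"
    if n: "1 \<le> n" and R: "0 < R" "R \<le> a n" for n R
  proof (cases "a n / 2 < R")
    case True
    have "mass (a n) R \<le> p0 * indicator (ball (a n) R) 0 + C * (2 * a n) powr s"
      using R by (intro below) (auto simp: dist_real_def)
    also have "indicator (ball (a n) R) 0 = (0::real)" using R by (auto simp: dist_real_def)
    also have "C * (2 * a n) powr s = C * 2 powr s * real n powr (1 - \<beta>)"
      using n lam by (simp add: a powr_mult powr_powr s_def)
    also have "\<dots> \<le> C * 2 powr s * (2 * (real n powr (- \<beta>) * (1 + R * real n powr (lam + 1))))"
    proof (intro mult_left_mono)
      have "real n = 2 * (real n powr (- lam) / 2 * real n powr (lam + 1))" using n by (simp flip: powr_add)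
      also have "\<dots> \<le> 2 * (R * real n powr (lam + 1))"
        using True n by (intro mult_left_mono mult_right_mono) (auto simp: a)
      also have "\<dots> \<le> 2 * (1 + R * real n powr (lam + 1))" by simp
      finally have "real n powr (- \<beta>) * real n \<le> real n powr (- \<beta>) * (2 * (1 + R * real n powr (lam + 1)))"
        by (intro mult_left_mono) auto
      then show "real n powr (1 - \<beta>) \<le> 2 * (real n powr (- \<beta>) * (1 + R * real n powr (lam + 1)))"
        using n by (simp add: powr_diff powr_minus divide_inverse mult_ac)
    qed (use C in auto)
    also have "\<dots> = C * 2 powr s * 2 * (real n powr (- \<beta>) * (1 + R * real n powr (lam + 1)))" by simp
    also have "\<dots> \<le> D * (real n powr (- \<beta>) * (1 + R * real n powr (lam + 1)))"
      using R by (intro mult_right_mono) (auto simp: D_def)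
    finally show ?thesis by simp
  next
    case False
    define X where "X = R * (A * real n) powr (lam + 1) / lam"
    have X: "0 \<le> X" unfolding X_def using R lam by auto
    have "mass (a n) R \<le> p0 * indicator (ball (a n) R) 0 +
        B * A powr \<beta> * (real n powr (- \<beta>) * (1 + R * real n powr (lam + 1)))"
    proof (rule measure_M_le)
      fix F assume F: "finite F" "F \<subseteq> {1..}" "a ` F \<subseteq> ball (a n) R"
      have m: "real m \<le> A * real n" "real n \<le> A * real m" "\<bar>real m - real n\<bar> \<le> X" if "m \<in> F" for m
      proof -
        have m1: "1 \<le> m" "\<bar>a n - a m\<bar> < R" using that F by (auto simp: dist_real_def)
        then show mA: "real m \<le> A * real n" "real n \<le> A * real m"
          using a_bounds_imp_index_bounds[OF n, of m] False R unfolding A_def by auto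
        have *: "lam * \<bar>real m - real n\<bar> * (A * real n) powr (- lam - 1) \<le> \<bar>a n - a m\<bar>"
        proof -
          define i j where "i = min m n" and "j = max m n"
          have ij: "1 \<le> i" "i \<le> j" "real j \<le> A * real n" using m1 n mA A by (auto simp: i_def j_def max_def)
          have "lam * (real j - real i) * (A * real n) powr (- lam - 1) \<le> lam * (real j - real i) * real j powr (- lam - 1)"
            using ij lam by (intro mult_left_mono powr_mono2') auto
          also have "\<dots> \<le> a i - a j"
            using powr_minus_diff_bounds(1)[of "real i" "real j" lam] ij lam by (simp add: a)
          finally have **: "lam * (real j - real i) * (A * real n) powr (- lam - 1) \<le> a i - a j" .
          show ?thesis
          proof (cases "m \<le> n")
            case True then show ?thesis using ** by (simp add: i_def j_def)
          next
            case False then show ?thesis using ** by (simp add: i_def j_def)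
          qed
        qed
        have "lam * \<bar>real m - real n\<bar> * (A * real n) powr (- lam - 1) * (A * real n) powr (lam + 1) \<le> R * (A * real n) powr (lam + 1)"
          using * m1 by (intro mult_right_mono) auto
        moreover have "(A * real n) powr (- lam - 1) * (A * real n) powr (lam + 1) = 1"
          using A n by (simp flip: powr_add)
        ultimately show "\<bar>real m - real n\<bar> \<le> X" unfolding X_def using lam
          by (simp add: mult.assoc field_simps)
      qed
      define k where "k = nat \<lfloor>X\<rfloor>"
      have "F \<subseteq> {n - k..n + k}"
      proof
        fix m' assume "m' \<in> F"
        then have "\<bar>real m' - real n\<bar> \<le> X" by (rule m)
        then have "\<bar>int m' - int n\<bar> \<le> int k" unfolding k_def using X by linarith
        then show "m' \<in> {n - k..n + k}" by auto
      qed
      then have "card F \<le> card {n - k..n + k}" by (intro card_mono) auto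
      then have "card F \<le> 2 * k + 1" by (simp split: nat_diff_split)
      then have card: "real (card F) \<le> 1 + 2 * X" using X unfolding k_def by linarith
      have "sum p F \<le> (\<Sum>m\<in>F. A powr \<beta> * real n powr (- \<beta>))"
      proof (intro sum_mono)
        fix m' assume m': "m' \<in> F"
        have m'1: "1 \<le> m'" using m' F by auto
        have "p m' = A powr \<beta> * (A * real m') powr (- \<beta>)"
          using A m'1 by (simp add: p powr_mult powr_minus)
        also have "\<dots> \<le> A powr \<beta> * real n powr (- \<beta>)"
          using m(2)[OF m'] \<beta> n by (intro mult_left_mono powr_mono2') auto
        finally show "p m' \<le> A powr \<beta> * real n powr (- \<beta>)" .
      qed
      also have "\<dots> = real (card F) * (A powr \<beta> * real n powr (- \<beta>))" by simp
      also have "\<dots> \<le> (B * (1 + R * real n powr (lam + 1))) * (A powr \<beta> * real n powr (- \<beta>))"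
      proof (intro mult_right_mono order.trans[OF card])
        have "0 \<le> A powr (lam + 1) / lam" "0 \<le> R * real n powr (lam + 1)" using lam R by auto
        moreover have "X = (A powr (lam + 1) / lam) * (R * real n powr (lam + 1))"
          unfolding X_def using A by (simp add: powr_mult)
        moreover have "1 + 2 * (P * Y) \<le> (1 + 2 * P) * (1 + Y)" if "0 \<le> P" "0 \<le> Y" for P Y :: real
          using that by (simp add: algebra_simps)
        ultimately show "1 + 2 * X \<le> B * (1 + R * real n powr (lam + 1))"
          unfolding B_def by (metis times_divide_eq_right)
      qed auto
      finally show "sum p F \<le> B * A powr \<beta> * (real n powr (- \<beta>) * (1 + R * real n powr (lam + 1)))"
        by (simp add: mult_ac)
    qed auto
    also have "indicator (ball (a n) R) 0 = (0::real)" using R by (auto simp: dist_real_def)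
    also have "B * A powr \<beta> * (real n powr (- \<beta>) * (1 + R * real n powr (lam + 1))) \<le>
        D * (real n powr (- \<beta>) * (1 + R * real n powr (lam + 1)))"
      using R by (intro mult_right_mono) (auto simp: D_def)
    finally show ?thesis by simp
  qed
  moreover have "0 < D" using C by (simp add: D_def less_max_iff_disj)
  ultimately show ?thesis by blast
qed

end


lemma eventually_powr_less_self:
  fixes K e :: real assumes "1 < e"
  shows "\<forall>\<^sub>F R in at_right 0. K * R powr e < R"
proof -
  have "((\<lambda>R::real. K * R powr (e - 1)) \<longlongrightarrow> 0) (at_right 0)" using assms by real_asymp
  then have "\<forall>\<^sub>F R in at_right 0. K * R powr (e - 1) < 1" by (simp add: order_tendstoD)
  then show ?thesis using eventually_at_right_0_less[of 1, OF zero_less_one]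
  proof eventually_elim
    case (elim R)
    then have "R * (K * R powr (e - 1)) < R * 1" by (intro mult_strict_left_mono) auto
    moreover have "R * R powr (e - 1) = R powr e" using elim powr_mult_base[of R "e - 1"] by simp
    ultimately show ?case by (simp add: mult_ac)
  qed
qed

context atomic_masses
begin

lemma support_nonneg: "x \<in> measure_support M \<Longrightarrow> 0 \<le> x"
  by (erule support_cases) (auto simp: a_pos less_imp_le)

lemma p0_le_measure_ball:
  assumes "0 \<le> x" "x < R" shows "p0 \<le> mass x R"
  using measure_M_ge[of "ball x R" "{}"] assms by (simp add: dist_real_def)

end

context poly_poly
begin

lemma s_pos: "0 < s" and t_pos: "0 < t"
  using \<beta> lam by (auto simp: s_def t_def)

lemma t_at_lam: "t * (lam + 1) = \<beta>" and s_at_lam: "s * lam = \<beta> - 1"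
  using lam by (auto simp: s_def t_def)

lemma s_le_t_iff: "s \<le> t \<longleftrightarrow> s \<le> 1" and t_le_1_iff: "t \<le> 1 \<longleftrightarrow> s \<le> 1"
  using lam by (auto simp: s_def t_def field_simps)

section \<open>Polynomial masses at polynomial positions: ratio bounds\<close>

text \<open>
  Turns \<open>r n^(lam+1) n^(-\<beta>)\<close>, the mass at intermediate radii, into \<open>r x^(s-1)\<close> for the centre \<open>x = a n\<close>.
\<close>
lemma index_powr_eq:
  assumes "1 \<le> n" shows "real n powr (lam + 1 - \<beta>) = a n powr (s - 1)"
proof -
  have "lam + 1 - \<beta> = - lam * (s - 1)" using s_at_lam by (simp add: algebra_simps)
  then show ?thesis using assms by (simp add: a powr_powr)
qed

text \<open>
  The maximum adds the contribution of the atom at the centre, which dominates when \<open>r\<close> is less than the distance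
  to the neighbours.
\<close>
lemma measure_ball_ge:
  "\<exists>c>0. \<forall>n r. 1 \<le> n \<longrightarrow> 0 < r \<longrightarrow> r \<le> a n \<longrightarrow>
     c * (real n powr (- \<beta>) * max 1 (r * real n powr (lam + 1))) \<le> mass (a n) r"
proof -
  obtain c where c: "0 < c" and *: "\<And>n r. 1 \<le> n \<Longrightarrow> 0 < r \<Longrightarrow> r \<le> a n \<Longrightarrow>
     c * (r * real n powr (lam + 1 - \<beta>)) \<le> mass (a n) r"
    using measure_ball_small_ge by blast
  have "min c 1 * (real n powr (- \<beta>) * max 1 (r * real n powr (lam + 1))) \<le> mass (a n) r"
    if n: "1 \<le> n" and r: "0 < r" "r \<le> a n" for n r
  proof -
    have 1: "real n powr (- \<beta>) \<le> mass (a n) r"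
      using measure_M_atom[of "ball (a n) r" n] n r by (simp add: p)
    have 2: "c * (real n powr (- \<beta>) * (r * real n powr (lam + 1))) \<le> mass (a n) r"
      using *[OF n r] n by (simp add: powr_diff powr_minus divide_inverse mult_ac)
    have "min c 1 * real n powr (- \<beta>) \<le> 1 * real n powr (- \<beta>)"
      by (intro mult_right_mono) auto
    moreover have "min c 1 * (real n powr (- \<beta>) * (r * real n powr (lam + 1))) \<le> c * (real n powr (- \<beta>) * (r * real n powr (lam + 1)))"
      using r by (intro mult_right_mono) auto
    ultimately show ?thesis using 1 2 by (simp add: max_def)
  qed
  then show ?thesis using c by (intro exI[of _ "min c 1"]) auto
qed

lemma measure_ball_large_le:
  "\<exists>C>0. \<forall>x R. 0 \<le> x \<longrightarrow> x \<le> R \<longrightarrow> 0 < R \<longrightarrow> mass x R \<le> p0 + C * R powr s"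
proof -
  obtain C where C: "0 < C" and below: "\<And>\<rho> A. 0 < \<rho> \<Longrightarrow> A \<in> sets borel \<Longrightarrow> A \<subseteq> {..<\<rho>} \<Longrightarrow>
     measure M A \<le> p0 * indicator A 0 + C * \<rho> powr s"
    using measure_below_le by blast
  have "mass x R \<le> p0 + C * 2 powr s * R powr s" if "0 \<le> x" "x \<le> R" "0 < R" for x R
  proof -
    have "mass x R \<le> p0 * indicator (ball x R) 0 + C * (2 * R) powr s"
      using that by (intro below) (auto simp: dist_real_def)
    also have "p0 * indicator (ball x R) 0 \<le> p0 * 1" using p0 by (intro mult_left_mono) (auto simp: indicator_def)
    finally show ?thesis using that by (simp add: powr_mult)
  qed
  then show ?thesis using C by (intro exI[of _ "C * 2 powr s"]) auto
qed

text \<open>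
  In the first of the three ranges below both balls have masses as in \<open>measure_ball_ge\<close>, up to constants, and the ratio is at most of
  order \<open>R/r\<close>. In the second the ratio is at most of order \<open>R^s / (r x^(s-1))\<close> with \<open>r \<le> x < R\<close>; the worst \<open>x\<close> is \<open>R\<close> for \<open>s \<le> 1\<close>
  and \<open>r\<close> for \<open>s > 1\<close>, which is where the maximum of \<open>1\<close> and \<open>s\<close> comes from. In the third it is at most of order \<open>(R/r)^s\<close>.
\<close>
lemma ratio_bound_away_from_atom:
  "\<exists>C>0. \<forall>r R x. 0 < r \<longrightarrow> r < R \<longrightarrow> R \<le> 1 \<longrightarrow> x \<in> measure_support M \<longrightarrow> p0 = 0 \<or> R \<le> x \<longrightarrow>
     mass x R \<le> C * (R / r) powr max 1 s * mass x r"
proof -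
  obtain c where c: "0 < c" and lo: "\<And>n r. 1 \<le> n \<Longrightarrow> 0 < r \<Longrightarrow> r \<le> a n \<Longrightarrow>
     c * (real n powr (- \<beta>) * max 1 (r * real n powr (lam + 1))) \<le> mass (a n) r"
    using measure_ball_ge by blast
  obtain c' where c': "0 < c'" and lo': "\<And>x r. 0 \<le> x \<Longrightarrow> x \<le> r \<Longrightarrow> 0 < r \<Longrightarrow> r \<le> 1 \<Longrightarrow>
     c' * r powr s \<le> mass x r" using measure_ball_large_ge by blast
  obtain C where C: "0 < C" and up: "\<And>n R. 1 \<le> n \<Longrightarrow> 0 < R \<Longrightarrow> R \<le> a n \<Longrightarrow>
     mass (a n) R \<le> C * (real n powr (- \<beta>) * (1 + R * real n powr (lam + 1)))"
    using measure_ball_small_le by blast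
  obtain C' where C': "0 < C'" and up': "\<And>x R. 0 \<le> x \<Longrightarrow> x \<le> R \<Longrightarrow> 0 < R \<Longrightarrow>
     mass x R \<le> p0 + C' * R powr s" using measure_ball_large_le by blast
  define D where "D = max (2 * C / c) (max (C' / c) (C' / c'))"
  have D: "2 * C / c \<le> D" "C' / c \<le> D" "C' / c' \<le> D" unfolding D_def by auto
  have Dpos: "0 < D" using less_le_trans[OF _ D(1)] C c by simp
  have "mass x R \<le> D * (R / r) powr max 1 s * mass x r"
    if r: "0 < r" "r < R" "R \<le> 1" and x: "x \<in> measure_support M" and near: "p0 = 0 \<or> R \<le> x" for r R x
  proof -
    have q1: "1 \<le> R / r" using r by simp
    have q: "R / r \<le> (R / r) powr max 1 s" "(R / r) powr s \<le> (R / r) powr max 1 s"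
      using powr_mono[of 1 "max 1 s" "R / r"] powr_mono[of s "max 1 s" "R / r"] q1 r by auto
    have x0: "0 \<le> x" by (rule support_nonneg[OF x])
    consider (inner) n where "1 \<le> n" "x = a n" "R \<le> x" | (mid) n where "1 \<le> n" "x = a n" "r \<le> x" "x < R" "p0 = 0"
      | (outer) "x < r" "p0 = 0"
      using x
    proof (cases rule: support_cases)
      case 1 then show ?thesis using r near that(3) by auto
    next
      case (2 n) then show ?thesis using near that(1,2)[of n] that(3) by force
    qed
    then show ?thesis
    proof cases
      case inner
      let ?N = "real n powr (lam + 1)"
      have "mass x R \<le> C * (real n powr (- \<beta>) * (1 + R * ?N))"
        using up[of n R] inner r by auto
      also have "\<dots> \<le> C * (real n powr (- \<beta>) * (2 * ((R / r) powr max 1 s * max 1 (r * ?N))))"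
      proof -
        have "1 * 1 \<le> (R / r) powr max 1 s * max 1 (r * ?N)" using q q1 by (intro mult_mono) auto
        moreover have "(R / r) * (r * ?N) \<le> (R / r) powr max 1 s * max 1 (r * ?N)"
          using q q1 r by (intro mult_mono) auto
        ultimately have "1 + R * ?N \<le> 2 * ((R / r) powr max 1 s * max 1 (r * ?N))" using r by simp
        then show ?thesis using C by (intro mult_left_mono) auto
      qed
      also have "\<dots> =
         (2 * C / c) * (R / r) powr max 1 s * (c * (real n powr (- \<beta>) * max 1 (r * ?N)))"
        using c by simp
      also have "\<dots> \<le> (2 * C / c) * (R / r) powr max 1 s * mass x r"
        using lo[of n r] inner r C c by (intro mult_left_mono) auto
      also have "\<dots> \<le> D * (R / r) powr max 1 s * mass x r"
        using D by (intro mult_right_mono) auto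
      finally show ?thesis .
    next
      case mid
      have "R powr s \<le> (R / r) powr max 1 s * (r * x powr (s - 1))"
      proof (cases "s \<le> 1")
        case True
        then have "R powr (s - 1) \<le> x powr (s - 1)" using mid r by (intro powr_mono2') auto
        then have "R * R powr (s - 1) \<le> R * x powr (s - 1)" using r by (intro mult_left_mono) auto
        then show ?thesis using max_absorb1[OF True] r powr_mult_base[of R "s - 1"] by simp
      next
        case False
        then have "r powr (s - 1) \<le> x powr (s - 1)" using mid r by (intro powr_mono2) auto
        then have "(R / r) powr s * (r * r powr (s - 1)) \<le> (R / r) powr s * (r * x powr (s - 1))"
          using r by (intro mult_left_mono) auto
        moreover have "(R / r) powr s * (r * r powr (s - 1)) = R powr s"
          using r powr_mult_base[of r "s - 1"] by (simp add: powr_divide)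
        ultimately show ?thesis using False by (simp add: max_def)
      qed
      also have "x powr (s - 1) = real n powr (- \<beta>) * real n powr (lam + 1)"
        using mid index_powr_eq[of n] by (simp flip: powr_add add: algebra_simps)
      finally have *: "R powr s \<le> (R / r) powr max 1 s * (real n powr (- \<beta>) * (r * real n powr (lam + 1)))"
        by (simp add: mult_ac)
      have "mass x R \<le> C' * R powr s" using up'[of x R] mid r x0 by auto
      also have "\<dots> \<le> C' * ((R / r) powr max 1 s * (real n powr (- \<beta>) * max 1 (r * real n powr (lam + 1))))"
        using C' by (intro mult_left_mono order.trans[OF *]) auto
      also have "\<dots> = (C' / c) * (R / r) powr max 1 s * (c * (real n powr (- \<beta>) * max 1 (r * real n powr (lam + 1))))"
        using c by simp
      also have "\<dots> \<le> (C' / c) * (R / r) powr max 1 s * mass x r"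
        using lo[of n r] mid r C' c by (intro mult_left_mono) auto
      also have "\<dots> \<le> D * (R / r) powr max 1 s * mass x r"
        using D by (intro mult_right_mono) auto
      finally show ?thesis .
    next
      case outer
      have "mass x R \<le> C' * R powr s" using up'[of x R] outer r x0 by auto
      also have "R powr s = (R / r) powr s * r powr s" using r by (simp add: powr_divide)
      also have "C' * ((R / r) powr s * r powr s) = (C' / c') * (R / r) powr s * (c' * r powr s)"
        using c' by simp
      also have "\<dots> \<le> (C' / c') * (R / r) powr max 1 s * mass x r"
        using lo'[of x r] outer r x0 C' c' q by (intro mult_mono) auto
      also have "\<dots> \<le> D * (R / r) powr max 1 s * mass x r"
        using D by (intro mult_right_mono) auto
      finally show ?thesis .
    qed
  qed
  then show ?thesis using Dpos by blast
qed

text \<open>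
  For \<open>s \<le> 1\<close> and \<open>y = r n^(lam+1)\<close>, one has \<open>max 1 y \<ge> y^t\<close> because \<open>0 \<le> t \<le> 1\<close>, and \<open>n^(-\<beta>) y^t = r^t\<close>. For \<open>s > 1\<close> the
  mass is at least of order \<open>r x^(s-1) \<ge> r^s\<close>.
\<close>
lemma measure_ball_ge_powr:
  "\<exists>c>0. \<forall>x r. x \<in> measure_support M \<longrightarrow> 0 < r \<longrightarrow> r \<le> 1 \<longrightarrow> c * r powr max s t \<le> mass x r"
proof -
  obtain c where c: "0 < c" and lo: "\<And>n r. 1 \<le> n \<Longrightarrow> 0 < r \<Longrightarrow> r \<le> a n \<Longrightarrow>
     c * (real n powr (- \<beta>) * max 1 (r * real n powr (lam + 1))) \<le> mass (a n) r"
    using measure_ball_ge by blast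
  obtain c' where c': "0 < c'" and lo': "\<And>x r. 0 \<le> x \<Longrightarrow> x \<le> r \<Longrightarrow> 0 < r \<Longrightarrow> r \<le> 1 \<Longrightarrow>
     c' * r powr s \<le> mass x r" using measure_ball_large_ge by blast
  have "min c c' * r powr max s t \<le> mass x r"
    if x: "x \<in> measure_support M" and r: "0 < r" "r \<le> 1" for x r
  proof (cases "r \<le> x")
    case False
    have "min c c' * r powr max s t \<le> c' * r powr s"
      using c c' r by (intro mult_mono powr_mono') auto
    also have "\<dots> \<le> mass x r" using lo'[of x r] support_nonneg[OF x] False r by auto
    finally show ?thesis .
  next
    case True
    then obtain n where n: "1 \<le> n" "x = a n" using x r by (auto elim!: support_cases)
    let ?y = "r * real n powr (lam + 1)"
    have "r powr max s t \<le> real n powr (- \<beta>) * max 1 ?y"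
    proof (cases "s \<le> 1")
      case s1: True
      then have st: "max s t = t" "t \<le> 1" using s_le_t_iff t_le_1_iff by auto
      have "r powr t = real n powr (- \<beta>) * ?y powr t"
        using r n t_at_lam by (simp add: powr_mult powr_powr mult.commute powr_minus)
      also have "?y powr t \<le> max 1 ?y"
      proof (cases "?y \<le> 1")
        case True
        have "?y powr t \<le> 1 powr t" using True r t_pos by (intro powr_mono2) auto
        then show ?thesis by simp
      next
        case False
        then show ?thesis using powr_mono[of t 1 ?y] st r by simp
      qed
      finally show ?thesis using st by (simp add: mult_left_mono)
    next
      case False
      then have st: "max s t = s" using s_le_t_iff by auto
      have "r powr (s - 1) \<le> x powr (s - 1)" using False True r by (intro powr_mono2) auto
      then have "r * r powr (s - 1) \<le> r * x powr (s - 1)" using r by simp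
      also have "x powr (s - 1) = real n powr (- \<beta>) * real n powr (lam + 1)"
        using n index_powr_eq[of n] by (simp flip: powr_add add: algebra_simps)
      also have "r * (real n powr (- \<beta>) * real n powr (lam + 1)) = real n powr (- \<beta>) * ?y" by simp
      also have "\<dots> \<le> real n powr (- \<beta>) * max 1 ?y" by (intro mult_left_mono) auto
      finally show ?thesis using st r powr_mult_base[of r "s - 1"] by simp
    qed
    then have "min c c' * r powr max s t \<le> c * (real n powr (- \<beta>) * max 1 ?y)"
      using c c' by (intro mult_mono) auto
    also have "\<dots> \<le> mass x r" using lo[of n r] True n r by auto
    finally show ?thesis .
  qed
  then show ?thesis using c c' by (intro exI[of _ "min c c'"]) auto
qed

end


context poly_poly
begin

text \<open>
  Since \<open>mass x r\<close> is at least of order \<open>r^t\<close> and \<open>(R/r)^t R^(s-t) r^t = R^s\<close>, it suffices to bound \<open>mass x R\<close> by a multiple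
  of \<open>R^s\<close>. This fails only for balls that contain little more than their central atom, where the two masses are comparable.
\<close>
lemma ratio_bound_isolated_no_atom:
  assumes "p0 = 0" "s \<le> 1"
  shows "\<exists>C>0. \<forall>r R x. 0 < r \<longrightarrow> r < R \<longrightarrow> R \<le> 1 \<longrightarrow> x \<in> measure_support M \<longrightarrow>
     mass x R \<le> C * (R / r) powr t * R powr (- (t - s)) * mass x r"
proof -
  have st: "s \<le> t" using assms s_le_t_iff by auto
  obtain c where c: "0 < c" and lo: "\<And>x r. x \<in> measure_support M \<Longrightarrow> 0 < r \<Longrightarrow> r \<le> 1 \<Longrightarrow>
     c * r powr max s t \<le> mass x r"
    using measure_ball_ge_powr by blast
  obtain C where C: "0 < C" and up: "\<And>n R. 1 \<le> n \<Longrightarrow> 0 < R \<Longrightarrow> R \<le> a n \<Longrightarrow>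
     mass (a n) R \<le> C * (real n powr (- \<beta>) * (1 + R * real n powr (lam + 1)))"
    using measure_ball_small_le by blast
  obtain C' where C': "0 < C'" and up': "\<And>x R. 0 \<le> x \<Longrightarrow> x \<le> R \<Longrightarrow> 0 < R \<Longrightarrow>
     mass x R \<le> p0 + C' * R powr s" using measure_ball_large_le by blast
  have *: "mass x R \<le> (2 * C + max C' (2 * C) / c) * (R / r) powr t * R powr (- (t - s)) * mass x r"
    if r: "0 < r" "r < R" "R \<le> 1" and x: "x \<in> measure_support M" for r R x
  proof -
    let ?W = "(R / r) powr t * R powr (- (t - s)) * mass x r"
    have W: "0 \<le> 2 * C * ?W" "0 \<le> max C' (2 * C) / c * ?W" using C c by (auto simp: le_max_iff_disj)
    \<comment> \<open>Each case below needs only one of the two summands of the constant.\<close>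
    have split: "(2 * C + max C' (2 * C) / c) * (R / r) powr t * R powr (- (t - s)) * mass x r =
        2 * C * ?W + max C' (2 * C) / c * ?W" by (simp add: algebra_simps)
    have main: "max C' (2 * C) * R powr s \<le> max C' (2 * C) / c * ?W"
    proof -
      have "R powr s = (R / r) powr t * R powr (- (t - s)) * r powr max s t"
        using st r by (simp add: powr_divide powr_diff max_def)
      also have "c * \<dots> \<le> ?W" using lo[OF x, of r] r mult_left_mono[of "c * r powr max s t" _ "(R / r) powr t * R powr (- (t - s))"]
        by (simp add: mult_ac)
      finally have "max C' (2 * C) / c * (c * R powr s) \<le> max C' (2 * C) / c * ?W"
        using C c by (intro mult_left_mono) (auto simp: le_max_iff_disj)
      then show ?thesis using c by simp
    qed
    have x0: "0 \<le> x" by (rule support_nonneg[OF x])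
    show ?thesis
    proof (cases "x < R")
      case True
      have "mass x R \<le> C' * R powr s" using up'[of x R] x0 True assms by auto
      also have "\<dots> \<le> max C' (2 * C) * R powr s" by (intro mult_right_mono) auto
      also note main
      finally show ?thesis unfolding split using W by linarith
    next
      case False
      then obtain n where n: "1 \<le> n" "x = a n" using x r by (auto elim!: support_cases)
      let ?N = "real n powr (lam + 1)"
      have m: "mass x R \<le> C * (real n powr (- \<beta>) * (1 + R * ?N))"
        using up[of n R] n False r by auto
      show ?thesis
      proof (cases "R * ?N \<le> 1")
        case True
        have "C * (real n powr (- \<beta>) * (1 + R * ?N)) \<le> C * (real n powr (- \<beta>) * 2)"
          using True C by (intro mult_left_mono) auto
        also have "\<dots> \<le> C * (mass x r * 2)"
          using measure_M_atom[of "ball (a n) r" n] n r C by (intro mult_left_mono mult_right_mono) (auto simp: p)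
        also have "\<dots> = 2 * C * (1 * 1 * mass x r)" by simp
        also have "\<dots> \<le> 2 * C * ?W"
        proof -
          have "1 \<le> (R / r) powr t" using r t_pos by (intro ge_one_powr_ge_zero) auto
          moreover have "1 \<le> R powr (- (t - s))" using powr_mono'[of "- (t - s)" 0 R] r st by simp
          ultimately have "1 * 1 \<le> (R / r) powr t * R powr (- (t - s))" by (intro mult_mono) auto
          then show ?thesis using C by (intro mult_left_mono mult_right_mono) auto
        qed
        finally show ?thesis unfolding split using m W by linarith
      next
        case False2: False
        have "C * (real n powr (- \<beta>) * (1 + R * ?N)) \<le> C * (real n powr (- \<beta>) * (2 * (R * ?N)))"
          using False2 C by (intro mult_left_mono) auto
        also have "\<dots> = 2 * C * (R * (real n powr (- \<beta>) * ?N))" by simp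
        also have "real n powr (- \<beta>) * ?N = x powr (s - 1)"
          using n index_powr_eq[of n] by (simp flip: powr_add add: algebra_simps)
        also have "2 * C * (R * x powr (s - 1)) \<le> 2 * C * (R * R powr (s - 1))"
          using False r assms C by (intro mult_left_mono powr_mono2') auto
        also have "\<dots> = 2 * C * R powr s" using r powr_mult_base[of R "s - 1"] by simp
        also have "\<dots> \<le> max C' (2 * C) * R powr s" by (intro mult_right_mono) auto
        also note main
        finally show ?thesis unfolding split using m W by linarith
      qed
    qed
  qed
  have "0 < 2 * C + max C' (2 * C) / c" using C C' c by (intro add_pos_nonneg) auto
  then show ?thesis using * by blast
qed

text \<open>
  The larger mass is bounded by the total mass, which loses only a constant for balls that contain an atom at \<open>0\<close>.
\<close>
lemma ratio_bound_total:
  "\<exists>C>0. \<forall>r R x. 0 < r \<longrightarrow> r < R \<longrightarrow> R \<le> 1 \<longrightarrow> x \<in> measure_support M \<longrightarrow>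
     mass x R \<le> C * (R / r) powr max s t * R powr (- max s t) * mass x r"
proof -
  obtain c where c: "0 < c" and lo: "\<And>x r. x \<in> measure_support M \<Longrightarrow> 0 < r \<Longrightarrow> r \<le> 1 \<Longrightarrow>
     c * r powr max s t \<le> mass x r"
    using measure_ball_ge_powr by blast
  have "mass x R \<le> measure M UNIV / c * (R / r) powr max s t * R powr (- max s t) * mass x r"
    if r: "0 < r" "r < R" "R \<le> 1" and x: "x \<in> measure_support M" for r R x
  proof -
    have "mass x R \<le> measure M UNIV" by (rule measure_M_le_total)
    also have "\<dots> = measure M UNIV / c * (R / r) powr max s t * R powr (- max s t) * (c * r powr max s t)"
      using c r by (simp add: powr_divide powr_minus)
    also have "\<dots> \<le> measure M UNIV / c * (R / r) powr max s t * R powr (- max s t) * mass x r"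
      using lo[OF x] r c by (intro mult_left_mono) auto
    finally show ?thesis .
  qed
  then show ?thesis using total_pos c by (intro exI[of _ "measure M UNIV / c"]) auto
qed

text \<open>
  For \<open>R \<le> x\<close> the atom at \<open>0\<close> is not involved. For \<open>R > x\<close> the mass is at most the total mass, and \<open>(R/r) R^(-s) * mass x r\<close> is bounded below: for \<open>r \<le> x\<close> because
  \<open>mass x r\<close> is at least of order \<open>r x^(s-1) \<ge> r R^(s-1)\<close>, and for \<open>r > x\<close> because it is at least of order \<open>r^s\<close>.
\<close>
lemma ratio_bound_mixed:
  assumes "s \<le> 1"
  shows "\<exists>C>0. \<forall>r R x. 0 < r \<longrightarrow> r < R \<longrightarrow> R \<le> 1 \<longrightarrow> x \<in> measure_support M \<longrightarrow>
     mass x R \<le> C * (R / r) powr 1 * R powr (- s) * mass x r"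
proof -
  obtain C where C: "0 < C" and inner: "\<And>r R x. 0 < r \<Longrightarrow> r < R \<Longrightarrow> R \<le> 1 \<Longrightarrow> x \<in> measure_support M \<Longrightarrow> p0 = 0 \<or> R \<le> x \<Longrightarrow>
     mass x R \<le> C * (R / r) powr max 1 s * mass x r"
    using ratio_bound_away_from_atom by blast
  obtain c where c: "0 < c" and lo: "\<And>n r. 1 \<le> n \<Longrightarrow> 0 < r \<Longrightarrow> r \<le> a n \<Longrightarrow>
     c * (real n powr (- \<beta>) * max 1 (r * real n powr (lam + 1))) \<le> mass (a n) r"
    using measure_ball_ge by blast
  obtain c' where c': "0 < c'" and lo': "\<And>x r. 0 \<le> x \<Longrightarrow> x \<le> r \<Longrightarrow> 0 < r \<Longrightarrow> r \<le> 1 \<Longrightarrow>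
     c' * r powr s \<le> mass x r" using measure_ball_large_ge by blast
  define T where "T = measure M UNIV"
  define d where "d = min c c'"
  have d: "0 < d" "d \<le> c" "d \<le> c'" using c c' by (auto simp: d_def)
  have T: "0 < T" unfolding T_def by (rule total_pos)
  have *: "mass x R \<le> (C + T / d) * (R / r) powr 1 * R powr (- s) * mass x r"
    if r: "0 < r" "r < R" "R \<le> 1" and x: "x \<in> measure_support M" for r R x
  proof -
    let ?m = "mass x r"
    let ?W = "(R / r) * R powr (- s) * ?m"
    have split: "(C + T / d) * (R / r) powr 1 * R powr (- s) * ?m = C * ?W + T / d * ?W"
      using r by (simp add: algebra_simps add_divide_distrib)
    have W: "0 \<le> C * ?W" "0 \<le> T / d * ?W" using r C T d by auto
    show ?thesis
    proof (cases "R \<le> x")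
      case True
      have "mass x R \<le> C * ((R / r) * 1 * ?m)"
        using inner[of r R x] r x True max_absorb1[OF assms] by simp
      also have "\<dots> \<le> C * ?W"
        using C r s_pos powr_mono'[of "- s" 0 R] by (intro mult_left_mono mult_right_mono) auto
      finally show ?thesis unfolding split using W by linarith
    next
      case False
      have "d \<le> (R / r) * R powr (- s) * ?m"
      proof (cases "r \<le> x")
        case True
        then obtain n where n: "1 \<le> n" "x = a n" using x r by (auto elim!: support_cases)
        have "(R / r) * R powr (- s) * (r * R powr (s - 1)) = R powr (- s) * (R * R powr (s - 1))"
          using r by simp
        also have "\<dots> = 1" using r powr_mult_base[of R "s - 1"] by (simp flip: powr_add)
        finally have "d * 1 = d * ((R / r) * R powr (- s) * (r * R powr (s - 1)))" by simp
        also have "\<dots> \<le> d * ((R / r) * R powr (- s) * (r * x powr (s - 1)))"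
          using d r False True assms by (intro mult_left_mono powr_mono2') auto
        also have "x powr (s - 1) = real n powr (- \<beta>) * real n powr (lam + 1)"
          using n index_powr_eq[of n] by (simp flip: powr_add add: algebra_simps)
        also have "d * ((R / r) * R powr (- s) * (r * (real n powr (- \<beta>) * real n powr (lam + 1)))) =
            (R / r) * R powr (- s) * (d * (real n powr (- \<beta>) * (r * real n powr (lam + 1))))" by simp
        also have "\<dots> \<le> (R / r) * R powr (- s) * (c * (real n powr (- \<beta>) * max 1 (r * real n powr (lam + 1))))"
          using r d by (intro mult_left_mono mult_mono) auto
        also have "\<dots> \<le> (R / r) * R powr (- s) * ?m"
          using lo[of n r] n True r by (intro mult_left_mono) auto
        finally show ?thesis by simp
      next
        case False
        have "d * 1 \<le> c' * (R / r) powr (1 - s)"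
          using d r assms by (intro mult_mono ge_one_powr_ge_zero) auto
        also have "\<dots> = (R / r) * R powr (- s) * (c' * r powr s)"
          using r by (simp add: powr_diff powr_divide powr_minus field_simps)
        also have "\<dots> \<le> (R / r) * R powr (- s) * ?m"
          using lo'[of x r] False support_nonneg[OF x] r by (intro mult_left_mono) auto
        finally show ?thesis by simp
      qed
      then have "T / d * d \<le> T / d * ?W" using T d by (intro mult_left_mono) auto
      then have "T \<le> T / d * ?W" using d by simp
      then show ?thesis unfolding split using W measure_M_le_total[of "ball x R"] unfolding T_def by linarith
    qed
  qed
  have "0 < C + T / d" using C T d by (intro add_pos_pos) auto
  then show ?thesis using * by blast
qed

section \<open>Polynomial masses at polynomial positions: test balls and dimensions\<close>

text \<open>
  A real parameter \<open>Q\<close> in place of the index; the three lemmas that follow choose it so that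
  \<open>r\<close> is comparable to the centre, or to the spacing of the atoms there, or so that the centre is comparable to a given \<open>R\<close>.
\<close>
lemma test_ball:
  "\<exists>C>0. \<forall>Q r. 1 \<le> Q \<longrightarrow> 0 < r \<longrightarrow> r \<le> Q powr (- lam) \<longrightarrow>
     (\<exists>x\<in>measure_support M. x \<le> 2 powr lam * Q powr (- lam) \<and>
        mass x r \<le> C * (Q powr (- \<beta>) * (1 + r * Q powr (lam + 1))))"
proof -
  obtain C where C: "0 < C" and up: "\<And>n R. 1 \<le> n \<Longrightarrow> 0 < R \<Longrightarrow> R \<le> a n \<Longrightarrow>
     mass (a n) R \<le> C * (real n powr (- \<beta>) * (1 + R * real n powr (lam + 1)))"
    using measure_ball_small_le by blast
  have "\<exists>x\<in>measure_support M. x \<le> 2 powr lam * Q powr (- lam) \<and>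
        mass x r \<le> C * 2 powr \<beta> * (Q powr (- \<beta>) * (1 + r * Q powr (lam + 1)))"
    if Q: "1 \<le> Q" and r: "0 < r" "r \<le> Q powr (- lam)" for Q r
  proof -
    define n where "n = nat \<lfloor>Q\<rfloor>"
    have n: "1 \<le> n" "real n \<le> Q" "Q / 2 \<le> real n"
    proof -
      show "1 \<le> n" "real n \<le> Q" unfolding n_def using Q by linarith+
      moreover have "Q < real n + 1" unfolding n_def using Q by linarith
      ultimately show "Q / 2 \<le> real n" by linarith
    qed
    have half: "real n powr (- q) \<le> 2 powr q * Q powr (- q)" if "0 < q" for q
    proof -
      have "real n powr (- q) \<le> (Q / 2) powr (- q)" using n Q that by (intro powr_mono2') auto
      then show ?thesis using Q by (simp add: powr_divide powr_minus field_simps)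
    qed
    have "Q powr (- lam) \<le> a n" using n lam Q by (auto simp: a intro!: powr_mono2')
    then have "mass (a n) r \<le> C * (real n powr (- \<beta>) * (1 + r * real n powr (lam + 1)))"
      using r n by (intro up) auto
    also have "\<dots> \<le> C * ((2 powr \<beta> * Q powr (- \<beta>)) * (1 + r * Q powr (lam + 1)))"
      using C r n Q lam \<beta> half[of \<beta>] by (intro mult_left_mono mult_mono add_left_mono powr_mono2) auto
    finally show ?thesis using half[OF lam] n atom_in_support[of n]
      by (intro bexI[of _ "a n"]) (auto simp: a mult_ac)
  qed
  then show ?thesis using C by (intro exI[of _ "C * 2 powr \<beta>"]) auto
qed

lemma test_ball_near_0:
  "\<exists>C>0. \<forall>r. 0 < r \<longrightarrow> r \<le> 1 \<longrightarrow>
     (\<exists>x\<in>measure_support M. x \<le> 2 powr lam * r \<and> mass x r \<le> C * r powr s)"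
proof -
  obtain C where C: "0 < C" and test: "\<And>Q r. 1 \<le> Q \<Longrightarrow> 0 < r \<Longrightarrow> r \<le> Q powr (- lam) \<Longrightarrow>
     (\<exists>x\<in>measure_support M. x \<le> 2 powr lam * Q powr (- lam) \<and>
        mass x r \<le> C * (Q powr (- \<beta>) * (1 + r * Q powr (lam + 1))))"
    using test_ball by blast
  have "\<exists>x\<in>measure_support M. x \<le> 2 powr lam * r \<and> mass x r \<le> 2 * C * r powr s"
    if r: "0 < r" "r \<le> 1" for r
  proof -
    let ?Q = "r powr (- 1 / lam)"
    have "1 powr (- 1 / lam) \<le> ?Q" using r lam by (intro powr_mono2') auto
    then have Q: "1 \<le> ?Q" "?Q powr (- lam) = r" using r lam by (auto simp: powr_powr)
    obtain x where x: "x \<in> measure_support M" "x \<le> 2 powr lam * r"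
      "mass x r \<le> C * (?Q powr (- \<beta>) * (1 + r * ?Q powr (lam + 1)))"
      using test[OF Q(1), of r] r Q(2) by auto
    have "?Q powr (- \<beta>) = r powr (\<beta> / lam)" by (simp add: powr_powr)
    also have "\<dots> \<le> r powr s" using r \<beta> lam by (intro powr_mono') (auto simp: s_def divide_right_mono)
    finally have 1: "?Q powr (- \<beta>) \<le> r powr s" .
    have "?Q powr (- \<beta>) * (r * ?Q powr (lam + 1)) = r powr 1 * (r powr (\<beta> / lam) * r powr (- ((lam + 1) / lam)))"
      using r by (simp add: powr_powr)
    also have "\<dots> = r powr (1 + (\<beta> / lam + - ((lam + 1) / lam)))" by (simp only: powr_add)
    also have "1 + (\<beta> / lam + - ((lam + 1) / lam)) = s" using lam by (simp add: s_def field_simps)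
    finally have "?Q powr (- \<beta>) * (1 + r * ?Q powr (lam + 1)) \<le> 2 * r powr s"
      using 1 by (simp add: algebra_simps)
    then have "C * (?Q powr (- \<beta>) * (1 + r * ?Q powr (lam + 1))) \<le> C * (2 * r powr s)"
      using C by (intro mult_left_mono) auto
    then show ?thesis using x by (intro bexI[of _ x]) auto
  qed
  then show ?thesis using C by (intro exI[of _ "2 * C"]) auto
qed

lemma test_ball_isolated:
  "\<exists>C>0. \<forall>r. 0 < r \<longrightarrow> r \<le> 1 \<longrightarrow>
     (\<exists>x\<in>measure_support M. x \<le> 2 powr lam * r powr (lam / (lam + 1)) \<and> mass x r \<le> C * r powr t)"
proof -
  obtain C where C: "0 < C" and test: "\<And>Q r. 1 \<le> Q \<Longrightarrow> 0 < r \<Longrightarrow> r \<le> Q powr (- lam) \<Longrightarrow>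
     (\<exists>x\<in>measure_support M. x \<le> 2 powr lam * Q powr (- lam) \<and>
        mass x r \<le> C * (Q powr (- \<beta>) * (1 + r * Q powr (lam + 1))))"
    using test_ball by blast
  have "\<exists>x\<in>measure_support M. x \<le> 2 powr lam * r powr (lam / (lam + 1)) \<and> mass x r \<le> 2 * C * r powr t"
    if r: "0 < r" "r \<le> 1" for r
  proof -
    let ?Q = "r powr (- 1 / (lam + 1))"
    have "1 powr (- 1 / (lam + 1)) \<le> ?Q" using r lam by (intro powr_mono2') auto
    then have Q: "1 \<le> ?Q" "?Q powr (- lam) = r powr (lam / (lam + 1))" using r lam by (auto simp: powr_powr)
    have "r powr 1 \<le> r powr (lam / (lam + 1))" using r lam by (intro powr_mono') auto
    then obtain x where x: "x \<in> measure_support M" "x \<le> 2 powr lam * r powr (lam / (lam + 1))"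
      "mass x r \<le> C * (?Q powr (- \<beta>) * (1 + r * ?Q powr (lam + 1)))"
      using test[OF Q(1), of r] r Q(2) by auto
    have "?Q powr (lam + 1) = r powr (- 1)" "?Q powr (- \<beta>) = r powr t"
      using lam by (auto simp: powr_powr t_def)
    then have "?Q powr (- \<beta>) * (1 + r * ?Q powr (lam + 1)) = 2 * r powr t"
      using r by (simp add: powr_minus)
    then show ?thesis using x by (intro bexI[of _ x]) auto
  qed
  then show ?thesis using C by (intro exI[of _ "2 * C"]) auto
qed

text \<open>
  Here the centre stays close to \<open>R\<close> while the ball contains many atoms; in that regime masses are proportional
  to the radius.
\<close>
lemma test_ball_dense:
  "\<exists>C>0. \<forall>R r. 0 < R \<longrightarrow> R \<le> 1 \<longrightarrow> R powr (1 + 1 / lam) \<le> r \<longrightarrow> r \<le> R / 2 powr (lam + 1) \<longrightarrow>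
     (\<exists>x\<in>measure_support M. x < R \<and> mass x r \<le> C * (r * R powr (s - 1)))"
proof -
  obtain C where C: "0 < C" and test: "\<And>Q r. 1 \<le> Q \<Longrightarrow> 0 < r \<Longrightarrow> r \<le> Q powr (- lam) \<Longrightarrow>
     (\<exists>x\<in>measure_support M. x \<le> 2 powr lam * Q powr (- lam) \<and>
        mass x r \<le> C * (Q powr (- \<beta>) * (1 + r * Q powr (lam + 1))))"
    using test_ball by blast
  \<comment> \<open>With this factor the centre is at most \<open>R/2\<close>.\<close>
  define k where "k = (2::real) powr ((lam + 1) / lam)"
  have k: "1 \<le> k" unfolding k_def using lam by (intro ge_one_powr_ge_zero) auto
  have "\<exists>x\<in>measure_support M. x < R \<and> mass x r \<le> C * (2 * k powr (lam + 1 - \<beta>)) * (r * R powr (s - 1))"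
    if R: "0 < R" "R \<le> 1" and r: "R powr (1 + 1 / lam) \<le> r" "r \<le> R / 2 powr (lam + 1)" for r R
  proof -
    let ?Q = "k * R powr (- 1 / lam)"
    have "1 powr (- 1 / lam) \<le> R powr (- 1 / lam)" using R lam by (intro powr_mono2') auto
    then have Q: "1 \<le> ?Q" using k mult_mono[of 1 k 1 "R powr (- 1 / lam)"] by auto
    have Q2: "?Q powr (- lam) = R / 2 powr (lam + 1)"
    proof -
      have "k powr (- lam) = 1 / 2 powr (lam + 1)"
        using lam by (simp add: k_def powr_powr powr_minus_divide)
      then show ?thesis using R lam k by (simp add: powr_mult powr_powr)
    qed
    have r0: "0 < r" using r(1) R by (smt (verit) powr_gt_zero)
    obtain x where x: "x \<in> measure_support M" "x \<le> 2 powr lam * (R / 2 powr (lam + 1))"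
      "mass x r \<le> C * (?Q powr (- \<beta>) * (1 + r * ?Q powr (lam + 1)))"
      using test[OF Q, of r] r r0 unfolding Q2 by auto
    have "x \<le> R / 2" using x(2) by (simp add: powr_add)
    then have "x < R" using R by simp
    have "1 * 1 \<le> k powr (lam + 1) * (r * R powr (- 1 - 1 / lam))"
    proof (intro mult_mono)
      have "1 = R powr (1 + 1 / lam) * R powr (- 1 - 1 / lam)" using R by (simp flip: powr_add)
      also have "\<dots> \<le> r * R powr (- 1 - 1 / lam)" using r by (intro mult_right_mono) auto
      finally show "1 \<le> r * R powr (- 1 - 1 / lam)" .
    qed (use k lam in \<open>auto intro!: ge_one_powr_ge_zero\<close>)
    moreover have QQ: "?Q powr (lam + 1) = k powr (lam + 1) * R powr (- 1 - 1 / lam)"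
    proof -
      have "- 1 / lam * (lam + 1) = - 1 - 1 / lam" using lam by (simp add: field_simps)
      then show ?thesis using k R by (simp add: powr_mult powr_powr)
    qed
    ultimately have "1 + r * ?Q powr (lam + 1) \<le> 2 * (r * ?Q powr (lam + 1))" by (simp add: mult_ac)
    then have "?Q powr (- \<beta>) * (1 + r * ?Q powr (lam + 1)) \<le> ?Q powr (- \<beta>) * (2 * (r * ?Q powr (lam + 1)))"
      by (intro mult_left_mono) auto
    also have "\<dots> = 2 * r * (?Q powr (lam + 1 - \<beta>))"
      using Q by (simp add: powr_diff powr_minus divide_inverse)
    also have "?Q powr (lam + 1 - \<beta>) = k powr (lam + 1 - \<beta>) * R powr (s - 1)"
    proof -
      have "- 1 / lam * (lam + 1 - \<beta>) = s - 1" using lam by (simp add: field_simps s_def)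
      then show ?thesis using k R by (simp add: powr_mult powr_powr)
    qed
    finally have "C * (?Q powr (- \<beta>) * (1 + r * ?Q powr (lam + 1))) \<le> C * (2 * r * (k powr (lam + 1 - \<beta>) * R powr (s - 1)))"
      using C by (intro mult_left_mono) auto
    then have "mass x r \<le> C * (2 * k powr (lam + 1 - \<beta>)) * (r * R powr (s - 1))"
      using x(3) by (simp add: mult_ac)
    then show ?thesis using x(1) \<open>x < R\<close> by blast
  qed
  then show ?thesis using C k by (intro exI[of _ "C * (2 * k powr (lam + 1 - \<beta>))"]) auto
qed

end


context atomic_masses
begin

lemma dim_leI:
  assumes \<Phi>: "dimension_function \<Phi>" and v: "0 \<le> v"
    and bound: "\<exists>C>0. \<forall>r R x. 0 < r \<longrightarrow> r < R \<longrightarrow> R \<le> 1 \<longrightarrow> x \<in> measure_support M \<longrightarrow>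
     mass x R \<le> C * (R / r) powr u * R powr (- v) * mass x r"
  shows "upper_Phi_dim \<Phi> M \<le> ereal u + ereal v * Phi_rate (\<lambda>_. 1) \<Phi>"
proof -
  obtain C where C: "0 < C" and *: "\<And>r R x. 0 < r \<Longrightarrow> r < R \<Longrightarrow> R \<le> 1 \<Longrightarrow> x \<in> measure_support M \<Longrightarrow>
     mass x R \<le> C * (R / r) powr u * R powr (- v) * mass x r" using bound by blast
  show ?thesis
    using finite_M \<Phi> C v
  proof (rule dim_le_of_ratio_bound)
    show "\<forall>\<^sub>F R in at_right 0. \<forall>r x. 0 < r \<longrightarrow> r < R \<longrightarrow> x \<in> measure_support M \<longrightarrow>
       mass x R \<le> C * (R / r) powr u * R powr (- v) * mass x r"
      using eventually_at_right_0_less[of 1, OF zero_less_one] by eventually_elim (auto intro!: *)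
  qed
qed

lemma Phi_rate_1_nonneg: "dimension_function \<Phi> \<Longrightarrow> 0 \<le> Phi_rate (\<lambda>_. 1) \<Phi>"
  by (rule Phi_rate_nonneg) auto

lemma measure_ball_bounded_below:
  assumes "0 < R"
  obtains c where "0 < c" "\<And>x. 0 \<le> x \<Longrightarrow> x < R \<Longrightarrow> c \<le> mass x R"
proof -
  have "\<forall>\<^sub>F n in sequentially. a n < R \<and> 1 \<le> n"
    using order_tendstoD(2)[OF a_tendsto_0 assms] eventually_ge_at_top[of 1] by eventually_elim auto
  then obtain n where n: "a n < R" "1 \<le> n" by (auto dest: eventually_happens)
  have "p n \<le> mass x R" if "0 \<le> x" "x < R" for x
    using that n a_pos[OF n(2)] by (intro measure_M_atom) (auto simp: dist_real_def)
  then show thesis using p_pos[OF n(2)] that by blast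
qed

text \<open>
  Test balls inside a fixed ball, whose mass is bounded below by that of a single atom.
\<close>
lemma exponent_ge_of_small_balls:
  assumes \<Phi>: "dimension_function \<Phi>" and \<alpha>: "controls \<Phi> M \<alpha>" and K: "0 < K"
    and test: "\<And>R. 0 < R \<Longrightarrow> \<forall>\<^sub>F r in at_right 0. \<exists>x\<in>measure_support M. x < R \<and> mass x r \<le> K * r powr u"
  shows "u \<le> \<alpha>"
proof (rule exponent_ge_of_fixed_ball[OF finite_M \<Phi> \<alpha>], rule eventually_mono[OF eventually_at_right_0_less[of 1]])
  fix R :: real assume R: "0 < R \<and> R < 1"
  obtain c where c: "0 < c" "\<And>x. 0 \<le> x \<Longrightarrow> x < R \<Longrightarrow> c \<le> mass x R"
    using measure_ball_bounded_below[of R] R by blast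
  have "\<forall>\<^sub>F r in at_right 0. \<exists>x\<in>measure_support M. c / K * r powr (- u) * mass x r \<le> mass x R"
    using test[OF R[THEN conjunct1]] eventually_at_right_0_less[of 1, OF zero_less_one]
  proof eventually_elim
    case (elim r)
    then obtain x where x: "x \<in> measure_support M" "x < R" "mass x r \<le> K * r powr u" by blast
    have "c / K * r powr (- u) * mass x r \<le> c / K * r powr (- u) * (K * r powr u)"
      using x c K by (intro mult_left_mono) auto
    also have "\<dots> = c" using elim K by (simp add: powr_minus)
    also have "\<dots> \<le> mass x R" using c(2) support_nonneg x by blast
    finally show ?case using x(1) by blast
  qed
  then have "\<exists>\<^sub>F r in at_right 0. \<exists>x\<in>measure_support M. c / K * r powr (- u) * mass x r \<le> mass x R"
    by (rule eventually_frequently[OF trivial_limit_at_right_real])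
  then show "\<exists>c>0. \<exists>\<^sub>F r in at_right 0. \<exists>x\<in>measure_support M. c * r powr (- u) * mass x r \<le> mass x R"
    using c(1) K by (intro exI[of _ "c / K"]) auto
qed simp

text \<open>
  With an atom at \<open>0\<close> every ball of radius \<open>R\<close> about a point \<open>x < R\<close> has mass at least \<open>p0\<close>, so only the smaller ball
  needs an estimate.
\<close>
lemma exponent_ge_of_scaled_small_balls:
  assumes p0: "p0 \<noteq> 0" and \<Phi>: "dimension_function \<Phi>" and \<alpha>: "controls \<Phi> M \<alpha>"
    and l: "0 < l" "ereal l < Phi_rate (\<lambda>_. 1) \<Phi>" and K: "0 < K"
    and test: "\<forall>\<^sub>F R in at_right 0. \<exists>x\<in>measure_support M. x < R \<and>
        (R / R powr (1 + 1/l)) powr u * R powr (- v) * mass x (R powr (1 + 1/l)) \<le> K"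
  shows "u + v * l \<le> \<alpha>"
proof (rule exponent_ge_of_scaled_ratio_bound[OF finite_M \<Phi> \<alpha> l])
  show "0 < p0 / K" using p0 p0_nonneg K by simp
  show "\<forall>\<^sub>F R in at_right 0. \<exists>x\<in>measure_support M.
     p0 / K * (R / R powr (1 + 1/l)) powr u * R powr (- v) * mass x (R powr (1 + 1/l))
       \<le> mass x R"
    using test
  proof eventually_elim
    case (elim R)
    then obtain x where x: "x \<in> measure_support M" "x < R"
      "(R / R powr (1 + 1/l)) powr u * R powr (- v) * mass x (R powr (1 + 1/l)) \<le> K" (is "?W \<le> K")
      by blast
    have "p0 / K * ?W \<le> p0 / K * K" using x(3) p0_nonneg K by (intro mult_left_mono) auto
    also have "\<dots> = p0" using K by simp
    also have "\<dots> \<le> mass x R" by (rule p0_le_measure_ball[OF support_nonneg[OF x(1)] x(2)])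
    finally show ?case using x(1) by (auto simp: mult.assoc)
  qed
qed

lemma exponent_ge_of_near_0_balls:
  assumes p0: "p0 \<noteq> 0" and \<Phi>: "dimension_function \<Phi>" and \<alpha>: "controls \<Phi> M \<alpha>"
    and l: "0 < l" "ereal l < Phi_rate (\<lambda>_. 1) \<Phi>" and K: "0 < K" and \<delta>: "0 < \<delta>"
    and test: "\<And>r. 0 < r \<Longrightarrow> r < \<delta> \<Longrightarrow> \<exists>x\<in>measure_support M. x \<le> B * r \<and> mass x r \<le> K * r powr u"
  shows "u + u * l \<le> \<alpha>"
proof (rule exponent_ge_of_scaled_small_balls[OF p0 \<Phi> \<alpha> l K])
  have e: "1 < 1 + 1/l" using l by simp
  show "\<forall>\<^sub>F R in at_right 0. \<exists>x\<in>measure_support M. x < R \<and>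
        (R / R powr (1 + 1/l)) powr u * R powr (- u) * mass x (R powr (1 + 1/l)) \<le> K"
    using eventually_powr_less_self[OF e, of B] eventually_powr_less_self[OF e, of 1]
      eventually_at_right_0_less[OF \<delta>]
  proof eventually_elim
    case (elim R)
    define r where "r = R powr (1 + 1/l)"
    have r: "0 < r" "r < \<delta>" using elim by (auto simp: r_def)
    obtain x where x: "x \<in> measure_support M" "x \<le> B * r" "mass x r \<le> K * r powr u"
      using test[OF r] by blast
    have "(R / r) powr u * R powr (- u) * mass x r \<le> (R / r) powr u * R powr (- u) * (K * r powr u)"
      using x by (intro mult_left_mono) auto
    also have "\<dots> = K" using elim r by (simp add: powr_divide powr_minus)
    finally show ?case using x elim unfolding r_def by (intro bexI[of _ x]) auto
  qed
qed

end

context poly_poly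
begin

lemma exponent_ge_s_t:
  assumes \<Phi>: "dimension_function \<Phi>" and \<alpha>: "controls \<Phi> M \<alpha>"
  shows "s \<le> \<alpha>" and "t \<le> \<alpha>"
proof -
  have *: "u \<le> \<alpha>" if K: "0 < K" and e: "0 < e"
    and test: "\<And>r. 0 < r \<Longrightarrow> r \<le> 1 \<Longrightarrow>
      \<exists>x\<in>measure_support M. x \<le> 2 powr lam * r powr e \<and> mass x r \<le> K * r powr u" for K e u
  proof (rule exponent_ge_of_small_balls[OF \<Phi> \<alpha> K])
    fix R :: real assume R: "0 < R"
    have "((\<lambda>r::real. 2 powr lam * r powr e) \<longlongrightarrow> 0) (at_right 0)" using e by real_asymp
    then have "\<forall>\<^sub>F r in at_right 0. 2 powr lam * r powr e < R" using R by (simp add: order_tendstoD)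
    then show "\<forall>\<^sub>F r in at_right 0. \<exists>x\<in>measure_support M. x < R \<and> mass x r \<le> K * r powr u"
      using eventually_at_right_0_less[of 1, OF zero_less_one]
    proof eventually_elim
      case (elim r)
      then obtain x where "x \<in> measure_support M" "x \<le> 2 powr lam * r powr e" "mass x r \<le> K * r powr u"
        using test[of r] by auto
      then show ?case using elim by (intro bexI[of _ x]) auto
    qed
  qed
  obtain C where "0 < C" "\<And>r. 0 < r \<Longrightarrow> r \<le> 1 \<Longrightarrow>
     (\<exists>x\<in>measure_support M. x \<le> 2 powr lam * r \<and> mass x r \<le> C * r powr s)"
    using test_ball_near_0 by blast
  then show "s \<le> \<alpha>" using *[of C 1 s] by auto
  obtain C where "0 < C" "\<And>r. 0 < r \<Longrightarrow> r \<le> 1 \<Longrightarrow>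
     (\<exists>x\<in>measure_support M. x \<le> 2 powr lam * r powr (lam / (lam + 1)) \<and> mass x r \<le> C * r powr t)"
    using test_ball_isolated by blast
  then show "t \<le> \<alpha>" using *[of C "lam / (lam + 1)" t] lam by auto
qed

text \<open>
  The condition \<open>l < lam\<close> enters here: it makes the exponent \<open>(1 + 1/l) lam / (lam + 1)\<close> larger than \<open>1\<close>.
\<close>
lemma eventually_isolated_centre_less:
  assumes "0 < l" "l < lam"
  shows "\<forall>\<^sub>F R in at_right 0. 2 powr lam * (R powr (1 + 1/l)) powr (lam / (lam + 1)) < R"
proof -
  have "l * (lam + 1) < (l + 1) * lam" using assms by (simp add: algebra_simps)
  then have "1 < ((l + 1) * lam) / (l * (lam + 1))" using assms by (subst less_divide_eq_1_pos) auto
  also have "\<dots> = (1 + 1/l) * (lam / (lam + 1))" using assms by (simp add: divide_simps)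
  finally have "1 < (1 + 1/l) * (lam / (lam + 1))" .
  from eventually_powr_less_self[OF this] show ?thesis by (simp only: powr_powr)
qed

lemma scaled_radius_le_1:
  fixes R l :: real assumes "0 < R \<and> R < 1" "0 < l"
  shows "0 < R powr (1 + 1/l)" "R powr (1 + 1/l) \<le> 1"
  using powr_mono'[of 0 "1 + 1/l" R] assms by auto

lemma exponent_isolated_no_atom:
  assumes \<Phi>: "dimension_function \<Phi>" and \<alpha>: "controls \<Phi> M \<alpha>"
    and l: "0 < l" "l < lam" "ereal l < Phi_rate (\<lambda>_. 1) \<Phi>"
  shows "t + (t - s) * l \<le> \<alpha>"
proof -
  obtain C where C: "0 < C" and test: "\<And>r. 0 < r \<Longrightarrow> r \<le> 1 \<Longrightarrow>
     (\<exists>x\<in>measure_support M. x \<le> 2 powr lam * r powr (lam / (lam + 1)) \<and> mass x r \<le> C * r powr t)"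
    using test_ball_isolated by blast
  obtain c' where c': "0 < c'" and lo': "\<And>x r. 0 \<le> x \<Longrightarrow> x \<le> r \<Longrightarrow> 0 < r \<Longrightarrow> r \<le> 1 \<Longrightarrow>
     c' * r powr s \<le> mass x r" using measure_ball_large_ge by blast
  have "0 < c' / C" using C c' by simp
  then show ?thesis
  proof (rule exponent_ge_of_scaled_ratio_bound[OF finite_M \<Phi> \<alpha> l(1,3)])
    show "\<forall>\<^sub>F R in at_right 0. \<exists>x\<in>measure_support M.
       c' / C * (R / R powr (1 + 1/l)) powr t * R powr (- (t - s)) * mass x (R powr (1 + 1/l))
         \<le> mass x R"
      using eventually_isolated_centre_less[OF l(1,2)] eventually_at_right_0_less[of 1, OF zero_less_one]
    proof eventually_elim
      case (elim R)
      define r where "r = R powr (1 + 1/l)"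
      have r: "0 < r" "r \<le> 1" using scaled_radius_le_1[OF elim(2) l(1)] by (auto simp: r_def)
      obtain x where x: "x \<in> measure_support M" "x \<le> 2 powr lam * r powr (lam / (lam + 1))" "mass x r \<le> C * r powr t"
        using test[OF r] by blast
      have "c' / C * (R / r) powr t * R powr (- (t - s)) * mass x r \<le>
         c' / C * (R / r) powr t * R powr (- (t - s)) * (C * r powr t)"
        using x C c' by (intro mult_left_mono) auto
      also have "\<dots> = c' * R powr s" using elim r C by (simp add: powr_divide powr_diff)
      also have "\<dots> \<le> mass x R"
        using lo'[of x R] support_nonneg[OF x(1)] x(2) elim unfolding r_def by auto
      finally show ?case using x(1) unfolding r_def by blast
    qed
  qed
qed

lemma exponent_isolated_atom:
  assumes p0': "p0 \<noteq> 0" and \<Phi>: "dimension_function \<Phi>" and \<alpha>: "controls \<Phi> M \<alpha>"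
    and l: "0 < l" "l < lam" "ereal l < Phi_rate (\<lambda>_. 1) \<Phi>"
  shows "t + t * l \<le> \<alpha>"
proof -
  obtain C where C: "0 < C" and test: "\<And>r. 0 < r \<Longrightarrow> r \<le> 1 \<Longrightarrow>
     (\<exists>x\<in>measure_support M. x \<le> 2 powr lam * r powr (lam / (lam + 1)) \<and> mass x r \<le> C * r powr t)"
    using test_ball_isolated by blast
  show ?thesis
  proof (rule exponent_ge_of_scaled_small_balls[OF p0' \<Phi> \<alpha> l(1,3) C])
    show "\<forall>\<^sub>F R in at_right 0. \<exists>x\<in>measure_support M. x < R \<and>
       (R / R powr (1 + 1/l)) powr t * R powr (- t) * mass x (R powr (1 + 1/l)) \<le> C"
      using eventually_isolated_centre_less[OF l(1,2)] eventually_at_right_0_less[of 1, OF zero_less_one]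
    proof eventually_elim
      case (elim R)
      define r where "r = R powr (1 + 1/l)"
      have r: "0 < r" "r \<le> 1" using scaled_radius_le_1[OF elim(2) l(1)] by (auto simp: r_def)
      obtain x where x: "x \<in> measure_support M" "x \<le> 2 powr lam * r powr (lam / (lam + 1))" "mass x r \<le> C * r powr t"
        using test[OF r] by blast
      have "(R / r) powr t * R powr (- t) * mass x r \<le> (R / r) powr t * R powr (- t) * (C * r powr t)"
        using x by (intro mult_left_mono) auto
      also have "\<dots> = C" using elim r by (simp add: powr_divide powr_minus)
      finally show ?case using x elim unfolding r_def by (intro bexI[of _ x]) auto
    qed
  qed
qed

lemma exponent_near_0_atom:
  assumes p0': "p0 \<noteq> 0" and \<Phi>: "dimension_function \<Phi>" and \<alpha>: "controls \<Phi> M \<alpha>"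
    and l: "0 < l" "ereal l < Phi_rate (\<lambda>_. 1) \<Phi>"
  shows "s + s * l \<le> \<alpha>"
proof -
  obtain C where "0 < C" "\<And>r. 0 < r \<Longrightarrow> r \<le> 1 \<Longrightarrow>
     (\<exists>x\<in>measure_support M. x \<le> 2 powr lam * r \<and> mass x r \<le> C * r powr s)"
    using test_ball_near_0 by blast
  then show ?thesis by (intro exponent_ge_of_near_0_balls[OF p0' \<Phi> \<alpha> l, of C 1 "2 powr lam"]) auto
qed

lemma exponent_dense_atom:
  assumes p0': "p0 \<noteq> 0" and \<Phi>: "dimension_function \<Phi>" and \<alpha>: "controls \<Phi> M \<alpha>"
    and l: "lam < l" "ereal l < Phi_rate (\<lambda>_. 1) \<Phi>"
  shows "1 + s * l \<le> \<alpha>"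
proof -
  have l0: "0 < l" using l lam by simp
  obtain C where C: "0 < C" and test: "\<And>R r. 0 < R \<Longrightarrow> R \<le> 1 \<Longrightarrow> R powr (1 + 1 / lam) \<le> r \<Longrightarrow> r \<le> R / 2 powr (lam + 1) \<Longrightarrow>
     (\<exists>x\<in>measure_support M. x < R \<and> mass x r \<le> C * (r * R powr (s - 1)))"
    using test_ball_dense by blast
  show ?thesis
  proof (rule exponent_ge_of_scaled_small_balls[OF p0' \<Phi> \<alpha> l0 l(2) C])
    have "1 < 1 + 1/l" using l0 by simp
    from eventually_powr_less_self[OF this, of "2 powr (lam + 1)"]
    show "\<forall>\<^sub>F R in at_right 0. \<exists>x\<in>measure_support M. x < R \<and>
       (R / R powr (1 + 1/l)) powr 1 * R powr (- s) * mass x (R powr (1 + 1/l)) \<le> C"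
      using eventually_at_right_0_less[of 1, OF zero_less_one]
    proof eventually_elim
      case (elim R)
      define r where "r = R powr (1 + 1/l)"
      have r: "0 < r" "r \<le> 1" using scaled_radius_le_1[OF elim(2) l0] by (auto simp: r_def)
      have "R powr (1 + 1 / lam) \<le> r" unfolding r_def using elim l lam by (intro powr_mono') (auto simp: frac_le)
      moreover have "r \<le> R / 2 powr (lam + 1)" using elim by (simp add: r_def field_simps)
      ultimately obtain x where x: "x \<in> measure_support M" "x < R" "mass x r \<le> C * (r * R powr (s - 1))"
        using test[of R r] elim by auto
      have "(R / r) powr 1 * R powr (- s) * mass x r \<le>
         (R / r) powr 1 * R powr (- s) * (C * (r * R powr (s - 1)))"
        using x by (intro mult_left_mono) auto
      also have "\<dots> = C * (R powr (- s) * (R * R powr (s - 1)))" using elim r by simp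
      also have "R powr (- s) * (R * R powr (s - 1)) = 1"
        using elim powr_mult_base[of R "s - 1"] by (simp flip: powr_add)
      finally show ?case using x unfolding r_def by (intro bexI[of _ x]) auto
    qed
  qed
qed

text \<open>
  The limit \<open>l \<rightarrow> lam\<close> of the bound from isolated test balls, since \<open>t + (t - s) lam = 1\<close>; for \<open>s > 1\<close> the bound \<open>s\<close>
  is stronger.
\<close>
lemma exponent_ge_1:
  assumes \<Phi>: "dimension_function \<Phi>" and \<alpha>: "controls \<Phi> M \<alpha>" and L: "ereal lam \<le> Phi_rate (\<lambda>_. 1) \<Phi>"
  shows "1 \<le> \<alpha>"
proof (cases "s \<le> 1")
  case True
  have "ereal t + ereal (t - s) * ereal lam \<le> ereal \<alpha>"
  proof (rule ereal_add_mult_le[of _ _ _ _ 0])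
    show "t + (t - s) * l \<le> \<alpha>" if "0 < l" "ereal l < ereal lam" for l
      using that less_le_trans[OF that(2) L] by (intro exponent_isolated_no_atom[OF \<Phi> \<alpha>]) auto
  qed (use exponent_ge_s_t[OF \<Phi> \<alpha>] s_le_t_iff True lam in auto)
  moreover have "t + (t - s) * lam = 1" using t_at_lam s_at_lam by (simp add: algebra_simps)
  ultimately show ?thesis by simp
qed (use exponent_ge_s_t[OF \<Phi> \<alpha>] in auto)

lemma dim_le_max_1_s:
  assumes \<Phi>: "dimension_function \<Phi>" and "p0 = 0"
  shows "upper_Phi_dim \<Phi> M \<le> ereal (max 1 s)"
proof -
  obtain C where "0 < C" and *: "\<And>r R x. 0 < r \<Longrightarrow> r < R \<Longrightarrow> R \<le> 1 \<Longrightarrow> x \<in> measure_support M \<Longrightarrow>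
     mass x R \<le> C * (R / r) powr max 1 s * mass x r"
    using ratio_bound_away_from_atom assms by blast
  have "upper_Phi_dim \<Phi> M \<le> ereal (max 1 s) + ereal 0 * Phi_rate (\<lambda>_. 1) \<Phi>"
    using \<open>0 < C\<close> * by (intro dim_leI[OF \<Phi>] exI[of _ C]) auto
  then show ?thesis by (simp flip: zero_ereal_def)
qed

lemma dim_no_atom_large_rate:
  assumes \<Phi>: "dimension_function \<Phi>" and "p0 = 0" and L: "ereal lam \<le> Phi_rate (\<lambda>_. 1) \<Phi>"
  shows "upper_Phi_dim \<Phi> M = ereal (max 1 s)"
proof (rule antisym[OF dim_le_max_1_s[OF assms(1,2)]])
  show "ereal (max 1 s) \<le> upper_Phi_dim \<Phi> M"
    using exponent_ge_s_t[OF \<Phi>] exponent_ge_1[OF \<Phi> _ L]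
    by (intro upper_Phi_dim_ge[OF finite_M \<Phi>]) auto
qed

lemma dim_no_atom_small_rate:
  assumes \<Phi>: "dimension_function \<Phi>" and "p0 = 0" and L: "Phi_rate (\<lambda>_. 1) \<Phi> \<le> ereal lam"
  shows "upper_Phi_dim \<Phi> M = max (ereal t + Phi_rate (\<lambda>_. 1) \<Phi> * ereal (t - s)) (ereal s)"
proof (rule antisym)
  let ?L = "Phi_rate (\<lambda>_. 1) \<Phi>"
  obtain L' where L': "?L = ereal L'" "0 \<le> L'"
    using L Phi_rate_1_nonneg[OF \<Phi>] by (cases ?L) auto
  show "upper_Phi_dim \<Phi> M \<le> max (ereal t + ?L * ereal (t - s)) (ereal s)"
  proof (cases "s \<le> 1")
    case True
    have "upper_Phi_dim \<Phi> M \<le> ereal t + ereal (t - s) * ?L"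
      using True s_le_t_iff assms(2) by (intro dim_leI[OF \<Phi>] ratio_bound_isolated_no_atom) auto
    then show ?thesis by (simp add: mult.commute le_max_iff_disj)
  next
    case False
    then show ?thesis using dim_le_max_1_s[OF assms(1,2)] by (simp add: le_max_iff_disj)
  qed
  show "max (ereal t + ?L * ereal (t - s)) (ereal s) \<le> upper_Phi_dim \<Phi> M"
  proof (rule upper_Phi_dim_ge[OF finite_M \<Phi>])
    fix \<alpha> assume \<alpha>: "controls \<Phi> M \<alpha>"
    note fixed = exponent_ge_s_t[OF \<Phi> \<alpha>]
    have "ereal t + ereal (t - s) * ?L \<le> ereal \<alpha>"
    proof (cases "s \<le> t")
      case True
      show ?thesis
      proof (rule ereal_add_mult_le[of _ _ _ _ 0])
        show "t + (t - s) * l \<le> \<alpha>" if "0 < l" "ereal l < ?L" for l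
          using that less_le_trans[OF that(2) L] by (intro exponent_isolated_no_atom[OF \<Phi> \<alpha>]) auto
      qed (use fixed True L' in auto)
    next
      case False
      then have "(t - s) * L' \<le> 0" using L' by (intro mult_nonpos_nonneg) auto
      then show ?thesis using fixed L' by simp
    qed
    then show "max (ereal t + ?L * ereal (t - s)) (ereal s) \<le> ereal \<alpha>"
      using fixed by (simp add: mult.commute)
  qed
qed

lemma dim_atom_large_rate:
  assumes \<Phi>: "dimension_function \<Phi>" and p0': "p0 \<noteq> 0" and L: "ereal lam \<le> Phi_rate (\<lambda>_. 1) \<Phi>"
  shows "upper_Phi_dim \<Phi> M = ereal s * Phi_rate (\<lambda>_. 1) \<Phi> + ereal (max 1 s)"
proof (rule antisym)
  let ?L = "Phi_rate (\<lambda>_. 1) \<Phi>"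
  have "upper_Phi_dim \<Phi> M \<le> ereal (max 1 s) + ereal s * ?L"
  proof (cases "s \<le> 1")
    case True
    have "upper_Phi_dim \<Phi> M \<le> ereal 1 + ereal s * ?L"
      using s_pos True by (intro dim_leI[OF \<Phi>] ratio_bound_mixed) auto
    then show ?thesis using max_absorb1[OF True] by simp
  next
    case False
    then have "max s t = s" "max 1 s = s" using s_le_t_iff by auto
    then show ?thesis
      using s_pos ratio_bound_total dim_leI[OF \<Phi>, of s s] by simp
  qed
  then show "upper_Phi_dim \<Phi> M \<le> ereal s * ?L + ereal (max 1 s)" by (simp add: add.commute)
  show "ereal s * ?L + ereal (max 1 s) \<le> upper_Phi_dim \<Phi> M"
  proof (rule upper_Phi_dim_ge[OF finite_M \<Phi>])
    \<comment> \<open>At \<open>L = lam\<close> no \<open>l\<close> lies strictly between \<open>lam\<close> and \<open>L\<close>; isolated test balls with \<open>l < lam\<close> then give the same value.\<close>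
    fix \<alpha> assume \<alpha>: "controls \<Phi> M \<alpha>"
    note fixed = exponent_ge_s_t[OF \<Phi> \<alpha>]
    have "ereal (max 1 s) + ereal s * ?L \<le> ereal \<alpha>"
    proof (cases "s \<le> 1")
      case s1: True
      show ?thesis
      proof (cases "?L = ereal lam")
        case True
        have "ereal t + ereal t * ?L \<le> ereal \<alpha>"
        proof (rule ereal_add_mult_le[of _ _ _ _ 0])
          show "t + t * l \<le> \<alpha>" if "0 < l" "ereal l < ?L" for l
            using that True by (intro exponent_isolated_atom[OF p0' \<Phi> \<alpha>]) auto
        qed (use fixed t_pos lam True in auto)
        moreover have "t + t * lam = 1 + s * lam" using t_at_lam s_at_lam by (simp add: algebra_simps)
        ultimately show ?thesis using True max_absorb1[OF s1] by simp
      next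
        case False
        have "ereal 1 + ereal s * ?L \<le> ereal \<alpha>"
        proof (rule ereal_add_mult_le[of _ _ _ _ "ereal lam"])
          show "1 + s * l \<le> \<alpha>" if "ereal lam < ereal l" "ereal l < ?L" for l
            using that by (intro exponent_dense_atom[OF p0' \<Phi> \<alpha>]) auto
        qed (use exponent_ge_1[OF \<Phi> \<alpha> L] s_pos lam L False Phi_rate_1_nonneg[OF \<Phi>] in auto)
        then show ?thesis using max_absorb1[OF s1] by simp
      qed
    next
      case False
      have "ereal s + ereal s * ?L \<le> ereal \<alpha>"
      proof (rule ereal_add_mult_le[of _ _ _ _ 0])
        show "s + s * l \<le> \<alpha>" if "0 < l" "ereal l < ?L" for l
          using that by (intro exponent_near_0_atom[OF p0' \<Phi> \<alpha>]) auto
      qed (use fixed s_pos Phi_rate_1_nonneg[OF \<Phi>] in auto)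
      then show ?thesis using False by simp
    qed
    then show "ereal s * ?L + ereal (max 1 s) \<le> ereal \<alpha>" by (simp add: add.commute)
  qed
qed

lemma dim_atom_small_rate:
  assumes \<Phi>: "dimension_function \<Phi>" and p0': "p0 \<noteq> 0" and L: "Phi_rate (\<lambda>_. 1) \<Phi> \<le> ereal lam"
  shows "upper_Phi_dim \<Phi> M = (1 + Phi_rate (\<lambda>_. 1) \<Phi>) * ereal (max s t)"
proof -
  let ?L = "Phi_rate (\<lambda>_. 1) \<Phi>"
  obtain L' where L': "?L = ereal L'" "0 \<le> L'"
    using L Phi_rate_1_nonneg[OF \<Phi>] by (cases ?L) auto
  have "upper_Phi_dim \<Phi> M \<le> ereal (max s t) + ereal (max s t) * ?L"
    using s_pos by (intro dim_leI[OF \<Phi>] ratio_bound_total) auto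
  moreover have "ereal (max s t) + ereal (max s t) * ?L \<le> upper_Phi_dim \<Phi> M"
  proof (rule upper_Phi_dim_ge[OF finite_M \<Phi>])
    fix \<alpha> assume \<alpha>: "controls \<Phi> M \<alpha>"
    note fixed = exponent_ge_s_t[OF \<Phi> \<alpha>]
    show "ereal (max s t) + ereal (max s t) * ?L \<le> ereal \<alpha>"
    proof (rule ereal_add_mult_le[of _ _ _ _ 0])
      show "max s t + max s t * l \<le> \<alpha>" if "0 < l" "ereal l < ?L" for l
        using exponent_near_0_atom[OF p0' \<Phi> \<alpha> that] exponent_isolated_atom[OF p0' \<Phi> \<alpha> that(1) _ that(2)]
          less_le_trans[OF that(2) L] by (auto simp: max_def)
    qed (use fixed s_pos L' in auto)
  qed
  ultimately have "upper_Phi_dim \<Phi> M = ereal (max s t) + ereal (max s t) * ?L" by (rule antisym)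
  also have "\<dots> = (1 + ?L) * ereal (max s t)" unfolding L' one_ereal_def by (cases "s \<le> t") (auto simp: max_def algebra_simps)
  finally show ?thesis .
qed

end


section \<open>Exponential masses at exponential positions\<close>
lemma sum_geometric_tail_le:
  fixes b :: real
  assumes b: "1 < b" and F: "finite F" "\<And>n. n \<in> F \<Longrightarrow> N \<le> n"
  shows "(\<Sum>n\<in>F. b powr (- real n)) \<le> b / (b - 1) * b powr (- real N)"
proof -
  have tele: "(\<Sum>n\<in>{N..<N+k}. b powr (- real n)) = b / (b - 1) * (b powr (- real N) - b powr (- real (N + k)))" for k
  proof (induction k)
    case (Suc k)
    have "b powr (- real (N + Suc k)) = b powr (- real (N + k)) / b"
      using b by (simp add: powr_diff[symmetric] powr_minus_divide powr_add[symmetric] powr_diff field_simps)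
    then have "b powr (- real (N + k)) = b / (b - 1) * (b powr (- real (N + k)) - b powr (- real (N + Suc k)))"
      using b by (simp add: field_simps)
    then show ?case using Suc by (simp add: algebra_simps)
  qed simp
  obtain k where "F \<subseteq> {..<k}" using finite_nat_iff_bounded F(1) by blast
  then have "F \<subseteq> {N..<N+k}" using F(2) by force
  then have "(\<Sum>n\<in>F. b powr (- real n)) \<le> (\<Sum>n\<in>{N..<N+k}. b powr (- real n))"
    by (intro sum_mono2) auto
  also have "\<dots> \<le> b / (b - 1) * b powr (- real N)"
    unfolding tele using b by (intro mult_left_mono) auto
  finally show ?thesis .
qed

lemma summable_geometric_powr:
  fixes b :: real assumes "1 < b" shows "summable (\<lambda>n. b powr (- real (Suc n)))"
proof -
  have "b powr (- real (Suc n)) = (1 / b) ^ Suc n" for n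
    using assms by (simp add: powr_minus powr_realpow power_one_over inverse_eq_divide del: of_nat_Suc power_Suc)
  then show ?thesis using assms summable_geometric[of "1 / b"] by (subst summable_Suc_iff[of "\<lambda>n. b powr (- real n)"]) (simp add: powr_minus powr_realpow power_one_over inverse_eq_divide)
qed

locale exp_exp =
  fixes p0 :: real and p a :: "nat \<Rightarrow> real" and \<beta> lam :: real
  assumes p0: "0 \<le> p0" and \<beta>: "1 < \<beta>" and lam: "1 < lam"
    and p: "\<And>n. 1 \<le> n \<Longrightarrow> p n = \<beta> powr (- real n)"
    and a: "\<And>n. 1 \<le> n \<Longrightarrow> a n = lam powr (- real n)"

sublocale exp_exp \<subseteq> atomic_masses p0 p a
proof
  show "summable (\<lambda>n. p (Suc n))" using summable_geometric_powr[OF \<beta>] by (simp add: p)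
  have "(\<lambda>n. lam powr (- real n)) \<longlonglongrightarrow> 0" using lam by real_asymp
  then show "a \<longlonglongrightarrow> 0"
    by (rule Lim_transform_eventually) (auto simp: a intro: eventually_mono[OF eventually_ge_at_top[of 1]])
qed (use p0 \<beta> lam in \<open>auto simp: p a\<close>)

text \<open>
  The index of the last power of \<open>1/lam\<close> that is at least \<open>r\<close>. The bound on \<open>r\<close> makes it at least \<open>1\<close>, the first index of an atom.
\<close>
lemma geometric_index:
  fixes lam r :: real
  assumes lam: "1 < lam" and r: "0 < r" "r \<le> 1 / lam"
  obtains n where "1 \<le> n" "r \<le> lam powr (- real n)" "lam powr (- real n) < lam * r"
    "lam powr (- real (Suc n)) < r" "r / lam \<le> lam powr (- real (Suc n))" "real n \<le> - ln r / ln lam"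
    "- ln r / ln lam < real n + 1"
proof -
  define y where "y = - ln r / ln lam"
  have ry: "r = lam powr (- y)" using r lam by (simp add: y_def powr_def)
  have "ln r \<le> ln (1 / lam)" using r lam by (subst ln_le_cancel_iff) auto
  then have "1 \<le> y" using lam by (simp add: y_def ln_div field_simps)
  define n where "n = nat \<lfloor>y\<rfloor>"
  have n: "1 \<le> n" "real n \<le> y" "y < real n + 1" unfolding n_def using \<open>1 \<le> y\<close> by linarith+
  have mult: "lam * lam powr (- y) = lam powr (1 - y)" "lam powr (- y) / lam = lam powr (- y - 1)"
    using lam powr_mult_base[of lam "- y"] powr_diff[of lam "- y" 1] by auto
  show thesis
  proof (rule that[OF n(1)])
    show "r \<le> lam powr (- real n)" "lam powr (- real (Suc n)) < r"
      unfolding ry using n lam by (auto intro!: powr_mono powr_less_mono)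
    show "lam powr (- real n) < lam * r" "r / lam \<le> lam powr (- real (Suc n))"
      unfolding ry mult using n lam by (auto intro!: powr_mono powr_less_mono)
  qed (use n in \<open>simp_all add: y_def\<close>)
qed

context exp_exp
begin

definition "s = ln \<beta> / ln lam"

lemma s_pos: "0 < s" using \<beta> lam by (simp add: s_def)

lemma p_eq_a_powr: "1 \<le> n \<Longrightarrow> p n = a n powr s"
  using \<beta> lam by (simp add: p a powr_powr s_def) (simp add: powr_def)

text \<open>
  The geometric tail is dominated by its first term, which is the power \<open>s\<close> of the position of the first atom in the set.
\<close>
lemma measure_below_le:
  assumes "A \<in> sets borel" "A \<subseteq> {..<\<rho>}" "0 < \<rho>"
  shows "measure M A \<le> p0 * indicator A 0 + \<beta> / (\<beta> - 1) * \<rho> powr s"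
proof (rule measure_M_le[OF assms(1)])
  fix F assume F: "finite F" "F \<subseteq> {1..}" "a ` F \<subseteq> A"
  show "sum p F \<le> \<beta> / (\<beta> - 1) * \<rho> powr s"
  proof (cases "F = {}")
    case False
    define N where "N = Min F"
    have N: "N \<in> F" "\<And>n. n \<in> F \<Longrightarrow> N \<le> n" using F False by (auto simp: N_def)
    have "sum p F = (\<Sum>n\<in>F. \<beta> powr (- real n))" using F(2) by (intro sum.cong) (auto simp: p)
    also have "\<dots> \<le> \<beta> / (\<beta> - 1) * \<beta> powr (- real N)"
      using \<beta> F N by (intro sum_geometric_tail_le) auto
    also have "\<beta> powr (- real N) = a N powr s" using N(1) F(2) p_eq_a_powr[of N] p[of N] by auto
    also have "\<beta> / (\<beta> - 1) * a N powr s \<le> \<beta> / (\<beta> - 1) * \<rho> powr s"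
      using N(1) F assms(2) \<beta> s_pos a_pos[of N] by (intro mult_left_mono powr_mono2) force+
    finally show ?thesis .
  qed (use \<beta> in auto)
qed

lemma measure_ball_le:
  assumes "0 \<le> x" "0 < R" "p0 = 0 \<or> R \<le> x"
  shows "mass x R \<le> \<beta> / (\<beta> - 1) * 2 powr s * max x R powr s"
proof -
  have "mass x R \<le> p0 * indicator (ball x R) 0 + \<beta> / (\<beta> - 1) * (2 * max x R) powr s"
    using assms by (intro measure_below_le) (auto simp: dist_real_def)
  also have "p0 * indicator (ball x R) 0 = 0" using assms by (auto simp: indicator_def dist_real_def)
  finally show ?thesis using assms by (simp add: powr_mult)
qed

text \<open>
  For \<open>r \<le> x\<close> the central atom suffices, and for \<open>r > x\<close> the first atom below \<open>r\<close>.
\<close>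
lemma measure_ball_ge:
  assumes x: "x \<in> measure_support M" and r: "0 < r" "r \<le> 1 / lam"
  shows "lam powr (- s) * max x r powr s \<le> mass x r"
proof (cases "r \<le> x")
  case True
  then obtain n where n: "1 \<le> n" "x = a n" using x r by (auto elim!: support_cases)
  have "lam powr (- s) * max x r powr s \<le> 1 * max x r powr s"
    using lam s_pos powr_mono[of "- s" 0 lam] by (intro mult_right_mono) auto
  also have "\<dots> = p n" using True n by (simp add: p_eq_a_powr)
  also have "\<dots> \<le> mass x r" using n r by (intro measure_M_atom) auto
  finally show ?thesis .
next
  case False
  obtain n where n: "lam powr (- real (Suc n)) < r" "r / lam \<le> lam powr (- real (Suc n))"
    using geometric_index[OF lam r] by metis
  have an: "a (Suc n) < r" "r / lam \<le> a (Suc n)" using n by (auto simp: a)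
  have "lam powr (- s) * max x r powr s = (r / lam) powr s"
    using False r lam by (simp add: powr_divide powr_minus_divide)
  also have "\<dots> \<le> a (Suc n) powr s" using an r lam s_pos by (intro powr_mono2) auto
  also have "\<dots> = p (Suc n)" by (simp add: p_eq_a_powr)
  also have "\<dots> \<le> mass x r"
    using an a_pos[of "Suc n"] support_nonneg[OF x] False by (intro measure_M_atom) (auto simp: dist_real_def)
  finally show ?thesis .
qed

lemma ratio_bound_away_from_atom:
  assumes r: "0 < r" "r < R" "R \<le> 1" "r \<le> 1 / lam" and x: "x \<in> measure_support M" and near: "p0 = 0 \<or> R \<le> x"
  shows "mass x R \<le> \<beta> / (\<beta> - 1) * 2 powr s * lam powr s * (R / r) powr s * mass x r"
proof -
  let ?C = "\<beta> / (\<beta> - 1) * 2 powr s"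
  have C: "0 \<le> ?C" using \<beta> by auto
  have x0: "0 \<le> x" by (rule support_nonneg[OF x])
  have "mass x R \<le> ?C * max x R powr s"
    using measure_ball_le[OF x0 _ near] r by simp
  also have "max x R \<le> (R / r) * max x r"
  proof -
    have "1 * x \<le> (R / r) * max x r" using r x0 by (intro mult_mono) auto
    moreover have "(R / r) * r \<le> (R / r) * max x r" using r by (intro mult_left_mono) auto
    ultimately show ?thesis using r by simp
  qed
  then have "?C * max x R powr s \<le> ?C * ((R / r) * max x r) powr s"
    using C s_pos r by (intro mult_left_mono powr_mono2) auto
  also have "\<dots> = ?C * lam powr s * (R / r) powr s * (lam powr (- s) * max x r powr s)"
  proof -
    have "((R / r) * max x r) powr s = (R / r) powr s * max x r powr s" using r by (subst powr_mult) auto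
    moreover have "lam powr s * lam powr (- s) = 1" using lam by (simp flip: powr_add)
    ultimately show ?thesis by (simp add: mult_ac)
  qed
  also have "\<dots> \<le> ?C * lam powr s * (R / r) powr s * mass x r"
    using measure_ball_ge[OF x r(1,4)] \<beta> by (intro mult_left_mono mult_nonneg_nonneg) auto
  finally show ?thesis .
qed

lemma ratio_bound_total:
  assumes r: "0 < r" "r < R" "R \<le> 1" "r \<le> 1 / lam" and x: "x \<in> measure_support M"
  shows "mass x R \<le> measure M UNIV * lam powr s * (R / r) powr s * R powr (- s) * mass x r"
proof -
  have "mass x R \<le> measure M UNIV" by (rule measure_M_le_total)
  also have "\<dots> = measure M UNIV * lam powr s * (R / r) powr s * R powr (- s) * (lam powr (- s) * r powr s)"
    using r lam by (simp add: powr_divide powr_minus_divide)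
  also have "lam powr (- s) * r powr s \<le> lam powr (- s) * max x r powr s"
    using r s_pos by (intro mult_left_mono powr_mono2) auto
  also note measure_ball_ge[OF x r(1,4)]
  finally show ?thesis using total_pos by (auto simp: mult_left_mono)
qed

lemma test_ball_near_0:
  assumes r: "0 < r" "r \<le> 1 / lam"
  shows "\<exists>x\<in>measure_support M. x \<le> lam * r \<and> mass x r \<le> \<beta> / (\<beta> - 1) * 2 powr s * lam powr s * r powr s"
proof -
  obtain n where n: "1 \<le> n" "r \<le> lam powr (- real n)" "lam powr (- real n) < lam * r"
    using geometric_index[OF lam r] by metis
  then have an: "r \<le> a n" "a n \<le> lam * r" by (auto simp: a)
  have "mass (a n) r \<le> \<beta> / (\<beta> - 1) * 2 powr s * max (a n) r powr s"
    using r an by (intro measure_ball_le) auto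
  also have "\<dots> \<le> \<beta> / (\<beta> - 1) * 2 powr s * (lam * r) powr s"
    using an r \<beta> s_pos by (intro mult_left_mono powr_mono2) auto
  finally show ?thesis using an atom_in_support[OF n(1)] r lam
    by (intro bexI[of _ "a n"]) (auto simp: powr_mult mult_ac)
qed

lemma exponent_ge_s:
  assumes \<Phi>: "dimension_function \<Phi>" and \<alpha>: "controls \<Phi> M \<alpha>"
  shows "s \<le> \<alpha>"
proof (rule exponent_ge_of_small_balls[OF \<Phi> \<alpha>])
  show "0 < \<beta> / (\<beta> - 1) * 2 powr s * lam powr s" using \<beta> lam by auto
  fix R :: real assume R: "0 < R"
  show "\<forall>\<^sub>F r in at_right 0. \<exists>x\<in>measure_support M. x < R \<and> mass x r \<le> \<beta> / (\<beta> - 1) * 2 powr s * lam powr s * r powr s"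
  proof (rule eventually_mono[OF eventually_at_right_0_less[of "min (1/lam) (R/lam)"]])
    show "0 < min (1 / lam) (R / lam)" using R lam by simp
    fix r assume r: "0 < r \<and> r < min (1 / lam) (R / lam)"
    then have "lam * r < R" using lam by (simp add: field_simps)
    moreover obtain x where "x \<in> measure_support M" "x \<le> lam * r"
      "mass x r \<le> \<beta> / (\<beta> - 1) * 2 powr s * lam powr s * r powr s"
      using test_ball_near_0[of r] r by auto
    ultimately show "\<exists>x\<in>measure_support M. x < R \<and> mass x r \<le> \<beta> / (\<beta> - 1) * 2 powr s * lam powr s * r powr s"
      by (intro bexI[of _ x]) auto
  qed
qed

lemma dim_no_atom:
  assumes \<Phi>: "dimension_function \<Phi>" and "p0 = 0"
  shows "upper_Phi_dim \<Phi> M = ereal s"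
proof (rule antisym)
  let ?C = "\<beta> / (\<beta> - 1) * 2 powr s * lam powr s"
  have "upper_Phi_dim \<Phi> M \<le> ereal s + ereal 0 * Phi_rate (\<lambda>_. 1) \<Phi>"
  proof (rule dim_le_of_ratio_bound[OF finite_M \<Phi>])
    show "0 < ?C" using \<beta> lam by auto
    have "0 < 1 / lam" using lam by simp
    from eventually_at_right_0_less[OF this]
    show "\<forall>\<^sub>F R in at_right 0. \<forall>r x. 0 < r \<longrightarrow> r < R \<longrightarrow> x \<in> measure_support M \<longrightarrow>
       mass x R \<le> ?C * (R / r) powr s * R powr (- 0) * mass x r"
    proof (eventually_elim, intro allI impI)
      fix R r x assume A: "0 < R \<and> R < 1 / lam" "0 < r" "r < R" "x \<in> measure_support M"
      have "1 / lam \<le> 1" using lam by simp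
      then show "mass x R \<le> ?C * (R / r) powr s * R powr (- 0) * mass x r"
        using ratio_bound_away_from_atom[of r R x] A assms(2) by simp
    qed
  qed simp
  then show "upper_Phi_dim \<Phi> M \<le> ereal s" by (simp flip: zero_ereal_def)
  show "ereal s \<le> upper_Phi_dim \<Phi> M"
    using exponent_ge_s[OF \<Phi>] by (intro upper_Phi_dim_ge[OF finite_M \<Phi>]) auto
qed

lemma dim_atom:
  assumes \<Phi>: "dimension_function \<Phi>" and p0': "p0 \<noteq> 0"
  shows "upper_Phi_dim \<Phi> M = (1 + Phi_rate (\<lambda>_. 1) \<Phi>) * ereal s"
proof -
  let ?L = "Phi_rate (\<lambda>_. 1) \<Phi>"
  let ?C = "measure M UNIV * lam powr s"
  have "upper_Phi_dim \<Phi> M \<le> ereal s + ereal s * ?L"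
  proof (rule dim_le_of_ratio_bound[OF finite_M \<Phi>])
    show "0 < ?C" using total_pos lam by auto
    have "0 < 1 / lam" using lam by simp
    from eventually_at_right_0_less[OF this]
    show "\<forall>\<^sub>F R in at_right 0. \<forall>r x. 0 < r \<longrightarrow> r < R \<longrightarrow> x \<in> measure_support M \<longrightarrow>
       mass x R \<le> ?C * (R / r) powr s * R powr (- s) * mass x r"
    proof (eventually_elim, intro allI impI)
      fix R r x assume A: "0 < R \<and> R < 1 / lam" "0 < r" "r < R" "x \<in> measure_support M"
      have "1 / lam \<le> 1" using lam by simp
      then show "mass x R \<le> ?C * (R / r) powr s * R powr (- s) * mass x r"
        using ratio_bound_total[of r R x] A by simp
    qed
  qed (use s_pos in simp)
  moreover have "ereal s + ereal s * ?L \<le> upper_Phi_dim \<Phi> M"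
  proof (rule upper_Phi_dim_ge[OF finite_M \<Phi>])
    fix \<alpha> assume \<alpha>: "controls \<Phi> M \<alpha>"
    show "ereal s + ereal s * ?L \<le> ereal \<alpha>"
    proof (rule ereal_add_mult_le[of _ _ _ _ 0])
      show "s + s * l \<le> \<alpha>" if "0 < l" "ereal l < ?L" for l
        using \<beta> lam test_ball_near_0
        by (intro exponent_ge_of_near_0_balls[OF p0' \<Phi> \<alpha> that, of "\<beta> / (\<beta> - 1) * 2 powr s * lam powr s" "1 / lam" lam]) auto
    qed (use exponent_ge_s[OF \<Phi> \<alpha>] s_pos Phi_rate_1_nonneg[OF \<Phi>] in auto)
  qed
  ultimately have "upper_Phi_dim \<Phi> M = ereal s + ereal s * ?L" by (rule antisym)
  also have "\<dots> = (1 + ?L) * ereal s"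
    using Phi_rate_1_nonneg[OF \<Phi>] s_pos unfolding one_ereal_def
    by (cases ?L) (auto simp: algebra_simps)
  finally show ?thesis .
qed

end

section \<open>Exponential masses at polynomial positions\<close>
locale exp_poly =
  fixes p0 :: real and p a :: "nat \<Rightarrow> real" and \<beta> lam :: real
  assumes p0: "0 \<le> p0" and \<beta>: "1 < \<beta>" and lam: "0 < lam"
    and p: "\<And>n. 1 \<le> n \<Longrightarrow> p n = \<beta> powr (- real n)"
    and a: "\<And>n. 1 \<le> n \<Longrightarrow> a n = real n powr (- lam)"

sublocale exp_poly \<subseteq> atomic_masses p0 p a
proof
  show "summable (\<lambda>n. p (Suc n))" using summable_geometric_powr[OF \<beta>] by (simp add: p)
  have "(\<lambda>n. real n powr (- lam)) \<longlonglongrightarrow> 0" using lam by real_asymp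
  then show "a \<longlonglongrightarrow> 0"
    by (rule Lim_transform_eventually) (auto simp: a intro: eventually_mono[OF eventually_ge_at_top[of 1]])
qed (use p0 \<beta> in \<open>auto simp: p a\<close>)

context exp_poly
begin

text \<open>
  By convexity of \<open>y \<mapsto> y^(-lam)\<close> the neighbour on the left is the nearest one, and \<open>(n+1)^(-lam-1) \<ge> (2 n)^(-lam-1)\<close> bounds its distance.
\<close>
lemma measure_isolated_ball:
  assumes n: "1 \<le> n" and r: "0 < r" "r \<le> lam * 2 powr (- lam - 1) * real n powr (- lam - 1)" "r \<le> a n"
  shows "mass (a n) r \<le> p n"
proof -
  have below: "a m \<le> a n - r" if "n < m" for m
  proof -
    have "lam * 1 * (2 * real n) powr (- lam - 1) \<le> lam * (real (Suc n) - real n) * real (Suc n) powr (- lam - 1)"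
      using n lam by (intro mult_mono powr_mono2') auto
    also have "\<dots> \<le> a n - a (Suc n)"
      using powr_minus_diff_bounds(1)[of "real n" "real (Suc n)" lam] n lam by (simp add: a)
    finally have "r \<le> a n - a (Suc n)" using r(2) by (simp add: powr_mult mult_ac)
    moreover have "a m \<le> a (Suc n)" using that lam by (auto simp: a intro!: powr_mono2')
    ultimately show ?thesis by simp
  qed
  have above: "a n + r \<le> a m" if "1 \<le> m" "m < n" for m
  proof -
    have "r \<le> lam * 1 * real n powr (- lam - 1)"
    proof -
      have "(2::real) powr (- lam - 1) \<le> 1" using lam powr_mono[of "- lam - 1" 0 "2::real"] by simp
      then have "lam * 2 powr (- lam - 1) * real n powr (- lam - 1) \<le> lam * 1 * real n powr (- lam - 1)"
        using lam by (intro mult_right_mono mult_left_mono) auto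
      then show ?thesis using r(2) by linarith
    qed
    also have "\<dots> \<le> lam * (real n - real m) * real n powr (- lam - 1)"
      using that lam by (intro mult_right_mono mult_left_mono) auto
    also have "\<dots> \<le> a m - a n"
      using powr_minus_diff_bounds(1)[of "real m" "real n" lam] that n lam by (simp add: a)
    finally show ?thesis by simp
  qed
  have "mass (a n) r \<le> p0 * indicator (ball (a n) r) 0 + p n"
  proof (rule measure_M_le)
    fix F assume F: "finite F" "F \<subseteq> {1..}" "a ` F \<subseteq> ball (a n) r"
    have "F \<subseteq> {n}"
    proof
      fix m assume "m \<in> F"
      then have "1 \<le> m" "\<bar>a n - a m\<bar> < r" using F by (auto simp: dist_real_def)
      then show "m \<in> {n}" using below[of m] above[of m] by (cases m n rule: linorder_cases) auto
    qed
    then show "sum p F \<le> p n" using p_pos[OF n] by (auto simp: subset_singleton_iff)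
  qed simp
  also have "indicator (ball (a n) r) 0 = (0::real)" using r by (auto simp: dist_real_def)
  finally show ?thesis by simp
qed

text \<open>
  A radius \<open>r\<close> isolates the atom with index of order \<open>Y = r^(-1/(lam+1))\<close>, whose mass is exponentially small in \<open>Y\<close> and
  therefore less than every power of \<open>r\<close>.
\<close>
lemma no_finite_exponent:
  assumes \<Phi>: "dimension_function \<Phi>" and \<alpha>: "controls \<Phi> M \<alpha>"
  shows "u \<le> \<alpha>"
proof (rule exponent_ge_of_small_balls[OF \<Phi> \<alpha> zero_less_one])
  fix R :: real assume R: "0 < R"
  define c where "c = min 1 (lam * 2 powr (- lam - 1))"
  have c: "0 < c" "c \<le> 1" "c \<le> lam * 2 powr (- lam - 1)" using lam by (auto simp: c_def)
  define Y where "Y r = (r / c) powr (- 1 / (lam + 1))" for r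
  have "filterlim Y at_top (at_right 0)" unfolding Y_def using c lam by real_asymp
  then have evY: "\<forall>\<^sub>F r in at_right 0. 1 \<le> Y r" by (auto simp: filterlim_at_top)
  have "((\<lambda>r. (Y r / 2) powr (- lam)) \<longlongrightarrow> 0) (at_right 0)" unfolding Y_def using c lam by real_asymp
  then have evR: "\<forall>\<^sub>F r in at_right 0. (Y r / 2) powr (- lam) < R" using R by (simp add: order_tendstoD)
  have "\<forall>\<^sub>F r in at_right 0. \<beta> powr (- (Y r / 2)) \<le> r powr u"
  proof -
    have "((\<lambda>r. \<beta> powr (- (Y r / 2)) * r powr (- u)) \<longlongrightarrow> 0) (at_right 0)"
      unfolding Y_def using c lam \<beta> by real_asymp
    then have "\<forall>\<^sub>F r in at_right 0. \<beta> powr (- (Y r / 2)) * r powr (- u) < 1" by (simp add: order_tendstoD)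
    then show ?thesis using eventually_at_right_0_less[of 1, OF zero_less_one]
    proof eventually_elim
      case (elim r)
      have "\<beta> powr (- (Y r / 2)) = (\<beta> powr (- (Y r / 2)) * r powr (- u)) * r powr u"
        using elim by (simp add: powr_minus)
      also have "\<dots> \<le> 1 * r powr u" using elim by (intro mult_right_mono) auto
      finally show ?case by simp
    qed
  qed
  then show "\<forall>\<^sub>F r in at_right 0. \<exists>x\<in>measure_support M. x < R \<and> mass x r \<le> 1 * r powr u"
    using evY evR eventually_at_right_0_less[of 1, OF zero_less_one]
  proof eventually_elim
    case (elim r)
    define n where "n = nat \<lfloor>Y r\<rfloor>"
    have n: "1 \<le> n" "real n \<le> Y r" "Y r / 2 \<le> real n"
    proof -
      show "1 \<le> n" "real n \<le> Y r" unfolding n_def using elim by linarith+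
      moreover have "Y r < real n + 1" unfolding n_def using elim by linarith
      ultimately show "Y r / 2 \<le> real n" by linarith
    qed
    have "r = c * Y r powr (- lam - 1)"
    proof -
      have "- 1 / (lam + 1) * (- lam - 1) = 1" using lam by (simp add: field_simps)
      then show ?thesis using elim c by (simp add: Y_def powr_powr)
    qed
    also have "\<dots> \<le> c * real n powr (- lam - 1)" using n c lam by (intro mult_left_mono powr_mono2') auto
    finally have r: "r \<le> c * real n powr (- lam - 1)" .
    have "r \<le> a n"
    proof -
      have "c * real n powr (- lam - 1) \<le> 1 * real n powr (- lam)"
        using n c by (intro mult_mono powr_mono) auto
      then show ?thesis using r n by (simp add: a)
    qed
    moreover have "r \<le> lam * 2 powr (- lam - 1) * real n powr (- lam - 1)"
      using r c mult_right_mono[OF c(3), of "real n powr (- lam - 1)"] by simp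
    ultimately have "mass (a n) r \<le> p n" using n elim by (intro measure_isolated_ball) auto
    also have "\<dots> \<le> \<beta> powr (- (Y r / 2))" using n \<beta> by (simp add: p)
    also have "\<dots> \<le> r powr u" by (rule elim)
    finally have "mass (a n) r \<le> 1 * r powr u" by simp
    moreover have "a n < R"
    proof -
      have "a n \<le> (Y r / 2) powr (- lam)" using n elim lam by (auto simp: a intro!: powr_mono2')
      then show ?thesis using elim by simp
    qed
    ultimately show ?case using atom_in_support[OF n(1)] by blast
  qed
qed

lemma dim_eq_infinity:
  assumes \<Phi>: "dimension_function \<Phi>"
  shows "upper_Phi_dim \<Phi> M = \<infinity>"
proof -
  have "\<infinity> \<le> upper_Phi_dim \<Phi> M"
  proof (rule upper_Phi_dim_ge[OF finite_M \<Phi>])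
    fix \<alpha> assume "controls \<Phi> M \<alpha>"
    then have "\<alpha> + 1 \<le> \<alpha>" by (rule no_finite_exponent[OF \<Phi>])
    then show "\<infinity> \<le> ereal \<alpha>" by simp
  qed
  then show ?thesis by simp
qed

end


section \<open>Polynomial masses at exponential positions\<close>
lemma one_plus_ln_powr_le:
  fixes y \<beta> e :: real
  assumes "1 \<le> y" "0 < \<beta>" "0 < e"
  shows "(1 + ln y) powr \<beta> \<le> (1 + \<beta> / e) powr \<beta> * y powr e"
proof -
  define d where "d = e / \<beta>"
  have d: "0 < d" using assms by (simp add: d_def)
  have "ln (y powr d) \<le> y powr d - 1" using assms by (intro ln_le_minus_one) auto
  then have "d * ln y \<le> y powr d" using assms by (simp add: ln_powr)
  then have "ln y \<le> (1 / d) * y powr d" using d by (simp add: field_simps)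
  moreover have "1 \<le> y powr d" using assms d by (intro ge_one_powr_ge_zero) auto
  ultimately have "1 + ln y \<le> (1 + 1 / d) * y powr d" by (simp add: algebra_simps)
  then have "(1 + ln y) powr \<beta> \<le> ((1 + 1 / d) * y powr d) powr \<beta>"
    using assms by (intro powr_mono2) auto
  also have "\<dots> = (1 + \<beta> / e) powr \<beta> * y powr e"
    using assms d by (subst powr_mult) (auto simp: powr_powr d_def)
  finally show ?thesis .
qed

lemma abs_ln_ge_1:
  fixes r :: real assumes "0 < r" "r \<le> exp (-1)" shows "1 \<le> \<bar>ln r\<bar>" "\<bar>ln r\<bar> = - ln r"
proof -
  have "ln r \<le> ln (exp (-1))" using assms by (subst ln_le_cancel_iff) auto
  then show "1 \<le> \<bar>ln r\<bar>" "\<bar>ln r\<bar> = - ln r" by auto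
qed

lemma powr_one_plus_Psi:
  fixes R l :: real
  assumes "0 < R" "R \<le> exp (-1)"
  shows "R powr (1 + Psi R / l) = R * \<bar>ln R\<bar> powr (- 1 / l)"
proof -
  note N = abs_ln_ge_1[OF assms]
  have "R powr (Psi R / l) = exp (Psi R / l * ln R)" using assms by (simp add: powr_def)
  also have "Psi R / l * ln R = - 1 / l * ln \<bar>ln R\<bar>" using N by (simp add: Psi_def)
  also have "exp \<dots> = \<bar>ln R\<bar> powr (- 1 / l)" using N by (simp add: powr_def)
  finally show ?thesis using assms by (simp add: powr_add)
qed

lemma eventually_Psi_pos: "\<forall>\<^sub>F x in at_right 0. 0 < Psi x"
  unfolding Psi_def by real_asymp

locale poly_exp =
  fixes p0 :: real and p a :: "nat \<Rightarrow> real" and \<beta> lam :: real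
  assumes p0: "0 \<le> p0" and \<beta>: "1 < \<beta>" and lam: "1 < lam"
    and p: "\<And>n. 1 \<le> n \<Longrightarrow> p n = real n powr (- \<beta>)"
    and a: "\<And>n. 1 \<le> n \<Longrightarrow> a n = lam powr (- real n)"

sublocale poly_exp \<subseteq> atomic_masses p0 p a
proof
  have "summable (\<lambda>n. real (Suc n) powr (- \<beta>))"
    using \<beta> summable_real_powr_iff[of "- \<beta>"] by (subst summable_Suc_iff) simp
  then show "summable (\<lambda>n. p (Suc n))" by (simp add: p)
  have "(\<lambda>n. lam powr (- real n)) \<longlonglongrightarrow> 0" using lam by real_asymp
  then show "a \<longlonglongrightarrow> 0"
    by (rule Lim_transform_eventually) (auto simp: a intro: eventually_mono[OF eventually_ge_at_top[of 1]])
qed (use p0 lam in \<open>auto simp: p a\<close>)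

context poly_exp
begin

text \<open>
  The ratio of the distance between \<open>a n\<close> and its left neighbour to \<open>a n\<close>.
\<close>
definition "\<kappa> = 1 - 1 / lam"

lemma \<kappa>: "0 < \<kappa>" "\<kappa> < 1" "\<kappa> \<le> lam - 1"
proof -
  show "0 < \<kappa>" "\<kappa> < 1" using lam by (auto simp: \<kappa>_def)
  have "\<kappa> * 1 \<le> \<kappa> * lam" using lam \<open>0 < \<kappa>\<close> by (intro mult_left_mono) auto
  then show "\<kappa> \<le> lam - 1" using lam by (simp add: \<kappa>_def algebra_simps)
qed

lemma ln_lam: "0 < ln lam" using lam by simp

lemma measure_isolated_ball:
  assumes n: "1 \<le> n" and r: "0 < r" "r \<le> \<kappa> * a n"
  shows "mass (a n) r = p n"
proof (rule antisym)
  have an: "0 < a n" by (rule a_pos[OF n])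
  have "\<kappa> * a n < 1 * a n" using \<kappa> an by (intro mult_strict_right_mono) auto
  then have ra: "r < a n" using r by simp
  have step: "a m \<le> a k / lam" if "1 \<le> k" "k < m" for k m
  proof -
    have "a m \<le> lam powr (- real k - 1)" using that lam by (auto simp: a intro!: powr_mono)
    then show ?thesis using that lam by (simp add: a powr_diff)
  qed
  have "mass (a n) r \<le> p0 * indicator (ball (a n) r) 0 + p n"
  proof (rule measure_M_le)
    fix F assume F: "finite F" "F \<subseteq> {1..}" "a ` F \<subseteq> ball (a n) r"
    have "F \<subseteq> {n}"
    proof
      fix m assume "m \<in> F"
      then have m: "1 \<le> m" "\<bar>a n - a m\<bar> < r" using F by (auto simp: dist_real_def)
      show "m \<in> {n}"
      proof (cases m n rule: linorder_cases)
        case less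
        then have "lam * a n \<le> a m" using step[of m n] m lam by (simp add: field_simps)
        moreover have "\<kappa> * a n \<le> (lam - 1) * a n" using \<kappa> an by (intro mult_right_mono) auto
        ultimately show ?thesis using m r by (simp add: algebra_simps)
      next
        case greater
        then have "\<kappa> * a n \<le> a n - a m" using step[of n m] n by (simp add: \<kappa>_def algebra_simps)
        then show ?thesis using m r by simp
      qed simp
    qed
    then show "sum p F \<le> p n" using p_pos[OF n] by (auto simp: subset_singleton_iff)
  qed simp
  also have "indicator (ball (a n) r) 0 = (0::real)" using ra by (auto simp: dist_real_def)
  finally show "mass (a n) r \<le> p n" by simp
  show "p n \<le> mass (a n) r" using n r by (intro measure_M_atom) auto
qed

lemma ball_index:
  assumes "0 < r" "r \<le> exp (-1)" "0 \<le> x" "x < r"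
  obtains N where "1 \<le> N" "real N \<le> (1 / ln lam + 1) * \<bar>ln r\<bar>" "\<And>n. N \<le> n \<Longrightarrow> a n \<in> ball x r"
proof -
  note M = abs_ln_ge_1[OF assms(1,2)]
  define y where "y = - ln r / ln lam"
  have y: "0 < y" unfolding y_def using M ln_lam by (intro divide_pos_pos) auto
  have ry: "r = lam powr (- y)" using assms lam by (simp add: y_def powr_def)
  define N where "N = nat \<lfloor>y\<rfloor> + 1"
  have N: "y < real N" "real N \<le> y + 1" unfolding N_def using y by linarith+
  show thesis
  proof (rule that[of N])
    have "real N \<le> y + 1 * \<bar>ln r\<bar>" using N M by simp
    also have "y = 1 / ln lam * \<bar>ln r\<bar>" using M by (simp add: y_def)
    finally show "real N \<le> (1 / ln lam + 1) * \<bar>ln r\<bar>" by (simp add: algebra_simps)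
    fix n assume n: "N \<le> n"
    then have n1: "1 \<le> n" "y < real n" using N by (auto simp: N_def)
    have "a n < r" unfolding ry using n1 lam by (auto simp: a intro!: powr_less_mono)
    then show "a n \<in> ball x r" using a_pos[OF n1(1)] assms by (auto simp: dist_real_def)
  qed (simp add: N_def)
qed

text \<open>
  Either the central atom \<open>a n \<ge> r\<close>, or the first atom below \<open>r\<close>, has an index of order at most \<open>|ln r|\<close>.
\<close>
lemma measure_ball_ge:
  "\<exists>c>0. \<forall>x r. x \<in> measure_support M \<longrightarrow> 0 < r \<longrightarrow> r \<le> exp (-1) \<longrightarrow> c * \<bar>ln r\<bar> powr (- \<beta>) \<le> mass x r"
proof (intro exI[of _ "(1 / ln lam + 1) powr (- \<beta>)"] conjI allI impI)
  have B: "0 < 1 / ln lam + 1" using ln_lam by (simp add: add_pos_pos)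
  then show "0 < (1 / ln lam + 1) powr (- \<beta>)" by simp
  fix x r :: real assume x: "x \<in> measure_support M" and r: "0 < r" "r \<le> exp (-1)"
  note M = abs_ln_ge_1[OF r]
  have main: "(1 / ln lam + 1) powr (- \<beta>) * \<bar>ln r\<bar> powr (- \<beta>) \<le> p n"
    if n: "1 \<le> n" "real n \<le> (1 / ln lam + 1) * \<bar>ln r\<bar>" for n
  proof -
    have "(1 / ln lam + 1) powr (- \<beta>) * \<bar>ln r\<bar> powr (- \<beta>) = ((1 / ln lam + 1) * \<bar>ln r\<bar>) powr (- \<beta>)"
      using B by (subst powr_mult) auto
    also have "\<dots> \<le> real n powr (- \<beta>)" using n \<beta> by (intro powr_mono2') auto
    finally show ?thesis using n by (simp add: p)
  qed
  show "(1 / ln lam + 1) powr (- \<beta>) * \<bar>ln r\<bar> powr (- \<beta>) \<le> mass x r"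
  proof (cases "r \<le> x")
    case True
    then obtain n where n: "1 \<le> n" "x = a n" using x r by (auto elim!: support_cases)
    have "ln r \<le> ln (a n)" using True r n a_pos[of n] by (subst ln_le_cancel_iff) auto
    then have "real n * ln lam \<le> \<bar>ln r\<bar>" using n lam M by (simp add: a ln_powr)
    then have "real n \<le> 1 / ln lam * \<bar>ln r\<bar>" using ln_lam by (simp add: field_simps)
    also have "\<dots> \<le> (1 / ln lam + 1) * \<bar>ln r\<bar>" by (intro mult_right_mono) auto
    finally show ?thesis using main[OF n(1)] measure_M_atom[of "ball x r" n] n r by fastforce
  next
    case False
    obtain N where "1 \<le> N" "real N \<le> (1 / ln lam + 1) * \<bar>ln r\<bar>" "a N \<in> ball x r"
      using ball_index[OF r support_nonneg[OF x]] False by (metis linorder_not_le order_refl)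
    then show ?thesis using main[of N] measure_M_atom[of "ball x r" N] by fastforce
  qed
qed

text \<open>
  The atoms below \<open>r\<close> with indices from \<open>N\<close> to \<open>2 N\<close>, where \<open>N\<close> is of order \<open>|ln r|\<close>, have this total mass.
\<close>
lemma measure_ball_large_ge:
  "\<exists>c>0. \<forall>x r. 0 \<le> x \<longrightarrow> x < r \<longrightarrow> r \<le> exp (-1) \<longrightarrow> c * \<bar>ln r\<bar> powr (1 - \<beta>) \<le> mass x r"
proof (intro exI[of _ "2 powr (- \<beta>) * (1 / ln lam + 1) powr (1 - \<beta>)"] conjI allI impI)
  have B: "0 < 1 / ln lam + 1" using ln_lam by (simp add: add_pos_pos)
  then show "0 < 2 powr (- \<beta>) * (1 / ln lam + 1) powr (1 - \<beta>)" by (intro mult_pos_pos) auto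
  fix x r :: real assume x: "0 \<le> x" "x < r" and r: "r \<le> exp (-1)"
  then have r0: "0 < r" by simp
  obtain N where N: "1 \<le> N" "real N \<le> (1 / ln lam + 1) * \<bar>ln r\<bar>" "\<And>n. N \<le> n \<Longrightarrow> a n \<in> ball x r"
    using ball_index[OF r0 r x] by blast
  have "2 powr (- \<beta>) * (1 / ln lam + 1) powr (1 - \<beta>) * \<bar>ln r\<bar> powr (1 - \<beta>) =
      2 powr (- \<beta>) * ((1 / ln lam + 1) * \<bar>ln r\<bar>) powr (1 - \<beta>)"
    using B by (subst powr_mult) auto
  also have "\<dots> \<le> 2 powr (- \<beta>) * real N powr (1 - \<beta>)"
    using N \<beta> by (intro mult_left_mono powr_mono2') auto
  also have "\<dots> = real N * real (2 * N) powr (- \<beta>)"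
    using N by (simp add: powr_mult powr_diff powr_minus divide_inverse)
  also have "\<dots> \<le> real (card {N..2*N}) * real (2 * N) powr (- \<beta>)"
    by (intro mult_right_mono) auto
  also have "\<dots> \<le> (\<Sum>n\<in>{N..2*N}. real n powr (- \<beta>))"
    using N \<beta> by (intro sum_powr_ge) auto
  also have "\<dots> = sum p {N..2*N}" using N by (intro sum.cong) (auto simp: p)
  also have "\<dots> \<le> mass x r" using N by (intro sum_le_measure_M) auto
  finally show "2 powr (- \<beta>) * (1 / ln lam + 1) powr (1 - \<beta>) * \<bar>ln r\<bar> powr (1 - \<beta>) \<le> mass x r" .
qed

text \<open>
  All atoms of the ball lie below a constant multiple of \<open>R\<close>, so their indices are at least of order \<open>|ln R|\<close>.
\<close>
lemma measure_ball_large_le: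
  assumes "p0 = 0"
  shows "\<exists>C>0. \<forall>\<^sub>F R in at_right 0. \<forall>x. 0 \<le> x \<longrightarrow> \<kappa> * x < R \<longrightarrow> mass x R \<le> C * \<bar>ln R\<bar> powr (1 - \<beta>)"
proof -
  \<comment> \<open>The ball lies below \<open>x + R\<close>, which is less than \<open>b R\<close>.\<close>
  define b where "b = 1 + 1 / \<kappa>"
  have b: "0 < b" using \<kappa> by (simp add: b_def add_pos_pos)
  define C where "C = 2 powr \<beta> / (\<beta> - 1) * (1 / (2 * ln lam)) powr (1 - \<beta>)"
  have "\<forall>\<^sub>F R in at_right 0. \<bar>ln R\<bar> \<le> 2 * (- ln (b * R))" using b by real_asymp
  then have "\<forall>\<^sub>F R in at_right 0. \<forall>x. 0 \<le> x \<longrightarrow> \<kappa> * x < R \<longrightarrow> mass x R \<le> C * \<bar>ln R\<bar> powr (1 - \<beta>)"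
    using eventually_at_right_0_less[of "exp (-1)", OF exp_gt_zero]
  proof (eventually_elim, intro allI impI)
    fix R x assume R: "\<bar>ln R\<bar> \<le> 2 * (- ln (b * R))" "0 < R \<and> R < exp (-1)" and x: "0 \<le> x" "\<kappa> * x < R"
    have N: "1 \<le> \<bar>ln R\<bar>" using abs_ln_ge_1[of R] R by auto
    have "mass x R \<le> p0 * indicator (ball x R) 0 + C * \<bar>ln R\<bar> powr (1 - \<beta>)"
    proof (rule measure_M_le)
      fix F assume F: "finite F" "F \<subseteq> {1..}" "a ` F \<subseteq> ball x R"
      have large: "\<bar>ln R\<bar> / (2 * ln lam) \<le> real n" if "n \<in> F" for n
      proof -
        have n: "1 \<le> n" "a n < x + R" using that F by (auto simp: dist_real_def)
        have "x < R / \<kappa>" using x \<kappa> by (simp add: field_simps)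
        then have "a n \<le> b * R" using n by (simp add: b_def algebra_simps)
        then have "ln (a n) \<le> ln (b * R)" using a_pos[OF n(1)] b R by (subst ln_le_cancel_iff) auto
        then have "\<bar>ln R\<bar> \<le> 2 * (real n * ln lam)" using R(1) n lam by (simp add: a ln_powr)
        then show ?thesis using ln_lam by (simp add: field_simps)
      qed
      have "sum p F = (\<Sum>n\<in>F. real n powr (- \<beta>))" using F by (intro sum.cong) (auto simp: p)
      also have "\<dots> \<le> 2 powr \<beta> / (\<beta> - 1) * (\<bar>ln R\<bar> / (2 * ln lam)) powr (1 - \<beta>)"
        using \<beta> F N ln_lam large by (intro sum_powr_tail_le) auto
      also have "(\<bar>ln R\<bar> / (2 * ln lam)) powr (1 - \<beta>) = (1 / (2 * ln lam)) powr (1 - \<beta>) * \<bar>ln R\<bar> powr (1 - \<beta>)"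
        using ln_lam by (subst powr_mult[symmetric]) auto
      finally show "sum p F \<le> C * \<bar>ln R\<bar> powr (1 - \<beta>)" by (simp add: C_def)
    qed simp
    then show "mass x R \<le> C * \<bar>ln R\<bar> powr (1 - \<beta>)" using assms by simp
  qed
  moreover have "0 < C" using \<beta> ln_lam by (simp add: C_def)
  ultimately show ?thesis by blast
qed

text \<open>
  Chosen so that \<open>|ln R|^(K-\<beta>)\<close> is the order of the mass of a ball of radius \<open>R\<close> around the origin: \<open>1 - \<beta>\<close> comes from the
  sum of the masses of the atoms in the ball, and \<open>0\<close> from the atom at the origin.
\<close>
definition "K = (if p0 = 0 then 1 else \<beta>)"

lemma K_pos: "0 < K" using \<beta> by (simp add: K_def)

lemma measure_ball_beyond_gap_le:
  "\<exists>C>0. \<forall>\<^sub>F R in at_right 0. \<forall>x. 0 \<le> x \<longrightarrow> \<kappa> * x < R \<longrightarrow> mass x R \<le> C * \<bar>ln R\<bar> powr (K - \<beta>)"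
proof (cases "p0 = 0")
  case True
  then have "K = 1" unfolding K_def by simp
  then show ?thesis using measure_ball_large_le[OF True] by simp
next
  case False
  then have "\<forall>\<^sub>F R in at_right 0. \<forall>x. 0 \<le> x \<longrightarrow> \<kappa> * x < R \<longrightarrow> mass x R \<le> measure M UNIV * \<bar>ln R\<bar> powr (K - \<beta>)"
    using measure_M_le_total
    by (intro eventually_mono[OF eventually_at_right_0_less[of "exp (-1)", OF exp_gt_zero]])
       (use abs_ln_ge_1(1) in \<open>force simp: K_def\<close>)
  then show ?thesis using total_pos by blast
qed

lemma measure_ball_around_0_ge:
  "\<exists>c>0. \<forall>x r. 0 \<le> x \<longrightarrow> x < r \<longrightarrow> r \<le> exp (-1) \<longrightarrow> c * \<bar>ln r\<bar> powr (K - \<beta>) \<le> mass x r"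
proof (cases "p0 = 0")
  case True
  then have "K = 1" unfolding K_def by simp
  then show ?thesis using measure_ball_large_ge by simp
next
  case False
  have "p0 * \<bar>ln r\<bar> powr (K - \<beta>) \<le> mass x r" if "0 \<le> x" "x < r" "r \<le> exp (-1)" for x r
    using abs_ln_ge_1(1)[of r] p0_le_measure_ball[of x r] that False by (simp add: K_def)
  then show ?thesis using False p0 by (intro exI[of _ p0]) auto
qed

text \<open>
  If the larger ball contains more than its centre, its mass is at most of order \<open>|ln R|^(K-\<beta>)\<close>, and the smaller one has
  mass at least of order \<open>|ln r|^(-\<beta>)\<close>, where \<open>|ln r| = |ln R| + ln (R/r)\<close> is at most \<open>|ln R| (1 + ln (R/r))\<close>. If not, the two
  masses coincide.
\<close>
lemma ratio_bound:
  "\<exists>C>0. \<forall>\<^sub>F R in at_right 0. \<forall>r x. 0 < r \<longrightarrow> r < R \<longrightarrow> x \<in> measure_support M \<longrightarrow>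
     mass x R \<le> C * \<bar>ln R\<bar> powr K * (1 + ln (R / r)) powr \<beta> * mass x r"
proof -
  obtain c where c: "0 < c" and lo: "\<And>x r. x \<in> measure_support M \<Longrightarrow> 0 < r \<Longrightarrow> r \<le> exp (-1) \<Longrightarrow>
     c * \<bar>ln r\<bar> powr (- \<beta>) \<le> mass x r" using measure_ball_ge by blast
  obtain C where C: "0 < C" and up: "\<forall>\<^sub>F R in at_right 0. \<forall>x. 0 \<le> x \<longrightarrow> \<kappa> * x < R \<longrightarrow>
     mass x R \<le> C * \<bar>ln R\<bar> powr (K - \<beta>)" using measure_ball_beyond_gap_le by blast
  define D where "D = max 1 (C / c)"
  have D: "1 \<le> D" "C / c \<le> D" by (auto simp: D_def)
  have "\<forall>\<^sub>F R in at_right 0. \<forall>r x. 0 < r \<longrightarrow> r < R \<longrightarrow> x \<in> measure_support M \<longrightarrow>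
     mass x R \<le> D * \<bar>ln R\<bar> powr K * (1 + ln (R / r)) powr \<beta> * mass x r"
    using up eventually_at_right_0_less[of "exp (-1)", OF exp_gt_zero]
  proof (eventually_elim, intro allI impI)
    fix R r x assume up: "\<forall>x. 0 \<le> x \<longrightarrow> \<kappa> * x < R \<longrightarrow> mass x R \<le> C * \<bar>ln R\<bar> powr (K - \<beta>)"
      and R: "0 < R \<and> R < exp (-1)" and r: "0 < r" "r < R" and x: "x \<in> measure_support M"
    let ?N = "\<bar>ln R\<bar>" and ?M = "\<bar>ln r\<bar>"
    have N: "1 \<le> ?N" "?N = - ln R" "1 \<le> ?M" "?M = - ln r"
      using abs_ln_ge_1[of R] abs_ln_ge_1[of r] R r by auto
    have x0: "0 \<le> x" by (rule support_nonneg[OF x])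
    have lnRr: "0 \<le> ln (R / r)" using r by simp
    show "mass x R \<le> D * ?N powr K * (1 + ln (R / r)) powr \<beta> * mass x r"
    proof (cases "\<kappa> * x < R")
      case True
      have quot: "?M \<le> ?N * (1 + ln (R / r))"
      proof -
        have "ln (R / r) \<le> ?N * ln (R / r)" using N(1) lnRr mult_right_mono[of 1 ?N "ln (R / r)"] by simp
        then show ?thesis using N r R by (simp add: ln_div algebra_simps)
      qed
      have "mass x R \<le> C * ?N powr (K - \<beta>)" using up x0 True by blast
      also have "\<dots> = (C / c) * ?N powr K * (?N powr (- \<beta>) * ?M powr \<beta>) * (c * ?M powr (- \<beta>))"
      proof -
        have "?M powr \<beta> * ?M powr (- \<beta>) = 1" using N(3) by (simp flip: powr_add)
        moreover have "?N powr (K - \<beta>) = ?N powr K * ?N powr (- \<beta>)" by (simp flip: powr_add)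
        ultimately show ?thesis using c by simp
      qed
      also have "\<dots> \<le> (C / c) * ?N powr K * (1 + ln (R / r)) powr \<beta> * mass x r"
      proof (intro mult_mono)
        have "?N powr (- \<beta>) * ?M powr \<beta> \<le> ?N powr (- \<beta>) * (?N * (1 + ln (R / r))) powr \<beta>"
          using quot N \<beta> by (intro mult_left_mono powr_mono2) auto
        also have "\<dots> = (1 + ln (R / r)) powr \<beta>" using N(1) lnRr by (simp add: powr_mult powr_minus)
        finally show "?N powr (- \<beta>) * ?M powr \<beta> \<le> (1 + ln (R / r)) powr \<beta>" .
        show "c * ?M powr (- \<beta>) \<le> mass x r" using lo[OF x r(1)] r R by simp
      qed (use C c in auto)
      also have "\<dots> \<le> D * ?N powr K * (1 + ln (R / r)) powr \<beta> * mass x r"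
        using D by (intro mult_right_mono) auto
      finally show ?thesis .
    next
      case False
      then have "x \<noteq> 0" using R by auto
      then obtain n where n: "1 \<le> n" "x = a n" using x by (auto elim!: support_cases)
      have "1 \<le> ?N powr K" using N K_pos by (intro ge_one_powr_ge_zero) auto
      moreover have "1 \<le> (1 + ln (R / r)) powr \<beta>" using lnRr \<beta> by (intro ge_one_powr_ge_zero) auto
      ultimately have "1 * 1 * 1 * mass x r \<le> D * ?N powr K * (1 + ln (R / r)) powr \<beta> * mass x r"
        using D by (intro mult_mono) auto
      moreover have "mass x R = mass x r"
        using measure_isolated_ball[OF n(1), of R] measure_isolated_ball[OF n(1), of r] False R r n by simp
      ultimately show ?thesis by simp
    qed
  qed
  then show ?thesis using D by (intro exI[of _ D]) auto
qed

text \<open>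
  The cutoff gives \<open>r \<le> R |ln R|^(-1/l)\<close>, that is \<open>|ln R| \<le> (R/r)^l\<close>, and the logarithmic factor is absorbed by \<open>(R/r)^e\<close>.
\<close>
lemma controls_above:
  assumes \<Phi>: "dimension_function \<Phi>" and l: "Phi_rate Psi \<Phi> < ereal l" "0 < l" and e: "0 < e"
  shows "controls \<Phi> M (K * l + e)"
proof -
  obtain C where C: "0 < C" and ratio: "\<forall>\<^sub>F R in at_right 0. \<forall>r x. 0 < r \<longrightarrow> r < R \<longrightarrow> x \<in> measure_support M \<longrightarrow>
     mass x R \<le> C * \<bar>ln R\<bar> powr K * (1 + ln (R / r)) powr \<beta> * mass x r"
    using ratio_bound by blast
  define D where "D = C * (1 + \<beta> / e) powr \<beta>"
  have "0 < 1 + \<beta> / e" using \<beta> e by (simp add: add_pos_pos)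
  then have D: "0 < D" using C by (simp add: D_def)
  show ?thesis unfolding controls_def
    using ratio Phi_rate_lessD[OF \<Phi> l eventually_Psi_pos] eventually_at_right_0_less[of "exp (-1)", OF exp_gt_zero]
  proof (intro exI[of _ D] conjI D, eventually_elim, intro allI ballI impI)
    fix R r x assume ratio: "\<forall>r x. 0 < r \<longrightarrow> r < R \<longrightarrow> x \<in> measure_support M \<longrightarrow>
       mass x R \<le> C * \<bar>ln R\<bar> powr K * (1 + ln (R / r)) powr \<beta> * mass x r"
      and *: "R powr (1 + \<Phi> R) \<le> R powr (1 + Psi R / l)"
      and R: "0 < R \<and> R < exp (-1)" and x: "x \<in> measure_support M" and r: "0 < r" "r < R powr (1 + \<Phi> R)"
    have e1: "exp (-1::real) < 1" by simp
    have rR: "r < R" using powr_one_plus_le[OF \<Phi>, of R] r R e1 by linarith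
    have N: "1 \<le> \<bar>ln R\<bar>" using abs_ln_ge_1[of R] R by auto
    have "r \<le> R * \<bar>ln R\<bar> powr (- 1 / l)"
      using powr_one_plus_Psi[of R l] R * r by simp
    then have "r * \<bar>ln R\<bar> powr (1 / l) \<le> R * \<bar>ln R\<bar> powr (- 1 / l) * \<bar>ln R\<bar> powr (1 / l)"
      by (intro mult_right_mono) auto
    also have "\<dots> = R" using N by (simp add: mult.assoc flip: powr_add)
    finally have "\<bar>ln R\<bar> powr (1 / l) \<le> R / r" using r by (simp add: field_simps)
    then have "(\<bar>ln R\<bar> powr (1 / l)) powr (K * l) \<le> (R / r) powr (K * l)"
      using K_pos l by (intro powr_mono2) auto
    then have 1: "\<bar>ln R\<bar> powr K \<le> (R / r) powr (K * l)" using l by (simp add: powr_powr)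
    have 2: "(1 + ln (R / r)) powr \<beta> \<le> (1 + \<beta> / e) powr \<beta> * (R / r) powr e"
      using rR r \<beta> e by (intro one_plus_ln_powr_le) auto
    have "mass x R \<le> C * \<bar>ln R\<bar> powr K * (1 + ln (R / r)) powr \<beta> * mass x r"
      using ratio r rR x by blast
    also have "\<dots> \<le> C * (R / r) powr (K * l) * ((1 + \<beta> / e) powr \<beta> * (R / r) powr e) * mass x r"
      using 1 2 C by (intro mult_mono) auto
    also have "\<dots> = D * (R / r) powr (K * l + e) * mass x r"
      by (simp add: D_def powr_add)
    finally show "mass x R \<le> D * (R / r) powr (K * l + e) * mass x r" .
  qed
qed

text \<open>
  Needed in its own right, because the upper limit of \<open>Psi/\<Phi>\<close> may be \<open>0\<close>.
\<close>
lemma exponent_nonneg: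
  assumes \<Phi>: "dimension_function \<Phi>" and \<alpha>: "controls \<Phi> M \<alpha>"
  shows "0 \<le> \<alpha>"
proof (rule exponent_ge_of_small_balls[OF \<Phi> \<alpha> total_pos])
  fix R :: real assume R: "0 < R"
  have "\<forall>\<^sub>F n in sequentially. a n < R \<and> 1 \<le> n"
    using order_tendstoD(2)[OF a_tendsto_0 R] eventually_ge_at_top[of 1] by eventually_elim auto
  then obtain n where n: "a n < R" "1 \<le> n" by (auto dest: eventually_happens)
  then show "\<forall>\<^sub>F r in at_right 0. \<exists>x\<in>measure_support M. x < R \<and> mass x r \<le> measure M UNIV * r powr 0"
    using atom_in_support[OF n(2)] measure_M_le_total
    by (intro eventually_mono[OF eventually_at_right_0_less[OF R]]) (auto intro!: bexI[of _ "a n"])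
qed

text \<open>
  An atom whose distance to its neighbours is comparable to \<open>R |ln R|^(-1/l)\<close>. Its index is of order at least \<open>|ln R|\<close>, and it lies below \<open>R\<close> because
  \<open>|ln R|^(-1/l)\<close> tends to \<open>0\<close>.
\<close>
lemma test_ball:
  assumes l: "0 < l"
  shows "\<exists>C>0. \<forall>\<^sub>F R in at_right 0. \<exists>x\<in>measure_support M. x < R \<and>
     mass x (R * \<bar>ln R\<bar> powr (- 1 / l)) \<le> C * \<bar>ln R\<bar> powr (- \<beta>)"
proof (intro exI conjI)
  let ?C = "(1 / (2 * ln lam)) powr (- \<beta>)"
  show "0 < ?C" using ln_lam by simp
  have "((\<lambda>R. lam / \<kappa> * \<bar>ln R\<bar> powr (- 1 / l)) \<longlongrightarrow> 0) (at_right 0)" using l by real_asymp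
  then have ev1: "\<forall>\<^sub>F R in at_right 0. lam / \<kappa> * \<bar>ln R\<bar> powr (- 1 / l) < 1" by (simp add: order_tendstoD)
  have ev2: "\<forall>\<^sub>F R in at_right 0. \<bar>ln R\<bar> / (2 * ln lam) + 1 \<le> - ln (R / \<kappa>) / ln lam"
  proof -
    have "\<forall>\<^sub>F R in at_right 0. \<bar>ln R\<bar> / 2 + ln lam \<le> - ln (R / \<kappa>)" using \<kappa> by real_asymp
    then show ?thesis
    proof eventually_elim
      case (elim R)
      then have "(\<bar>ln R\<bar> / 2 + ln lam) / ln lam \<le> - ln (R / \<kappa>) / ln lam" using ln_lam by (intro divide_right_mono) auto
      then show ?case using ln_lam by (simp add: add_divide_distrib)
    qed
  qed
  have "0 < \<kappa> / lam" using \<kappa> lam by simp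
  from ev1 ev2 eventually_at_right_0_less[OF this] eventually_at_right_0_less[of "exp (-1)", OF exp_gt_zero]
  show "\<forall>\<^sub>F R in at_right 0. \<exists>x\<in>measure_support M. x < R \<and>
     mass x (R * \<bar>ln R\<bar> powr (- 1 / l)) \<le> ?C * \<bar>ln R\<bar> powr (- \<beta>)"
  proof eventually_elim
    case (elim R)
    define r where "r = R * \<bar>ln R\<bar> powr (- 1 / l)"
    have N: "1 \<le> \<bar>ln R\<bar>" using abs_ln_ge_1[of R] elim by auto
    have "\<bar>ln R\<bar> powr (- 1 / l) \<le> \<bar>ln R\<bar> powr 0" using N l by (intro powr_mono) auto
    also have "\<dots> = 1" using N by auto
    finally have "\<bar>ln R\<bar> powr (- 1 / l) \<le> 1" .
    then have "R * \<bar>ln R\<bar> powr (- 1 / l) \<le> R * 1" using elim by (intro mult_left_mono) auto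
    moreover have "0 < \<bar>ln R\<bar> powr (- 1 / l)" using N by (subst powr_gt_zero) auto
    ultimately have r: "0 < r" "r \<le> R" unfolding r_def using elim by (auto intro: mult_pos_pos)
    have "r \<le> \<kappa> / lam" using r elim by simp
    then have "r / \<kappa> \<le> 1 / lam" using \<kappa> lam by (simp add: field_simps)
    then obtain n where n: "1 \<le> n" "r / \<kappa> \<le> lam powr (- real n)" "lam powr (- real n) < lam * (r / \<kappa>)"
      "- ln (r / \<kappa>) / ln lam < real n + 1"
      using geometric_index[OF lam, of "r / \<kappa>"] r \<kappa> by (metis divide_pos_pos)
    have "a n < R"
    proof -
      have "a n < lam * (r / \<kappa>)" using n by (simp add: a)
      also have "\<dots> = R * (lam / \<kappa> * \<bar>ln R\<bar> powr (- 1 / l))" by (simp add: r_def)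
      also have "\<dots> < R * 1" using elim by (intro mult_strict_left_mono) auto
      finally show ?thesis by simp
    qed
    moreover have "mass (a n) r \<le> ?C * \<bar>ln R\<bar> powr (- \<beta>)"
    proof -
      have "r \<le> \<kappa> * a n" using n \<kappa> by (simp add: a field_simps)
      then have "mass (a n) r = real n powr (- \<beta>)"
        using measure_isolated_ball[OF n(1) r(1)] n by (simp add: p)
      also have "\<dots> \<le> (\<bar>ln R\<bar> / (2 * ln lam)) powr (- \<beta>)"
      proof (intro powr_mono2')
        have "ln (r / \<kappa>) \<le> ln (R / \<kappa>)" using r \<kappa> elim by (subst ln_le_cancel_iff) (auto simp: divide_right_mono)
        then have "- ln (R / \<kappa>) / ln lam \<le> - ln (r / \<kappa>) / ln lam" using ln_lam by (intro divide_right_mono) auto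
        then show "\<bar>ln R\<bar> / (2 * ln lam) \<le> real n" using n(4) elim by linarith
      qed (use N ln_lam \<beta> in auto)
      also have "\<dots> = ?C * \<bar>ln R\<bar> powr (- \<beta>)" using ln_lam by (subst powr_mult[symmetric]) auto
      finally show ?thesis .
    qed
    ultimately show ?case using atom_in_support[OF n(1)] unfolding r_def by blast
  qed
qed

text \<open>
  At the radius \<open>r = R |ln R|^(-1/l)\<close> the masses have a ratio of order at least \<open>|ln R|^K\<close>, while \<open>(R/r)^\<alpha> = |ln R|^(\<alpha>/l)\<close>.
\<close>
lemma exponent_ge:
  assumes \<Phi>: "dimension_function \<Phi>" and \<alpha>: "controls \<Phi> M \<alpha>" and l: "0 < l" "ereal l < Phi_rate Psi \<Phi>"
  shows "K * l \<le> \<alpha>"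
proof (rule ccontr)
  assume neg: "\<not> K * l \<le> \<alpha>"
  obtain C where C: "0 < C" and evC: "\<forall>\<^sub>F R in at_right 0. \<forall>r. \<forall>x\<in>measure_support M.
        0 < r \<longrightarrow> r < R powr (1 + \<Phi> R) \<longrightarrow>
        mass x R \<le> C * (R / r) powr \<alpha> * mass x r"
    using \<alpha> unfolding controls_def by blast
  obtain c where c: "0 < c" and lo: "\<And>x r. 0 \<le> x \<Longrightarrow> x < r \<Longrightarrow> r \<le> exp (-1) \<Longrightarrow> c * \<bar>ln r\<bar> powr (K - \<beta>) \<le> mass x r"
    using measure_ball_around_0_ge by blast
  obtain D where D: "0 < D" and test: "\<forall>\<^sub>F R in at_right 0. \<exists>x\<in>measure_support M. x < R \<and>
     mass x (R * \<bar>ln R\<bar> powr (- 1 / l)) \<le> D * \<bar>ln R\<bar> powr (- \<beta>)" using test_ball[OF l(1)] by blast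
  have "\<forall>\<^sub>F R in at_right 0. R powr (1 + Psi R / l) < R powr (1 + \<Phi> R) \<longrightarrow> c \<le> C * D * \<bar>ln R\<bar> powr (\<alpha> / l - K)"
    using evC test eventually_at_right_0_less[of "exp (-1)", OF exp_gt_zero]
  proof (eventually_elim, intro impI)
    fix R assume *: "\<forall>r. \<forall>x\<in>measure_support M. 0 < r \<longrightarrow> r < R powr (1 + \<Phi> R) \<longrightarrow>
        mass x R \<le> C * (R / r) powr \<alpha> * mass x r"
      and "\<exists>x\<in>measure_support M. x < R \<and> mass x (R * \<bar>ln R\<bar> powr (- 1 / l)) \<le> D * \<bar>ln R\<bar> powr (- \<beta>)"
      and R: "0 < R \<and> R < exp (-1)" and lt: "R powr (1 + Psi R / l) < R powr (1 + \<Phi> R)"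
    then obtain x where x: "x \<in> measure_support M" "x < R"
      "mass x (R * \<bar>ln R\<bar> powr (- 1 / l)) \<le> D * \<bar>ln R\<bar> powr (- \<beta>)" by blast
    let ?N = "\<bar>ln R\<bar>"
    define r where "r = R * ?N powr (- 1 / l)"
    have N: "1 \<le> ?N" using abs_ln_ge_1[of R] R by auto
    have r: "0 < r" "r < R powr (1 + \<Phi> R)" "R / r = ?N powr (1 / l)"
    proof -
      have "0 < ?N powr (- 1 / l)" using N by (subst powr_gt_zero) auto
      then show "0 < r" unfolding r_def using R by (intro mult_pos_pos) auto
      show "r < R powr (1 + \<Phi> R)" using lt powr_one_plus_Psi[of R l] R by (simp add: r_def)
      show "R / r = ?N powr (1 / l)" using R N by (simp add: r_def powr_minus_divide)
    qed
    have "c * ?N powr (K - \<beta>) \<le> mass x R" using lo[of x R] support_nonneg[OF x(1)] x(2) R by auto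
    also have "\<dots> \<le> C * (R / r) powr \<alpha> * mass x r" using * x(1) r by blast
    also have "\<dots> \<le> C * (R / r) powr \<alpha> * (D * ?N powr (- \<beta>))"
      using x(3) C unfolding r_def by (intro mult_left_mono) auto
    also have "(R / r) powr \<alpha> = ?N powr (\<alpha> / l)" by (simp add: r(3) powr_powr)
    finally have "c * ?N powr (K - \<beta>) * ?N powr (\<beta> - K) \<le> C * ?N powr (\<alpha> / l) * (D * ?N powr (- \<beta>)) * ?N powr (\<beta> - K)"
      by (intro mult_right_mono) auto
    moreover have "?N powr (K - \<beta>) * ?N powr (\<beta> - K) = 1" using N by (simp flip: powr_add)
    moreover have "?N powr (\<alpha> / l) * (?N powr (- \<beta>) * ?N powr (\<beta> - K)) = ?N powr (\<alpha> / l - K)"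
      by (simp flip: powr_add)
    ultimately show "c \<le> C * D * ?N powr (\<alpha> / l - K)" by (simp add: mult_ac)
  qed
  with less_Phi_rateD[OF \<Phi> l(2,1) eventually_Psi_pos]
  have "\<exists>\<^sub>F R in at_right 0. c \<le> C * D * \<bar>ln R\<bar> powr (\<alpha> / l - K)" by (rule frequently_rev_mp)
  moreover have "\<alpha> / l - K < 0" using neg l by (simp add: field_simps)
  then have "((\<lambda>R. C * D * \<bar>ln R\<bar> powr (\<alpha> / l - K)) \<longlongrightarrow> 0) (at_right 0)" using C D by real_asymp
  then have "\<forall>\<^sub>F R in at_right 0. C * D * \<bar>ln R\<bar> powr (\<alpha> / l - K) < c" using c by (simp add: order_tendstoD)
  ultimately show False by (simp add: frequently_def not_le)
qed

lemma dim_eq: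
  assumes \<Phi>: "dimension_function \<Phi>"
  shows "upper_Phi_dim \<Phi> M = ereal K * Phi_rate Psi \<Phi>"
proof (rule antisym)
  let ?D = "Phi_rate Psi \<Phi>"
  have D0: "0 \<le> ?D" by (rule Phi_rate_nonneg[OF \<Phi> eventually_Psi_pos])
  show "upper_Phi_dim \<Phi> M \<le> ereal K * ?D"
  proof (cases ?D)
    case (real D)
    have "upper_Phi_dim \<Phi> M \<le> ereal (K * D) + ereal e" if "0 < e" for e
    proof -
      define l where "l = D + e / (2 * K)"
      have l: "?D < ereal l" "0 < l" using D0 real K_pos that by (auto simp: l_def add_nonneg_pos)
      have "upper_Phi_dim \<Phi> M \<le> ereal (K * l + e / 2)"
        using that by (intro upper_Phi_dim_le[OF finite_M \<Phi>] controls_above[OF \<Phi> l]) auto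
      also have "K * l + e / 2 = K * D + e" using K_pos by (simp add: l_def field_simps)
      finally show ?thesis by simp
    qed
    then have "upper_Phi_dim \<Phi> M \<le> ereal (K * D)" by (rule ereal_le_epsilon2)
    then show ?thesis using real by simp
  qed (use D0 K_pos in auto)
  show "ereal K * ?D \<le> upper_Phi_dim \<Phi> M"
  proof (rule upper_Phi_dim_ge[OF finite_M \<Phi>])
    fix \<alpha> assume \<alpha>: "controls \<Phi> M \<alpha>"
    have "ereal 0 + ereal K * ?D \<le> ereal \<alpha>"
    proof (rule ereal_add_mult_le[of _ _ _ _ 0])
      show "0 + K * l \<le> \<alpha>" if "0 < l" "ereal l < ?D" for l
        using exponent_ge[OF \<Phi> \<alpha> that] by simp
    qed (use D0 K_pos exponent_nonneg[OF \<Phi> \<alpha>] in auto)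
    then show "ereal K * ?D \<le> ereal \<alpha>" by simp
  qed
qed

end

section \<open>The four combinations of rates\<close>

theorem theorem4p1:
  fixes p0 :: real and p a :: "nat \<Rightarrow> real" and \<Phi> :: "real \<Rightarrow> real"
    and \<mu> :: "real measure" and L :: ereal
  assumes "p0 \<ge> 0"
    and "\<mu> = atomic_measure p0 p a"
    and "dimension_function \<Phi>"
    and "L = Limsup (at_right 0) (\<lambda>x. 1 / ereal (\<Phi> x))"
  shows
    "(\<forall>\<beta> lam s t :: real.
        \<beta> > 1 \<and> lam > 0 \<and>
        (\<forall>n\<ge>1. p n = real n powr (-\<beta>) \<and> a n = real n powr (-lam)) \<and>
        s = (\<beta> - 1) / lam \<and> t = \<beta> / (lam + 1) \<longrightarrow>
        (p0 = 0 \<longrightarrow>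
           (L \<ge> ereal lam \<longrightarrow> upper_Phi_dim \<Phi> \<mu> = ereal (max 1 s)) \<and>
           (L \<le> ereal lam \<longrightarrow>
              upper_Phi_dim \<Phi> \<mu> = max (ereal t + L * ereal (t - s)) (ereal s))) \<and>
        (p0 \<noteq> 0 \<longrightarrow>
           (L \<ge> ereal lam \<longrightarrow> upper_Phi_dim \<Phi> \<mu> = ereal s * L + ereal (max 1 s)) \<and>
           (L \<le> ereal lam \<longrightarrow> upper_Phi_dim \<Phi> \<mu> = (1 + L) * ereal (max s t)))) \<and>
     (\<forall>\<beta> lam :: real.
        \<beta> > 1 \<and> lam > 1 \<and>
        (\<forall>n\<ge>1. p n = \<beta> powr (- real n) \<and> a n = lam powr (- real n)) \<longrightarrow>
        (p0 \<noteq> 0 \<longrightarrow> upper_Phi_dim \<Phi> \<mu> = (1 + L) * ereal (ln \<beta> / ln lam)) \<and>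
        (p0 = 0 \<longrightarrow> upper_Phi_dim \<Phi> \<mu> = ereal (ln \<beta> / ln lam))) \<and>
     (\<forall>\<beta> lam :: real.
        \<beta> > 1 \<and> lam > 0 \<and>
        (\<forall>n\<ge>1. p n = \<beta> powr (- real n) \<and> a n = real n powr (-lam)) \<longrightarrow>
        upper_Phi_dim \<Phi> \<mu> = \<infinity>) \<and>
     (\<forall>\<beta> lam :: real.
        \<beta> > 1 \<and> lam > 1 \<and>
        (\<forall>n\<ge>1. p n = real n powr (-\<beta>) \<and> a n = lam powr (- real n)) \<longrightarrow>
        (p0 \<noteq> 0 \<longrightarrow>
           upper_Phi_dim \<Phi> \<mu> =
             Limsup (at_right 0) (\<lambda>x. ereal \<beta> * (ereal (Psi x) / ereal (\<Phi> x)))) \<and>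
        (p0 = 0 \<longrightarrow>
           upper_Phi_dim \<Phi> \<mu> = Limsup (at_right 0) (\<lambda>x. ereal (Psi x) / ereal (\<Phi> x))))"
proof (intro conjI)
  let ?D = "upper_Phi_dim \<Phi> \<mu>"
  have L: "L = Phi_rate (\<lambda>_. 1) \<Phi>"
    using assms(4) by (simp only: Phi_rate_def one_ereal_def)
  note \<Phi> = assms(3)
  show "\<forall>\<beta> lam s t :: real.
        \<beta> > 1 \<and> lam > 0 \<and>
        (\<forall>n\<ge>1. p n = real n powr (-\<beta>) \<and> a n = real n powr (-lam)) \<and>
        s = (\<beta> - 1) / lam \<and> t = \<beta> / (lam + 1) \<longrightarrow>
        (p0 = 0 \<longrightarrow>
           (L \<ge> ereal lam \<longrightarrow> ?D = ereal (max 1 s)) \<and>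
           (L \<le> ereal lam \<longrightarrow> ?D = max (ereal t + L * ereal (t - s)) (ereal s))) \<and>
        (p0 \<noteq> 0 \<longrightarrow>
           (L \<ge> ereal lam \<longrightarrow> ?D = ereal s * L + ereal (max 1 s)) \<and>
           (L \<le> ereal lam \<longrightarrow> ?D = (1 + L) * ereal (max s t)))"
  proof (intro allI impI)
    fix \<beta> lam s t :: real
    assume H: "\<beta> > 1 \<and> lam > 0 \<and>
        (\<forall>n\<ge>1. p n = real n powr (-\<beta>) \<and> a n = real n powr (-lam)) \<and>
        s = (\<beta> - 1) / lam \<and> t = \<beta> / (lam + 1)"
    interpret poly_poly p0 p a \<beta> lam by unfold_locales (use H assms(1) in auto)
    have st: "s = poly_poly.s \<beta> lam" "t = poly_poly.t \<beta> lam" using H by (simp_all add: s_def t_def)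
    show "(p0 = 0 \<longrightarrow>
           (L \<ge> ereal lam \<longrightarrow> ?D = ereal (max 1 s)) \<and>
           (L \<le> ereal lam \<longrightarrow> ?D = max (ereal t + L * ereal (t - s)) (ereal s))) \<and>
        (p0 \<noteq> 0 \<longrightarrow>
           (L \<ge> ereal lam \<longrightarrow> ?D = ereal s * L + ereal (max 1 s)) \<and>
           (L \<le> ereal lam \<longrightarrow> ?D = (1 + L) * ereal (max s t)))"
      unfolding st L assms(2)
      using dim_no_atom_large_rate[OF \<Phi>] dim_no_atom_small_rate[OF \<Phi>]
        dim_atom_large_rate[OF \<Phi>] dim_atom_small_rate[OF \<Phi>] by blast
  qed
  show "\<forall>\<beta> lam :: real.
        \<beta> > 1 \<and> lam > 1 \<and>
        (\<forall>n\<ge>1. p n = \<beta> powr (- real n) \<and> a n = lam powr (- real n)) \<longrightarrow>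
        (p0 \<noteq> 0 \<longrightarrow> ?D = (1 + L) * ereal (ln \<beta> / ln lam)) \<and>
        (p0 = 0 \<longrightarrow> ?D = ereal (ln \<beta> / ln lam))"
  proof (intro allI impI)
    fix \<beta> lam :: real
    assume H: "\<beta> > 1 \<and> lam > 1 \<and>
        (\<forall>n\<ge>1. p n = \<beta> powr (- real n) \<and> a n = lam powr (- real n))"
    interpret exp_exp p0 p a \<beta> lam by unfold_locales (use H assms(1) in auto)
    show "(p0 \<noteq> 0 \<longrightarrow> ?D = (1 + L) * ereal (ln \<beta> / ln lam)) \<and> (p0 = 0 \<longrightarrow> ?D = ereal (ln \<beta> / ln lam))"
      unfolding L assms(2) s_def[symmetric] using dim_atom[OF \<Phi>] dim_no_atom[OF \<Phi>] by blast
  qed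
  show "\<forall>\<beta> lam :: real.
        \<beta> > 1 \<and> lam > 0 \<and>
        (\<forall>n\<ge>1. p n = \<beta> powr (- real n) \<and> a n = real n powr (-lam)) \<longrightarrow> ?D = \<infinity>"
  proof (intro allI impI)
    fix \<beta> lam :: real
    assume H: "\<beta> > 1 \<and> lam > 0 \<and>
        (\<forall>n\<ge>1. p n = \<beta> powr (- real n) \<and> a n = real n powr (-lam))"
    interpret exp_poly p0 p a \<beta> lam by unfold_locales (use H assms(1) in auto)
    show "?D = \<infinity>" unfolding assms(2) by (rule dim_eq_infinity[OF \<Phi>])
  qed
  show "\<forall>\<beta> lam :: real.
        \<beta> > 1 \<and> lam > 1 \<and>
        (\<forall>n\<ge>1. p n = real n powr (-\<beta>) \<and> a n = lam powr (- real n)) \<longrightarrow>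
        (p0 \<noteq> 0 \<longrightarrow> ?D = Limsup (at_right 0) (\<lambda>x. ereal \<beta> * (ereal (Psi x) / ereal (\<Phi> x)))) \<and>
        (p0 = 0 \<longrightarrow> ?D = Limsup (at_right 0) (\<lambda>x. ereal (Psi x) / ereal (\<Phi> x)))"
  proof (intro allI impI)
    fix \<beta> lam :: real
    assume H: "\<beta> > 1 \<and> lam > 1 \<and>
        (\<forall>n\<ge>1. p n = real n powr (-\<beta>) \<and> a n = lam powr (- real n))"
    interpret poly_exp p0 p a \<beta> lam by unfold_locales (use H assms(1) in auto)
    have "Limsup (at_right 0) (\<lambda>x. ereal \<beta> * (ereal (Psi x) / ereal (\<Phi> x))) = ereal \<beta> * Phi_rate Psi \<Phi>"
      unfolding Phi_rate_def using H by (intro Limsup_ereal_mult_left) auto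
    moreover have "p0 = 0 \<Longrightarrow> poly_exp.K p0 \<beta> = 1" "p0 \<noteq> 0 \<Longrightarrow> poly_exp.K p0 \<beta> = \<beta>"
      unfolding K_def by simp_all
    ultimately show "(p0 \<noteq> 0 \<longrightarrow> ?D = Limsup (at_right 0) (\<lambda>x. ereal \<beta> * (ereal (Psi x) / ereal (\<Phi> x)))) \<and>
        (p0 = 0 \<longrightarrow> ?D = Limsup (at_right 0) (\<lambda>x. ereal (Psi x) / ereal (\<Phi> x)))"
      using dim_eq[OF \<Phi>] unfolding assms(2) Phi_rate_def by auto
  qed
qed

end
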